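(* Let $W$ be a complex reflection group with braid group $B$ and pure braid group $P$, and let $d$ be a freely regular number with respect to $W$. Then there exists $b\in B/(P,P)$ of order $d$.
   Context: A complex reflection group is a finite subgroup $W<\mathrm{GL}_n(\mathbf{C})$ generated by (pseudo-)reflections, i.e. elements $\neq 1$ fixing pointwise a hyperplane. $\mathcal{A}$ is the set of reflecting hyperplanes of $W$, and $X=\mathbf{C}^n\setminus\bigcup\mathcal{A}$. The group $W$ acts freely on $X$; $P=\pi_1(X)$ (pure braid group) and $B=\pi_1(X/W)$ (braid group), so there is an exact sequence $1\to P\to B\to W\to 1$. $(P,P)$ is the commutator subgroup of $P$. If $w\in W$ has an eigenvector $x\in X$, with eigenvalue of (multiplicative) order $d$, then $w$ is called a regular element and $d$ a regular number for $W$; such a $w$ necessarily has order $d$. One says that $w$ and $d$ are freely regular if in addition the cyclic group $\langle w\rangle$ acts freely on the set $\mathcal{A}$. *)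

theory Defs
  imports "HOL-Analysis.Analysis" "HOL-Algebra.Multiplicative_Group"
begin

section \<open>The fundamental group of an abstract topological space\<close>

text \<open>
  The orbit space of a reflection group is not carried by a type with a \<open>topological_space\<close>
  instance, so the homotopy notions for \<open>path\<close> do not apply to it. What follows is their
  analogue for values of type \<open>'a topology\<close>. As in \<open>homotopic_paths\<close>, a path is a function on
  all of \<open>real\<close> of which only the values on \<open>[0,1]\<close> matter: two loops that agree on \<open>[0,1]\<close> are
  homotopic.
\<close>

definition loops :: "'a topology \<Rightarrow> 'a \<Rightarrow> (real \<Rightarrow> 'a) set"
  where "loops Y y = {g. pathin Y g \<and> g 0 = y \<and> g 1 = y}"

definition loop_homotopic :: "'a topology \<Rightarrow> 'a \<Rightarrow> (real \<Rightarrow> 'a) \<Rightarrow> (real \<Rightarrow> 'a) \<Rightarrow> bool"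
  where "loop_homotopic Y y = homotopic_with (\<lambda>h. h 0 = y \<and> h 1 = y) (top_of_set {0..1}) Y"

definition loop_class :: "'a topology \<Rightarrow> 'a \<Rightarrow> (real \<Rightarrow> 'a) \<Rightarrow> (real \<Rightarrow> 'a) set"
  where "loop_class Y y f = {g \<in> loops Y y. loop_homotopic Y y f g}"

definition loop_join :: "(real \<Rightarrow> 'a) \<Rightarrow> (real \<Rightarrow> 'a) \<Rightarrow> real \<Rightarrow> 'a"
  where "loop_join f g = (\<lambda>t. if t \<le> 1/2 then f (2 * t) else g (2 * t - 1))"

definition pi1 :: "'a topology \<Rightarrow> 'a \<Rightarrow> (real \<Rightarrow> 'a) set monoid"
  where "pi1 Y y =
    \<lparr>carrier = loop_class Y y ` loops Y y,
     mult = (\<lambda>A B. \<Union>f\<in>A. \<Union>g\<in>B. loop_class Y y (loop_join f g)),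
     one = loop_class Y y (\<lambda>t. y)\<rparr>"

text \<open>The homomorphism \<open>pi1 Y y \<rightarrow> pi1 Z (p y)\<close> induced by a continuous map \<open>p\<close> from \<open>Y\<close> to \<open>Z\<close>;
  the argument \<open>z\<close> is \<open>p y\<close>.\<close>

definition pi1_map :: "'b topology \<Rightarrow> 'b \<Rightarrow> ('a \<Rightarrow> 'b) \<Rightarrow> (real \<Rightarrow> 'a) set \<Rightarrow> (real \<Rightarrow> 'b) set"
  where "pi1_map Z z p A = (\<Union>f\<in>A. loop_class Z z (p \<circ> f))"

lemma loop_homotopic_loops:
  assumes "loop_homotopic Y y f g"
  shows "f \<in> loops Y y" "g \<in> loops Y y"
  using homotopic_with_imp_continuous_maps[OF assms[unfolded loop_homotopic_def]]
    homotopic_with_imp_property[OF assms[unfolded loop_homotopic_def]]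
  by (auto simp: loops_def pathin_def)

lemma loop_homotopic_refl: "f \<in> loops Y y \<Longrightarrow> loop_homotopic Y y f f"
  by (simp add: loop_homotopic_def loops_def pathin_def)

lemma loop_homotopic_sym: "loop_homotopic Y y f g \<Longrightarrow> loop_homotopic Y y g f"
  unfolding loop_homotopic_def by (rule homotopic_with_symD)

lemma loop_homotopic_trans:
  "loop_homotopic Y y f g \<Longrightarrow> loop_homotopic Y y g h \<Longrightarrow> loop_homotopic Y y f h"
  unfolding loop_homotopic_def by (rule homotopic_with_trans)

lemma loop_class_eq:
  assumes "loop_homotopic Y y f g"
  shows "loop_class Y y f = loop_class Y y g"
proof -
  have "loop_homotopic Y y f h \<longleftrightarrow> loop_homotopic Y y g h" for h
    using loop_homotopic_trans[OF assms, of h]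
      loop_homotopic_trans[OF loop_homotopic_sym[OF assms], of h] by (rule iffI[rotated])
  then show ?thesis
    by (simp add: loop_class_def)
qed

lemma loop_class_self: "f \<in> loops Y y \<Longrightarrow> f \<in> loop_class Y y f"
  by (simp add: loop_class_def loop_homotopic_refl)

lemma loop_class_memD: "g \<in> loop_class Y y f \<Longrightarrow> loop_homotopic Y y f g"
  by (simp add: loop_class_def)

lemma loop_homotopic_join:
  assumes f: "loop_homotopic Y y f f'" and g: "loop_homotopic Y y g g'"
  shows "loop_homotopic Y y (loop_join f g) (loop_join f' g')"
proof -
  let ?I = "top_of_set {0..1::real}"
  let ?II = "prod_topology ?I ?I"
  obtain h where h: "continuous_map ?II Y h" "\<And>x. h (0, x) = f x" "\<And>x. h (1, x) = f' x"
      "\<And>t. t \<in> {0..1} \<Longrightarrow> h (t, 0) = y \<and> h (t, 1) = y"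
    using f unfolding loop_homotopic_def homotopic_with_def by auto
  obtain k where k: "continuous_map ?II Y k" "\<And>x. k (0, x) = g x" "\<And>x. k (1, x) = g' x"
      "\<And>t. t \<in> {0..1} \<Longrightarrow> k (t, 0) = y \<and> k (t, 1) = y"
    using g unfolding loop_homotopic_def homotopic_with_def by auto
  let ?H = "\<lambda>z::real \<times> real. if snd z \<le> 1/2 then h (fst z, 2 * snd z) else k (fst z, 2 * snd z - 1)"
  have II: "?II = top_of_set ({0..1} \<times> {0..1})"
    by (simp add: euclidean_product_topology flip: subtopology_Times)
  have "continuous_map ?II Y ?H"
  proof (rule continuous_map_cases_le)
    show "continuous_map ?II euclideanreal snd" "continuous_map ?II euclideanreal (\<lambda>z. 1/2)"
      unfolding II by (auto intro!: continuous_intros)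
    have "continuous_map (subtopology ?II {z \<in> topspace ?II. snd z \<le> 1/2}) ?II
        (\<lambda>z. (fst z, 2 * snd z))"
      unfolding II by (auto simp: subtopology_subtopology intro!: continuous_intros)
    from continuous_map_compose[OF this h(1)]
    show "continuous_map (subtopology ?II {z \<in> topspace ?II. snd z \<le> 1/2}) Y
        (\<lambda>z. h (fst z, 2 * snd z))"
      by (simp add: o_def)
    have "continuous_map (subtopology ?II {z \<in> topspace ?II. 1/2 \<le> snd z}) ?II
        (\<lambda>z. (fst z, 2 * snd z - 1))"
      unfolding II by (auto simp: subtopology_subtopology intro!: continuous_intros)
    from continuous_map_compose[OF this k(1)]
    show "continuous_map (subtopology ?II {z \<in> topspace ?II. 1/2 \<le> snd z}) Y
        (\<lambda>z. k (fst z, 2 * snd z - 1))"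
      by (simp add: o_def)
    show "h (fst z, 2 * snd z) = k (fst z, 2 * snd z - 1)"
      if "z \<in> topspace ?II" "snd z = 1/2" for z
    proof -
      have "2 * snd z = 1" "fst z \<in> {0..1}"
        using that by (auto simp: II)
      then show ?thesis
        using h(4)[of "fst z"] k(4)[of "fst z"] by simp
    qed
  qed
  then show ?thesis
    unfolding loop_homotopic_def homotopic_with_def
    by (intro exI[of _ ?H]) (use h(2-4) k(2-4) in \<open>auto simp: loop_join_def\<close>)
qed

lemma loop_join_loops:
  assumes "f \<in> loops Y y" "g \<in> loops Y y"
  shows "loop_join f g \<in> loops Y y"
  using loop_homotopic_join[OF loop_homotopic_refl loop_homotopic_refl, OF assms]
  by (rule loop_homotopic_loops)

lemma loop_homotopic_reparam:
  assumes f: "f \<in> loops Y y"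
    and u: "continuous_on {0..1} u" "u ` {0..1} \<subseteq> {0..1}"
    and v: "continuous_on {0..1} v" "v ` {0..1} \<subseteq> {0..1}"
    and eq: "u 0 = v 0" "u 1 = v 1"
    and ends: "u 0 \<in> {0, 1}" "u 1 \<in> {0, 1}"
  shows "loop_homotopic Y y (f \<circ> u) (f \<circ> v)"
proof -
  let ?I = "top_of_set {0..1::real}"
  let ?k = "\<lambda>z::real \<times> real. (1 - fst z) * u (snd z) + fst z * v (snd z)"
  have II: "prod_topology ?I ?I = top_of_set ({0..1} \<times> {0..1})"
    by (simp add: euclidean_product_topology flip: subtopology_Times)
  have mem: "?k z \<in> {0..1}" if "z \<in> {0..1} \<times> {0..1}" for z
  proof -
    have "u (snd z) \<in> {0..1}" "v (snd z) \<in> {0..1}" "fst z \<in> {0..1}"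
      using that u(2) v(2) by (auto simp: image_subset_iff mem_Times_iff)
    then show ?thesis
      using convexD[of "{0..1::real}" "u (snd z)" "v (snd z)" "1 - fst z" "fst z"] by auto
  qed
  have "continuous_on ({0..1} \<times> {0..1}) (\<lambda>z::real \<times> real. u (snd z))"
    by (rule continuous_on_compose2[OF u(1)]) (auto intro!: continuous_intros)
  moreover have "continuous_on ({0..1} \<times> {0..1}) (\<lambda>z::real \<times> real. v (snd z))"
    by (rule continuous_on_compose2[OF v(1)]) (auto intro!: continuous_intros)
  ultimately have "continuous_on ({0..1} \<times> {0..1}) ?k"
    by (intro continuous_intros)
  then have k: "continuous_map (prod_topology ?I ?I) ?I ?k"
    unfolding II using mem by auto
  have "continuous_map ?I Y f"
    using f by (simp add: loops_def pathin_def)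
  from continuous_map_compose[OF k this]
  have "continuous_map (prod_topology ?I ?I) Y (f \<circ> ?k)" .
  moreover have "f (u 0) = y" "f (u 1) = y"
    using ends f by (auto simp: loops_def)
  moreover have "(1 - t) * v 0 + t * v 0 = v 0" "(1 - t) * v 1 + t * v 1 = v 1" for t
    by (simp_all add: algebra_simps)
  ultimately show ?thesis
    unfolding loop_homotopic_def homotopic_with_def
    by (intro exI[of _ "f \<circ> ?k"]) (auto simp: eq)
qed

lemma const_loop: "y \<in> topspace Y \<Longrightarrow> (\<lambda>t. y) \<in> loops Y y"
  by (simp add: loops_def pathin_def)

lemma loop_join_assoc:
  assumes "f \<in> loops Y y" "g \<in> loops Y y" "h \<in> loops Y y"
  shows "loop_homotopic Y y (loop_join (loop_join f g) h) (loop_join f (loop_join g h))"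
proof -
  let ?J = "loop_join f (loop_join g h)"
  let ?u = "\<lambda>t::real. min (2 * t) (min (t + 1/4) (t / 2 + 1/2))"
  have J: "?J \<in> loops Y y"
    using assms by (simp add: loop_join_loops)
  have gh: "f 1 = y" "g 0 = y" "g 1 = y" "h 0 = y"
    using assms by (auto simp: loops_def)
  have "loop_homotopic Y y (?J \<circ> ?u) (?J \<circ> (\<lambda>t. t))"
    by (rule loop_homotopic_reparam[OF J]) (auto intro!: continuous_intros)
  moreover have "?J \<circ> ?u = loop_join (loop_join f g) h"
  proof
    fix t :: real
    consider "t \<le> 1/4" | "1/4 < t" "t \<le> 1/2" | "1/2 < t" by linarith
    then show "(?J \<circ> ?u) t = loop_join (loop_join f g) h t"
    proof cases
      case 1
      then have "?u t = 2 * t" by (simp add: min_def)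
      with 1 show ?thesis by (simp add: loop_join_def)
    next
      case 2
      then have "?u t = t + 1/4" by (simp add: min_def)
      with 2 show ?thesis by (simp add: loop_join_def algebra_simps)
    next
      case 3
      then have "?u t = t / 2 + 1/2" by (simp add: min_def)
      with 3 show ?thesis by (simp add: loop_join_def algebra_simps)
    qed
  qed
  ultimately show ?thesis by (simp add: o_def)
qed

lemma loop_join_const_left:
  assumes "f \<in> loops Y y"
  shows "loop_homotopic Y y (loop_join (\<lambda>t. y) f) f"
proof -
  let ?u = "\<lambda>t::real. max 0 (2 * t - 1)"
  have "loop_homotopic Y y (f \<circ> ?u) (f \<circ> (\<lambda>t. t))"
    by (rule loop_homotopic_reparam[OF assms]) (auto intro!: continuous_intros)
  moreover have "f \<circ> ?u = loop_join (\<lambda>t. y) f"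
  proof
    fix t :: real
    consider "2 * t < 1" | "2 * t = 1" | "2 * t > 1" by linarith
    then show "(f \<circ> ?u) t = loop_join (\<lambda>t. y) f t"
      using assms by cases (auto simp: loop_join_def loops_def max_def)
  qed
  ultimately show ?thesis by (simp add: o_def)
qed

lemma loop_join_reverse:
  assumes "f \<in> loops Y y"
  shows "(\<lambda>t. f (1 - t)) \<in> loops Y y"
    and "loop_homotopic Y y (loop_join (\<lambda>t. f (1 - t)) f) (\<lambda>t. y)"
proof -
  have "loop_homotopic Y y (f \<circ> (\<lambda>t. 1 - t)) (f \<circ> (\<lambda>t. 1 - t))"
    by (rule loop_homotopic_reparam[OF assms]) (auto intro!: continuous_intros)
  then show "(\<lambda>t. f (1 - t)) \<in> loops Y y"
    using loop_homotopic_loops(1) by (fastforce simp: o_def)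
  let ?u = "\<lambda>t::real. max (1 - 2 * t) (2 * t - 1)"
  have "loop_homotopic Y y (f \<circ> ?u) (f \<circ> (\<lambda>t. 1))"
    by (rule loop_homotopic_reparam[OF assms]) (auto intro!: continuous_intros)
  moreover have "f \<circ> ?u = loop_join (\<lambda>t. f (1 - t)) f"
  proof
    fix t :: real
    consider "2 * t < 1" | "2 * t = 1" | "2 * t > 1" by linarith
    then show "(f \<circ> ?u) t = loop_join (\<lambda>t. f (1 - t)) f t"
      by cases (auto simp: loop_join_def max_def)
  qed
  moreover have "f 1 = y"
    using assms by (simp add: loops_def)
  ultimately show "loop_homotopic Y y (loop_join (\<lambda>t. f (1 - t)) f) (\<lambda>t. y)"
    by (simp add: o_def)
qed

lemma pi1_mult:
  assumes "f \<in> loops Y y" "g \<in> loops Y y"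
  shows "loop_class Y y f \<otimes>\<^bsub>pi1 Y y\<^esub> loop_class Y y g = loop_class Y y (loop_join f g)"
proof -
  have "loop_class Y y (loop_join f' g') = loop_class Y y (loop_join f g)"
    if "f' \<in> loop_class Y y f" "g' \<in> loop_class Y y g" for f' g'
    using loop_class_eq[OF loop_homotopic_join[OF that[THEN loop_class_memD]]] by simp
  then have "(\<Union>f'\<in>loop_class Y y f. \<Union>g'\<in>loop_class Y y g. loop_class Y y (loop_join f' g'))
      = (\<Union>f'\<in>loop_class Y y f. \<Union>g'\<in>loop_class Y y g. loop_class Y y (loop_join f g))"
    by (intro SUP_cong refl)
  moreover have "loop_class Y y f \<noteq> {}" "loop_class Y y g \<noteq> {}"
    using loop_class_self[OF assms(1)] loop_class_self[OF assms(2)] by blast+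
  ultimately show ?thesis
    by (simp add: pi1_def)
qed

lemma group_pi1:
  assumes y: "y \<in> topspace Y"
  shows "group (pi1 Y y)"
proof (rule groupI)
  have car: "carrier (pi1 Y y) = loop_class Y y ` loops Y y"
    and one: "\<one>\<^bsub>pi1 Y y\<^esub> = loop_class Y y (\<lambda>t. y)"
    by (simp_all add: pi1_def)
  show "\<one>\<^bsub>pi1 Y y\<^esub> \<in> carrier (pi1 Y y)"
    unfolding car one by (rule imageI[OF const_loop[OF y]])
  show "A \<otimes>\<^bsub>pi1 Y y\<^esub> B \<in> carrier (pi1 Y y)"
    if AB: "A \<in> carrier (pi1 Y y)" "B \<in> carrier (pi1 Y y)" for A B
  proof -
    obtain f g where A: "A = loop_class Y y f" and B: "B = loop_class Y y g"
        and f: "f \<in> loops Y y" and g: "g \<in> loops Y y"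
      using AB by (auto simp: car)
    show ?thesis
      unfolding A B pi1_mult[OF f g] car by (rule imageI[OF loop_join_loops[OF f g]])
  qed
  show "A \<otimes>\<^bsub>pi1 Y y\<^esub> B \<otimes>\<^bsub>pi1 Y y\<^esub> C = A \<otimes>\<^bsub>pi1 Y y\<^esub> (B \<otimes>\<^bsub>pi1 Y y\<^esub> C)"
    if ABC: "A \<in> carrier (pi1 Y y)" "B \<in> carrier (pi1 Y y)" "C \<in> carrier (pi1 Y y)" for A B C
  proof -
    obtain f g h where A: "A = loop_class Y y f" and B: "B = loop_class Y y g"
        and C: "C = loop_class Y y h"
        and f: "f \<in> loops Y y" and g: "g \<in> loops Y y" and h: "h \<in> loops Y y"
      using ABC by (auto simp: car)
    show ?thesis
      unfolding A B C pi1_mult[OF f g] pi1_mult[OF g h] pi1_mult[OF loop_join_loops[OF f g] h]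
        pi1_mult[OF f loop_join_loops[OF g h]]
      by (rule loop_class_eq[OF loop_join_assoc[OF f g h]])
  qed
  show "\<one>\<^bsub>pi1 Y y\<^esub> \<otimes>\<^bsub>pi1 Y y\<^esub> A = A" if A': "A \<in> carrier (pi1 Y y)" for A
  proof -
    obtain f where A: "A = loop_class Y y f" and f: "f \<in> loops Y y"
      using A' by (auto simp: car)
    show ?thesis
      unfolding A one pi1_mult[OF const_loop[OF y] f]
      by (rule loop_class_eq[OF loop_join_const_left[OF f]])
  qed
  show "\<exists>B\<in>carrier (pi1 Y y). B \<otimes>\<^bsub>pi1 Y y\<^esub> A = \<one>\<^bsub>pi1 Y y\<^esub>"
    if A: "A \<in> carrier (pi1 Y y)" for A
  proof -
    obtain f where f: "f \<in> loops Y y" "A = loop_class Y y f"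
      using A by (auto simp: car)
    note rev = loop_join_reverse[OF f(1)]
    have "loop_class Y y (\<lambda>t. f (1 - t)) \<otimes>\<^bsub>pi1 Y y\<^esub> A = \<one>\<^bsub>pi1 Y y\<^esub>"
      by (simp only: f(2) one pi1_mult[OF rev(1) f(1)] loop_class_eq[OF rev(2)])
    then show ?thesis
      by (rule bexI) (unfold car, rule imageI[OF rev(1)])
  qed
qed

lemma pi1_map_class:
  assumes p: "continuous_map Y Z p" and f: "f \<in> loops Y y"
  shows "p \<circ> f \<in> loops Z (p y)"
    and "pi1_map Z (p y) p (loop_class Y y f) = loop_class Z (p y) (p \<circ> f)"
proof -
  have *: "loop_homotopic Z (p y) (p \<circ> f) (p \<circ> g)" if "loop_homotopic Y y f g" for g
    using that unfolding loop_homotopic_def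
    by (rule homotopic_with_compose_continuous_map_left[OF _ p]) (simp add: o_def)
  show "p \<circ> f \<in> loops Z (p y)"
    by (rule loop_homotopic_loops(1)[OF *[OF loop_homotopic_refl[OF f]]])
  have "loop_class Z (p y) (p \<circ> g) = loop_class Z (p y) (p \<circ> f)" if "g \<in> loop_class Y y f" for g
    using loop_class_eq[OF *[OF loop_class_memD[OF that]]] by simp
  then have "pi1_map Z (p y) p (loop_class Y y f) =
      (\<Union>g\<in>loop_class Y y f. loop_class Z (p y) (p \<circ> f))"
    unfolding pi1_map_def by (intro SUP_cong refl)
  moreover have "loop_class Y y f \<noteq> {}"
    using loop_class_self[OF f] by blast
  ultimately show "pi1_map Z (p y) p (loop_class Y y f) = loop_class Z (p y) (p \<circ> f)"
    by simp
qed

lemma pi1_map_hom: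
  assumes p: "continuous_map Y Z p"
  shows "pi1_map Z (p y) p \<in> hom (pi1 Y y) (pi1 Z (p y))"
proof -
  have join: "p \<circ> loop_join f g = loop_join (p \<circ> f) (p \<circ> g)" for f g
    by (rule ext) (simp add: loop_join_def)
  have car: "carrier (pi1 Y y) = loop_class Y y ` loops Y y"
    "carrier (pi1 Z (p y)) = loop_class Z (p y) ` loops Z (p y)"
    by (simp_all add: pi1_def)
  show ?thesis
  proof (rule homI)
    show "pi1_map Z (p y) p A \<in> carrier (pi1 Z (p y))" if A: "A \<in> carrier (pi1 Y y)" for A
    proof -
      obtain f where f: "f \<in> loops Y y" "A = loop_class Y y f"
        using A by (auto simp: car)
      show ?thesis
        unfolding f(2) pi1_map_class(2)[OF p f(1)] car
        by (rule imageI[OF pi1_map_class(1)[OF p f(1)]])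
    qed
    show "pi1_map Z (p y) p (A \<otimes>\<^bsub>pi1 Y y\<^esub> B) =
        pi1_map Z (p y) p A \<otimes>\<^bsub>pi1 Z (p y)\<^esub> pi1_map Z (p y) p B"
      if AB: "A \<in> carrier (pi1 Y y)" "B \<in> carrier (pi1 Y y)" for A B
    proof -
      obtain f g where A: "A = loop_class Y y f" and B: "B = loop_class Y y g"
          and f: "f \<in> loops Y y" and g: "g \<in> loops Y y"
        using AB by (auto simp: car)
      show ?thesis
        unfolding A B pi1_mult[OF f g] pi1_map_class(2)[OF p f] pi1_map_class(2)[OF p g]
          pi1_map_class(2)[OF p loop_join_loops[OF f g]] join
        by (rule pi1_mult[OF pi1_map_class(1)[OF p f] pi1_map_class(1)[OF p g], symmetric])
    qed
  qed
qed


section \<open>Quotient topologies\<close>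

definition quotient_topology :: "'a topology \<Rightarrow> ('a \<Rightarrow> 'b) \<Rightarrow> 'b topology"
  where "quotient_topology Y q =
    topology (\<lambda>U. U \<subseteq> q ` topspace Y \<and> openin Y {x \<in> topspace Y. q x \<in> U})"

lemma openin_quotient_topology:
  "openin (quotient_topology Y q) U \<longleftrightarrow>
    U \<subseteq> q ` topspace Y \<and> openin Y {x \<in> topspace Y. q x \<in> U}"
proof -
  have "istopology (\<lambda>U. U \<subseteq> q ` topspace Y \<and> openin Y {x \<in> topspace Y. q x \<in> U})"
    unfolding istopology_def
  proof (intro conjI allI impI)
    fix S T
    assume *: "S \<subseteq> q ` topspace Y \<and> openin Y {x \<in> topspace Y. q x \<in> S}"
      "T \<subseteq> q ` topspace Y \<and> openin Y {x \<in> topspace Y. q x \<in> T}"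
    then show "S \<inter> T \<subseteq> q ` topspace Y" by blast
    have "{x \<in> topspace Y. q x \<in> S \<inter> T} = {x \<in> topspace Y. q x \<in> S} \<inter> {x \<in> topspace Y. q x \<in> T}"
      by blast
    with * show "openin Y {x \<in> topspace Y. q x \<in> S \<inter> T}" by auto
  next
    fix K
    assume *: "\<forall>S\<in>K. S \<subseteq> q ` topspace Y \<and> openin Y {x \<in> topspace Y. q x \<in> S}"
    then show "\<Union>K \<subseteq> q ` topspace Y" by blast
    have "{x \<in> topspace Y. q x \<in> \<Union>K} = (\<Union>S\<in>K. {x \<in> topspace Y. q x \<in> S})"
      by blast
    with * show "openin Y {x \<in> topspace Y. q x \<in> \<Union>K}" by auto
  qed
  then show ?thesis
    unfolding quotient_topology_def by (simp add: topology_inverse')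
qed

lemma topspace_quotient_topology: "topspace (quotient_topology Y q) = q ` topspace Y"
proof -
  have "{x \<in> topspace Y. q x \<in> q ` topspace Y} = topspace Y" by blast
  then have "openin (quotient_topology Y q) (q ` topspace Y)"
    by (simp add: openin_quotient_topology)
  then show ?thesis
    using openin_subset openin_topspace openin_quotient_topology by (metis subset_antisym)
qed

lemma quotient_map_quotient_topology: "quotient_map Y (quotient_topology Y q) q"
  by (auto simp: quotient_map_def topspace_quotient_topology openin_quotient_topology)


section \<open>Complex reflection groups\<close>

definition GL :: "(complex^'n^'n) monoid"
  where "GL = \<lparr>carrier = {A. invertible A}, mult = (**), one = mat 1\<rparr>"

definition hyperplane :: "(complex^'n) set \<Rightarrow> bool"
  where "hyperplane H \<longleftrightarrow> vec.subspace H \<and> vec.dim H + 1 = CARD('n)"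

definition reflection_along :: "complex^'n^'n \<Rightarrow> (complex^'n) set \<Rightarrow> bool"
  where "reflection_along s H \<longleftrightarrow>
    s \<in> carrier GL \<and> s \<noteq> mat 1 \<and> hyperplane H \<and> (\<forall>v\<in>H. s *v v = v)"

definition complex_reflection_group :: "(complex^'n^'n) set \<Rightarrow> bool"
  where "complex_reflection_group W \<longleftrightarrow>
    finite W \<and> subgroup W GL \<and> W = generate GL {s \<in> W. \<exists>H. reflection_along s H}"

definition reflecting_hyperplanes :: "(complex^'n^'n) set \<Rightarrow> (complex^'n) set set"
  where "reflecting_hyperplanes W = {H. \<exists>s\<in>W. reflection_along s H}"

definition hyperplane_complement :: "(complex^'n^'n) set \<Rightarrow> (complex^'n) set"
  where "hyperplane_complement W = - \<Union>(reflecting_hyperplanes W)"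

definition orbit_of :: "(complex^'n^'n) set \<Rightarrow> complex^'n \<Rightarrow> (complex^'n) set"
  where "orbit_of W x = (\<lambda>w. w *v x) ` W"

definition orbit_space :: "(complex^'n^'n) set \<Rightarrow> (complex^'n) set topology"
  where "orbit_space W = quotient_topology (top_of_set (hyperplane_complement W)) (orbit_of W)"

definition pure_braid_group :: "(complex^'n^'n) set \<Rightarrow> complex^'n \<Rightarrow> (real \<Rightarrow> complex^'n) set monoid"
  where "pure_braid_group W x = pi1 (top_of_set (hyperplane_complement W)) x"

definition braid_group :: "(complex^'n^'n) set \<Rightarrow> complex^'n \<Rightarrow> (real \<Rightarrow> (complex^'n) set) set monoid"
  where "braid_group W x = pi1 (orbit_space W) (orbit_of W x)"

text \<open>\<open>W\<close> acts freely on \<open>hyperplane_complement W\<close>, so the projection to the orbit space is a covering and the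
  map it induces is injective: this is the inclusion of \<open>P\<close> in \<open>B\<close>.\<close>

definition pure_braid_incl ::
    "(complex^'n^'n) set \<Rightarrow> complex^'n \<Rightarrow> (real \<Rightarrow> complex^'n) set \<Rightarrow> (real \<Rightarrow> (complex^'n) set) set"
  where "pure_braid_incl W x = pi1_map (orbit_space W) (orbit_of W x) (orbit_of W)"

definition quasi_abelianized_braid_group ::
    "(complex^'n^'n) set \<Rightarrow> complex^'n \<Rightarrow> (real \<Rightarrow> (complex^'n) set) set set monoid"
  where "quasi_abelianized_braid_group W x =
    braid_group W x Mod
      pure_braid_incl W x ` derived (pure_braid_group W x) (carrier (pure_braid_group W x))"

definition root_of_unity_order :: "complex \<Rightarrow> nat \<Rightarrow> bool"
  where "root_of_unity_order \<zeta> d \<longleftrightarrow> 0 < d \<and> \<zeta> ^ d = 1 \<and> (\<forall>k. 0 < k \<and> k < d \<longrightarrow> \<zeta> ^ k \<noteq> 1)"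

text \<open>If \<open>W\<close> is trivial, the zero vector lies in \<open>hyperplane_complement W\<close>, so \<open>x \<noteq> 0\<close> has to be
  required separately.\<close>

definition regular_element :: "(complex^'n^'n) set \<Rightarrow> complex^'n^'n \<Rightarrow> nat \<Rightarrow> bool"
  where "regular_element W w d \<longleftrightarrow> w \<in> W \<and>
    (\<exists>x\<in>hyperplane_complement W. \<exists>\<zeta>. x \<noteq> 0 \<and> w *v x = \<zeta> *s x \<and> root_of_unity_order \<zeta> d)"

definition acts_freely_on_hyperplanes :: "(complex^'n^'n) set \<Rightarrow> (complex^'n^'n) set \<Rightarrow> bool"
  where "acts_freely_on_hyperplanes W C \<longleftrightarrow>
    (\<forall>g\<in>C. \<forall>H\<in>reflecting_hyperplanes W. (\<lambda>v. g *v v) ` H = H \<longrightarrow> g = mat 1)"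

definition freely_regular_number :: "(complex^'n^'n) set \<Rightarrow> nat \<Rightarrow> bool"
  where "freely_regular_number W d \<longleftrightarrow>
    (\<exists>w. regular_element W w d \<and> acts_freely_on_hyperplanes W (generate GL {w}))"

lemma group_GL: "group (GL :: (complex^'n^'n) monoid)"
proof (rule groupI)
  show "\<exists>B\<in>carrier GL. B \<otimes>\<^bsub>GL\<^esub> A = \<one>\<^bsub>GL\<^esub>" if "A \<in> carrier GL" for A :: "complex^'n^'n"
    using that by (auto simp: GL_def invertible_def)
  show "\<one>\<^bsub>GL\<^esub> \<in> carrier (GL :: (complex^'n^'n) monoid)"
    by (auto simp: GL_def invertible_def intro!: exI[of _ "mat 1"])
qed (auto simp: GL_def invertible_mult matrix_mul_assoc)

lemma group_pure_braid_group:
  "x \<in> hyperplane_complement W \<Longrightarrow> group (pure_braid_group W x)"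
  by (simp add: pure_braid_group_def group_pi1)

lemma group_braid_group:
  "x \<in> hyperplane_complement W \<Longrightarrow> group (braid_group W x)"
  by (simp add: braid_group_def group_pi1 orbit_space_def topspace_quotient_topology)

lemma pure_braid_incl_hom:
  "pure_braid_incl W x \<in> hom (pure_braid_group W x) (braid_group W x)"
  unfolding pure_braid_incl_def pure_braid_group_def braid_group_def
  by (rule pi1_map_hom)
    (simp add: orbit_space_def quotient_imp_continuous_map quotient_map_quotient_topology)

end

theory Submission
  imports Defs "HOL-Complex_Analysis.Conformal_Mappings"
begin

text \<open>
  Let \<open>X\<close> be the complement of the reflecting hyperplanes and \<open>g\<close> a power of the regular element
  with eigenvalue \<open>exp (2\<pi>i/d)\<close> on an eigenvector \<open>e\<close> in \<open>X\<close>. Turning \<open>e\<close> through the angle \<open>2\<pi>/d\<close> is a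
  path in \<open>X\<close> from \<open>e\<close> to \<open>g e\<close>, hence gives an element \<open>b\<close> of the braid group over \<open>g\<close>. Its power
  with exponent \<open>d\<close> is the full turn of \<open>e\<close>, the full twist, a pure braid. The element \<open>b\<close> has
  infinite order in general, but it can be corrected by a factor \<open>c\<close> from the abelian group
  \<open>P/(P,P)\<close>: since \<open>(c b)^d\<close> is the product of the conjugates of \<open>c\<close> by \<open>1, b, \<dots>, b^(d-1)\<close>, times
  the full twist, it suffices that the inverse of the full twist is a norm.

  In \<open>P/(P,P)\<close> a loop has a class independent of its base point. Each hyperplane \<open>H\<close> has a
  meridian, the class of a small circle around it; a braid over \<open>g\<close> conjugates the meridian of \<open>H\<close> to
  that of \<open>g H\<close> (\<open>qbraid_meridian\<close>), and the full twist is the product of all the meridians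
  (\<open>full_twist_eq_meridian_product\<close>). For the latter, deform the full twist to a large circle on a
  generic complex line; when the circle is contracted it crosses the hyperplanes one by one, and each
  crossing splits off a meridian (\<open>circle_crossing\<close>). Now the powers of \<open>g\<close> act freely on the
  hyperplanes. So for the inverse \<open>c\<close> of the product of the meridians of a set of orbit
  representatives, the product of the conjugates of \<open>c\<close> is the inverse of the full twist, and
  \<open>(c b)^d = 1\<close>.

  Smaller positive powers of \<open>c b\<close> are not trivial, because their images in \<open>W\<close>, the powers of \<open>g\<close>,
  are not. That braids have images in \<open>W\<close> is a matter of lifting loops and homotopies from \<open>X/W\<close> to
  \<open>X\<close>, and this requires \<open>W\<close> to act freely on \<open>X\<close>, which is Steinberg's theorem (\<open>steinberg\<close>). It
  is derived here from Chevalley's argument: for a group generated by reflections, the polynomial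
  functions are generated over the invariants by at most \<open>card W\<close> of them (\<open>hpoly_generators\<close>). The
  determinant of the values of such generators on the translates of a point \<open>y\<close> is a polynomial that
  vanishes precisely if the stabilizer of \<open>y\<close> is not trivial. Its zero set is a hypersurface, but near
  a point off the reflecting hyperplanes the points with nontrivial stabilizer form a set of
  codimension at least two. So there are none.
\<close>

section \<open>Homogeneous polynomial functions\<close>

text \<open>
  Polynomials in the coordinates are represented by the functions that they induce; over the complex
  numbers this loses nothing, and a matrix then acts by composition. The index is a degree, and the
  zero function has every degree.
\<close>
inductive hpoly :: "nat \<Rightarrow> (complex^'n \<Rightarrow> complex) \<Rightarrow> bool"
  where
    hpoly_const: "hpoly 0 (\<lambda>x. c)"
  | hpoly_zero: "hpoly k (\<lambda>x. 0)"
  | hpoly_add: "hpoly k p \<Longrightarrow> hpoly k q \<Longrightarrow> hpoly k (\<lambda>x. p x + q x)"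
  | hpoly_coord: "hpoly k p \<Longrightarrow> hpoly (Suc k) (\<lambda>x. x $ i * p x)"

lemma hpoly_scale: "hpoly k p \<Longrightarrow> hpoly k (\<lambda>x. c * p x)"
proof (induction rule: hpoly.induct)
  case (hpoly_const d) show ?case by (rule hpoly.hpoly_const)
next
  case (hpoly_zero k) show ?case by (simp add: hpoly.hpoly_zero)
next
  case (hpoly_add k p q) then show ?case
    using hpoly.hpoly_add[of k "\<lambda>x. c * p x" "\<lambda>x. c * q x"] by (simp add: distrib_left)
next
  case (hpoly_coord k p i) then show ?case
    using hpoly.hpoly_coord[of k "\<lambda>x. c * p x" i] by (simp add: mult.left_commute)
qed

lemma hpoly_uminus: "hpoly k p \<Longrightarrow> hpoly k (\<lambda>x. - p x)"
  using hpoly_scale[of k p "-1"] by simp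

lemma hpoly_diff: "hpoly k p \<Longrightarrow> hpoly k q \<Longrightarrow> hpoly k (\<lambda>x. p x - q x)"
  using hpoly_add[of k p "\<lambda>x. - q x"] hpoly_uminus[of k q] by simp

lemma hpoly_sum:
  assumes "\<And>j. j \<in> J \<Longrightarrow> hpoly k (p j)"
  shows "hpoly k (\<lambda>x. \<Sum>j\<in>J. p j x)"
proof (cases "finite J")
  case True
  then show ?thesis using assms
    by (induction J) (auto intro: hpoly_zero hpoly_add)
qed (simp add: hpoly_zero)

lemma hpoly_mult:
  assumes "hpoly k p" "hpoly l q"
  shows "hpoly (k + l) (\<lambda>x. p x * q x)"
  using assms
proof (induction rule: hpoly.induct)
  case (hpoly_const c) then show ?case by (simp add: hpoly_scale)
next
  case (hpoly_zero k) show ?case by (simp add: hpoly.hpoly_zero)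
next
  case (hpoly_add k p p') then show ?case
    using hpoly.hpoly_add[of "k + l" "\<lambda>x. p x * q x" "\<lambda>x. p' x * q x"]
    by (simp add: distrib_right)
next
  case (hpoly_coord k p i) then show ?case
    using hpoly.hpoly_coord[of "k + l" "\<lambda>x. p x * q x" i] by (simp add: mult.assoc)
qed

lemma hpoly_homogeneous: "hpoly k p \<Longrightarrow> p (c *s x) = c ^ k * p x"
  by (induction rule: hpoly.induct) (auto simp: algebra_simps)

lemma hpoly_0_const:
  assumes "hpoly 0 p" shows "p = (\<lambda>x. p 0)"
proof
  fix x
  from hpoly_homogeneous[OF assms, of 0 x] show "p x = p 0" by simp
qed

lemma hpoly_linear_form: "hpoly 1 (\<lambda>x. \<Sum>i\<in>UNIV. a i * x $ i)"
proof (rule hpoly_sum)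
  fix i show "hpoly 1 (\<lambda>x. a i * x $ i)"
    using hpoly_scale[OF hpoly_coord[OF hpoly_const[of 1], of i], of "a i"] by simp
qed

lemma hpoly_compose: "hpoly k p \<Longrightarrow> hpoly k (\<lambda>x. p (A *v x))"
proof (induction rule: hpoly.induct)
  case (hpoly_const d) show ?case by (rule hpoly.hpoly_const)
next
  case (hpoly_zero k) show ?case by (simp add: hpoly.hpoly_zero)
next
  case (hpoly_add k p q) then show ?case by (simp add: hpoly.hpoly_add)
next
  case (hpoly_coord k p i)
  have "hpoly 1 (\<lambda>x. (A *v x) $ i)"
    unfolding matrix_vector_mult_def using hpoly_linear_form[of "\<lambda>j. A $ i $ j"] by simp
  from hpoly_mult[OF this hpoly_coord.IH] show ?case by simp
qed

lemma hpoly_power: "hpoly k p \<Longrightarrow> hpoly (k * j) (\<lambda>x. p x ^ j)"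
proof (induction j)
  case 0 then show ?case using hpoly_const[of 1] by simp
next
  case (Suc j) then show ?case using hpoly_mult[of k p "k * j"] by simp
qed

lemma hpoly_continuous_on: "hpoly k p \<Longrightarrow> continuous_on S p"
  by (induction rule: hpoly.induct) (auto intro!: continuous_intros)

lemma hpoly_on_line:
  assumes "hpoly k p"
  shows "\<exists>P. \<forall>t. p (x + t *s y) = poly P t"
  using assms
proof (induction rule: hpoly.induct)
  case (hpoly_const c) show ?case by (rule exI[of _ "[:c:]"]) simp
next
  case (hpoly_zero k) show ?case by (rule exI[of _ 0]) simp
next
  case (hpoly_add k p q)
  then obtain P Q where "\<forall>t. p (x + t *s y) = poly P t" "\<forall>t. q (x + t *s y) = poly Q t" by blast
  then show ?case by (intro exI[of _ "P + Q"]) simp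
next
  case (hpoly_coord k p i)
  then obtain P where "\<forall>t. p (x + t *s y) = poly P t" by blast
  then show ?case by (intro exI[of _ "[:x $ i, y $ i:] * P"]) (simp add: algebra_simps)
qed


text \<open>
  Where \<open>l\<close> vanishes, \<open>A\<close> fixes the point, so \<open>p - p \<circ> A\<close> vanishes there and is divisible by
  \<open>l\<close>. The quotient is the divided difference (Demazure operator) of \<open>p\<close>; the recursion for it is a
  twisted Leibniz rule.
\<close>
lemma hpoly_divided_difference:
  fixes \<alpha> :: "'n::finite \<Rightarrow> complex"
  defines "l \<equiv> \<lambda>x::complex^'n. \<Sum>i\<in>UNIV. \<alpha> i * x $ i"
  assumes "hpoly k p" and s: "\<And>x. A *v x = x + l x *s r"
  shows "(k = 0 \<and> (\<forall>x. p (A *v x) = p x)) \<or>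
    (\<exists>j q. k = Suc j \<and> hpoly j q \<and> (\<forall>x. p x - p (A *v x) = l x * q x))"
  using assms(2)
proof (induction rule: hpoly.induct)
  case (hpoly_const c) show ?case by simp
next
  case (hpoly_zero k)
  then show ?case by (cases k) (auto intro!: exI[of _ "\<lambda>x. 0"] hpoly.hpoly_zero)
next
  case (hpoly_add k p q)
  show ?case
  proof (cases k)
    case 0 with hpoly_add.IH show ?thesis by simp
  next
    case (Suc j)
    with hpoly_add.IH obtain p' q' where *: "hpoly j p'" "\<forall>x. p x - p (A *v x) = l x * p' x"
      "hpoly j q'" "\<forall>x. q x - q (A *v x) = l x * q' x" by auto
    have "\<forall>x. p x + q x - (p (A *v x) + q (A *v x)) = l x * (p' x + q' x)"
      using *(2,4) by (simp add: distrib_left add_diff_add)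
    with *(1,3) Suc show ?thesis
      by (intro disjI2 exI[of _ j] exI[of _ "\<lambda>x. p' x + q' x"]) (auto intro: hpoly.hpoly_add)
  qed
next
  case (hpoly_coord k p i)
  have "\<exists>q. hpoly k q \<and> (\<forall>x. x $ i * p x - (A *v x) $ i * p (A *v x) = l x * q x)"
  proof (cases k)
    case 0
    with hpoly_coord have "\<forall>x. p (A *v x) = p x" "hpoly 0 p" by auto
    then show ?thesis using 0
      using hpoly_scale[of 0 p "- r $ i"]
      by (intro exI[of _ "\<lambda>x. - r $ i * p x"]) (auto simp: s algebra_simps)
  next
    case (Suc j)
    with hpoly_coord obtain q where q: "hpoly j q" "\<And>x. p x - p (A *v x) = l x * q x" by auto
    have "hpoly k (\<lambda>x. x $ i * q x - r $ i * p (A *v x))"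
      unfolding Suc using hpoly_coord.hyps Suc
      by (intro hpoly_diff hpoly.hpoly_coord q(1) hpoly_scale hpoly_compose) simp
    moreover have "x $ i * p x - (A *v x) $ i * p (A *v x) = l x * (x $ i * q x - r $ i * p (A *v x))" for x
    proof -
      have "x $ i * p x - (A *v x) $ i * p (A *v x) = x $ i * (p x - p (A *v x)) - l x * r $ i * p (A *v x)"
        by (simp add: s algebra_simps)
      then show ?thesis by (simp add: q(2) algebra_simps)
    qed
    ultimately show ?thesis by blast
  qed
  then show ?case by auto
qed

text \<open>
  On a line through a point where the first functions do not vanish and a point where the last one
  does not, each function is a nonzero polynomial of one variable, so that a parameter outside
  finitely many roots serves for all. The general position arguments rest on this lemma.
\<close>
lemma hpoly_common_nonzero:
  assumes "finite J" "\<And>j. j \<in> J \<Longrightarrow> hpoly (k j) (p j) \<and> (\<exists>x. p j x \<noteq> 0)"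
  shows "\<exists>x. \<forall>j\<in>J. p j x \<noteq> 0"
  using assms
proof (induction J)
  case (insert i J)
  then obtain x where x: "\<And>j. j \<in> J \<Longrightarrow> p j x \<noteq> 0" by auto
  obtain y where y: "p i y \<noteq> 0" using insert.prems by auto
  have "\<exists>P. \<forall>t. p j (x + t *s (y - x)) = poly P t" if "j \<in> insert i J" for j
    using hpoly_on_line insert.prems that by blast
  then obtain P where P: "\<And>j t. j \<in> insert i J \<Longrightarrow> p j (x + t *s (y - x)) = poly (P j) t"
    by metis
  have "P j \<noteq> 0" if "j \<in> insert i J" for j
  proof (cases "j = i")
    case True with P[of i 1] y show ?thesis by auto
  next
    case False with P[of j 0] x that show ?thesis by auto
  qed
  then have "finite (\<Union>j\<in>insert i J. {t. poly (P j) t = 0})"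
    using insert.hyps by (auto intro: poly_roots_finite)
  then obtain t where "t \<notin> (\<Union>j\<in>insert i J. {t. poly (P j) t = 0})"
    using ex_new_if_finite infinite_UNIV_char_0 by blast
  then have "\<forall>j\<in>insert i J. p j (x + t *s (y - x)) \<noteq> 0" using P by auto
  then show ?case by blast
qed auto

section \<open>Invariants of a reflection group\<close>

lemma GL_simps [simp]: "mult GL = (**)" "one GL = mat 1" "carrier GL = {A. invertible A}"
  by (simp_all add: GL_def)

locale reflection_group =
  fixes W :: "(complex^'n^'n) set"
  assumes refl_group: "complex_reflection_group W"
begin

lemma finite_W: "finite W" and subgroup_W: "subgroup W GL"
  and W_generate: "W = generate GL {s \<in> W. \<exists>H. reflection_along s H}"
  using refl_group by (auto simp: complex_reflection_group_def)

lemma W_one: "mat 1 \<in> W"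
  using subgroup.one_closed[OF subgroup_W] by simp

lemma W_mult: "g \<in> W \<Longrightarrow> h \<in> W \<Longrightarrow> g ** h \<in> W"
  using subgroup.m_closed[OF subgroup_W] by simp

lemma W_inverse:
  assumes "g \<in> W" obtains g' where "g' \<in> W" "g' ** g = mat 1" "g ** g' = mat 1" "g' = inv\<^bsub>GL\<^esub> g"
proof -
  have g: "g \<in> carrier GL" using assms subgroup.mem_carrier[OF subgroup_W] by blast
  show ?thesis
    using subgroup.m_inv_closed[OF subgroup_W assms] group.l_inv[OF group_GL g] group.r_inv[OF group_GL g]
    by (intro that[of "inv\<^bsub>GL\<^esub> g"]) auto
qed

lemma bij_right_mult:
  assumes "g \<in> W" shows "bij_betw (\<lambda>u. u ** g) W W"
proof -
  obtain g' where g': "g' \<in> W" "g' ** g = mat 1" "g ** g' = mat 1"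
    using W_inverse[OF assms] by metis
  show ?thesis
    by (rule bij_betw_byWitness[of W "\<lambda>u. u ** g'"])
      (use g' assms in \<open>auto simp: W_mult simp flip: matrix_mul_assoc\<close>)
qed

lemma sum_right_mult:
  assumes "g \<in> W" shows "(\<Sum>u\<in>W. F (u ** g)) = (\<Sum>u\<in>W. F u)"
  using sum.reindex_bij_betw[OF bij_right_mult[OF assms]] .

end

text \<open>
  A nonzero row of \<open>s - 1\<close> is a linear form that vanishes on \<open>H\<close>, hence has kernel \<open>H\<close> by
  dimension; so \<open>s - 1\<close> is this form times a vector.
\<close>
lemma reflection_along_form:
  assumes "reflection_along s H"
  obtains \<alpha> r where "H = {x. (\<Sum>i\<in>UNIV. \<alpha> i * x $ i) = 0}" "\<exists>x. (\<Sum>i\<in>UNIV. \<alpha> i * x $ i) \<noteq> 0"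
    "\<forall>x. s *v x = x + (\<Sum>i\<in>UNIV. \<alpha> i * x $ i) *s r"
proof -
  have s: "s \<noteq> mat 1" "vec.subspace H" "vec.dim H + 1 = CARD('a)" "\<And>v. v \<in> H \<Longrightarrow> s *v v = v"
    using assms by (auto simp: reflection_along_def hyperplane_def)
  obtain v where "s *v v \<noteq> v"
    using s(1) by (metis matrix_eq matrix_vector_mul_lid)
  then obtain i where i: "((s - mat 1) *v v) $ i \<noteq> 0"
    by (auto simp: vec_eq_iff matrix_vector_mult_diff_rdistrib)
  define \<alpha> where "\<alpha> = (\<lambda>j. (s - mat 1) $ i $ j)"
  define l where "l = (\<lambda>x::complex^'a. \<Sum>j\<in>UNIV. \<alpha> j * x $ j)"
  have l_eq: "l x = ((s - mat 1) *v x) $ i" for x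
    by (simp add: l_def \<alpha>_def matrix_vector_mult_def)
  have sub: "vec.subspace {x. l x = 0}"
    by (auto simp: vec.subspace_def l_eq matrix_vector_right_distrib vec.scale)
  have H: "H = {x. l x = 0}"
  proof (rule vec.subspace_dim_equal[OF s(2) sub])
    show "H \<subseteq> {x. l x = 0}"
      using s(4) by (auto simp: l_eq matrix_vector_mult_diff_rdistrib)
    have "v \<notin> {x. l x = 0}" using i by (simp add: l_eq)
    moreover have "vec.span {x. l x = 0} = {x. l x = 0}"
      using sub by (simp add: vec.span_eq_iff)
    ultimately have "vec.span {x. l x = 0} \<noteq> UNIV" by blast
    then have "vec.dim {x. l x = 0} \<noteq> CARD('a)"
      using vec.dim_eq_full[of "{x. l x = 0}"] by (simp add: vec.dimension_def card_cart_basis)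
    moreover have "vec.dim {x. l x = 0} \<le> CARD('a)"
      using vec.dim_subset_UNIV[of "{x. l x = 0}"] by (simp add: vec.dimension_def card_cart_basis)
    ultimately show "vec.dim {x. l x = 0} \<le> vec.dim H" using s(3) by simp
  qed
  define e where "e = inverse (l v) *s v"
  have e: "l e = 1" using i by (simp add: e_def l_eq vec.scale)
  have "s *v x = x + l x *s (s *v e - e)" for x
  proof -
    have "x - l x *s e \<in> H"
      using e by (simp add: H l_eq matrix_vector_right_distrib vec.scale vec.diff)
    from s(4)[OF this] have "s *v x - l x *s (s *v e) = x - l x *s e"
      by (simp add: vec.diff vec.scale)
    then show ?thesis by (simp add: algebra_simps vec.scale_right_diff_distrib)
  qed
  moreover have "l v \<noteq> 0" using i by (simp add: l_eq)
  ultimately show ?thesis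
    using H unfolding l_def by (intro that[of \<alpha> "s *v e - e"]) blast+
qed

definition invariant :: "(complex^'n^'n) set \<Rightarrow> (complex^'n \<Rightarrow> complex) \<Rightarrow> bool"
  where "invariant W f \<longleftrightarrow> (\<forall>g\<in>W. \<forall>x. f (g *v x) = f x)"

text \<open>
  The part of degree \<open>k\<close> of the Hilbert ideal, which is generated by the homogeneous invariants of
  positive degree.
\<close>
inductive inv_ideal :: "(complex^'n^'n) set \<Rightarrow> nat \<Rightarrow> (complex^'n \<Rightarrow> complex) \<Rightarrow> bool" for W
  where
    inv_ideal_zero: "inv_ideal W k (\<lambda>x. 0)"
  | inv_ideal_add: "inv_ideal W k p \<Longrightarrow> inv_ideal W k q \<Longrightarrow> inv_ideal W k (\<lambda>x. p x + q x)"
  | inv_ideal_gen: "invariant W p \<Longrightarrow> hpoly a p \<Longrightarrow> 0 < a \<Longrightarrow> hpoly b q \<Longrightarrow>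
      inv_ideal W (a + b) (\<lambda>x. p x * q x)"

lemma inv_ideal_mult:
  assumes "inv_ideal W k h" "hpoly j r"
  shows "inv_ideal W (k + j) (\<lambda>x. h x * r x)"
  using assms
proof (induction rule: inv_ideal.induct)
  case (inv_ideal_zero k) show ?case by (simp add: inv_ideal.inv_ideal_zero)
next
  case (inv_ideal_add k p q) then show ?case
    using inv_ideal.inv_ideal_add[of W "k + j" "\<lambda>x. p x * r x" "\<lambda>x. q x * r x"]
    by (simp add: distrib_right)
next
  case (inv_ideal_gen p a b q)
  then show ?case
    using inv_ideal.inv_ideal_gen[OF inv_ideal_gen.hyps(1-3) hpoly_mult[OF inv_ideal_gen.hyps(4) inv_ideal_gen.prems]]
    by (simp add: mult.assoc add.assoc)
qed

lemma inv_ideal_scale: "inv_ideal W k h \<Longrightarrow> inv_ideal W k (\<lambda>x. c * h x)"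
  using inv_ideal_mult[OF _ hpoly_const[of c]] by (simp add: mult.commute)

lemma inv_ideal_sum:
  assumes "\<And>j. j \<in> J \<Longrightarrow> inv_ideal W k (p j)"
  shows "inv_ideal W k (\<lambda>x. \<Sum>j\<in>J. p j x)"
proof (cases "finite J")
  case True
  then show ?thesis using assms
    by (induction J) (auto intro: inv_ideal_zero inv_ideal_add)
qed (simp add: inv_ideal_zero)

lemma inv_ideal_compose:
  assumes "inv_ideal W k h" "g \<in> W"
  shows "inv_ideal W k (\<lambda>x. h (g *v x))"
  using assms
proof (induction rule: inv_ideal.induct)
  case (inv_ideal_gen p a b q)
  moreover have "(\<lambda>x. p (g *v x) * q (g *v x)) = (\<lambda>x. p x * q (g *v x))"
    using inv_ideal_gen by (auto simp: invariant_def)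
  ultimately show ?case
    using inv_ideal.inv_ideal_gen hpoly_compose by metis
qed (auto intro: inv_ideal.intros)

lemma hpoly_cancel:
  assumes "hpoly k p" "hpoly l q" "hpoly l q'" "\<exists>x. p x \<noteq> 0" "\<And>x. p x * q x = p x * q' x"
  shows "q = q'"
proof (rule ccontr)
  assume "q \<noteq> q'"
  then obtain y where "q y - q' y \<noteq> 0" by auto
  moreover have "hpoly l (\<lambda>x. q x - q' x)" using assms(2,3) by (rule hpoly_diff)
  ultimately have "\<exists>x. \<forall>j\<in>{True, False}. (if j then p else (\<lambda>x. q x - q' x)) x \<noteq> 0"
    using assms(1,4)
    by (intro hpoly_common_nonzero[where k = "\<lambda>j. if j then k else l"]) auto
  then show False using assms(5) by auto
qed

context reflection_group
begin

text \<open>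
  Modulo the Hilbert ideal, \<open>h\<close> is fixed by the reflections, hence by the group that they generate,
  hence equal to its average over the group; and the average is an invariant of positive degree.
  This is the place where \<open>W\<close> has to be generated by reflections.
\<close>
lemma inv_ideal_if_reflections:
  assumes "hpoly k h"
    and refl: "\<And>s H. s \<in> W \<Longrightarrow> reflection_along s H \<Longrightarrow> inv_ideal W k (\<lambda>x. h x - h (s *v x))"
    and "0 < k"
  shows "inv_ideal W k h"
proof -
  have "g \<in> W \<and> inv_ideal W k (\<lambda>x. h x - h (g *v x))"
    if "g \<in> generate GL {s \<in> W. \<exists>H. reflection_along s H}" for g
    using that
  proof (induction rule: generate.induct)
    case one show ?case by (simp add: W_one inv_ideal_zero)
  next
    case (incl s) then show ?case using refl by blast
  next
    case (inv s)
    then have s: "s \<in> W" "inv_ideal W k (\<lambda>x. h x - h (s *v x))" using refl by blast+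
    obtain s' where s': "s' \<in> W" "s ** s' = mat 1" "s' = inv\<^bsub>GL\<^esub> s" using W_inverse[OF s(1)] by metis
    have "inv_ideal W k (\<lambda>x. - 1 * (h (s' *v x) - h (s *v (s' *v x))))"
      using inv_ideal_scale[OF inv_ideal_compose[OF s(2) s'(1)], of "-1"] .
    then show ?case using s' by (simp add: matrix_vector_mul_assoc)
  next
    case (eng g g')
    have "inv_ideal W k (\<lambda>x. (h x - h (g' *v x)) + (h (g' *v x) - h (g *v (g' *v x))))"
      using eng.IH inv_ideal_compose[of W k "\<lambda>x. h x - h (g *v x)" g'] by (intro inv_ideal_add) auto
    with eng show ?case by (simp add: W_mult matrix_vector_mul_assoc)
  qed
  then have "inv_ideal W k (\<lambda>x. \<Sum>g\<in>W. h x - h (g *v x))"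
    using W_generate by (intro inv_ideal_sum) blast
  moreover have "invariant W (\<lambda>x. \<Sum>g\<in>W. h (g *v x))"
    using sum_right_mult[of _ "\<lambda>u. h (u *v _)"] by (simp add: invariant_def matrix_vector_mul_assoc)
  from inv_ideal_gen[OF this _ \<open>0 < k\<close> hpoly_const[of 1]]
  have "inv_ideal W k (\<lambda>x. \<Sum>g\<in>W. h (g *v x))"
    using assms(1) by (simp add: hpoly_sum hpoly_compose)
  ultimately have "inv_ideal W k (\<lambda>x. (\<Sum>g\<in>W. h x - h (g *v x)) + (\<Sum>g\<in>W. h (g *v x)))"
    by (rule inv_ideal_add)
  from inv_ideal_scale[OF this, of "1 / of_nat (card W)"]
  have "inv_ideal W k (\<lambda>x. 1 / of_nat (card W) * (of_nat (card W) * h x))"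
    by (simp add: sum_subtractf)
  moreover have "card W \<noteq> 0" using finite_W W_one by auto
  ultimately show ?thesis by simp
qed

text \<open>
  Chevalley's lemma on syzygies among invariants. Subtract from the relation its transform under a
  reflection: the invariants \<open>f i\<close> factor out, and cancelling the linear form of the reflection leaves
  a relation between divided differences, which have smaller degree. By induction the divided
  differences of \<open>h0\<close> lie in the Hilbert ideal, and so does \<open>h0\<close>. In degree 0 the function \<open>h0\<close> is
  a constant by which the relation can be divided.
\<close>
lemma chevalley_syzygy:
  assumes "invariant W f0" "hpoly a0 f0" "hpoly b0 h0" "a0 + b0 = D" "finite J"
    and "\<And>i. i \<in> J \<Longrightarrow> invariant W (f i) \<and> hpoly (a i) (f i) \<and> hpoly (b i) (h i) \<and> a i + b i = D"
    and "\<And>x. f0 x * h0 x = (\<Sum>i\<in>J. f i x * h i x)"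
  shows "inv_ideal W b0 h0 \<or>
    (\<exists>r. (\<forall>i\<in>J. r i = (\<lambda>x. 0) \<or> (\<exists>c. hpoly c (r i) \<and> a i + c = a0)) \<and>
      (\<forall>x. f0 x = (\<Sum>i\<in>J. r i x * f i x)))"
  using assms(3-)
proof (induction b0 arbitrary: h0 D J b h)
  case 0
  define c where "c = h0 0"
  have h0: "h0 x = c" for x using hpoly_0_const[OF 0(1)] unfolding c_def by metis
  show ?case
  proof (cases "c = 0")
    case True then show ?thesis using h0 inv_ideal_zero[of W 0] by (metis ext)
  next
    case False
    have "f0 x = (\<Sum>i\<in>J. (1 / c * h i x) * f i x)" for x
    proof -
      have "f0 x = (f0 x * h0 x) / c" using False by (simp add: h0)
      also have "\<dots> = (\<Sum>i\<in>J. (1 / c * h i x) * f i x)"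
        unfolding 0(5) by (simp add: sum_divide_distrib mult.commute)
      finally show ?thesis .
    qed
    moreover have "hpoly (b i) (\<lambda>x. 1 / c * h i x)" "a i + b i = a0" if "i \<in> J" for i
      using 0(2) 0(4)[OF that] hpoly_scale[of "b i" "h i" "1 / c"] by auto
    ultimately show ?thesis
      by (intro disjI2 exI[of _ "\<lambda>i x. 1 / c * h i x"]) blast
  qed
next
  case (Suc b0)
  show ?case
  proof (rule disjCI)
    assume no: "\<not> (\<exists>r. (\<forall>i\<in>J. r i = (\<lambda>x. 0) \<or> (\<exists>c. hpoly c (r i) \<and> a i + c = a0)) \<and>
      (\<forall>x. f0 x = (\<Sum>i\<in>J. r i x * f i x)))"
    show "inv_ideal W (Suc b0) h0"
    proof (rule inv_ideal_if_reflections[OF Suc.prems(1)])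
      fix s H assume s: "s \<in> W" "reflection_along s H"
      obtain \<alpha> r where \<alpha>: "H = {x. (\<Sum>i\<in>UNIV. \<alpha> i * x $ i) = 0}"
        "\<exists>x. (\<Sum>i\<in>UNIV. \<alpha> i * x $ i) \<noteq> 0"
        "\<forall>x. s *v x = x + (\<Sum>i\<in>UNIV. \<alpha> i * x $ i) *s r"
        by (rule reflection_along_form[OF s(2)])
      define l where "l = (\<lambda>x::complex^'n. \<Sum>i\<in>UNIV. \<alpha> i * x $ i)"
      have l: "hpoly 1 l" unfolding l_def by (rule hpoly_linear_form)
      obtain q0 where q0: "hpoly b0 q0" "\<And>x. h0 x - h0 (s *v x) = l x * q0 x"
        using hpoly_divided_difference[OF Suc.prems(1) \<alpha>(3)[rule_format]] unfolding l_def by blast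
      define J' where "J' = {i \<in> J. b i \<noteq> 0}"
      have "\<forall>i\<in>J'. \<exists>q. hpoly (b i - 1) q \<and> (\<forall>x. h i x - h i (s *v x) = l x * q x)"
      proof
        fix i assume "i \<in> J'"
        then have "b i \<noteq> 0" "hpoly (b i) (h i)" using Suc.prems(4)[of i] by (auto simp: J'_def)
        then obtain j q where "b i = Suc j" "hpoly j q" "\<forall>x. h i x - h i (s *v x) = l x * q x"
          using hpoly_divided_difference[of "b i" "h i", OF _ \<alpha>(3)[rule_format]] unfolding l_def by auto
        then show "\<exists>q. hpoly (b i - 1) q \<and> (\<forall>x. h i x - h i (s *v x) = l x * q x)" by auto
      qed
      from bchoice[OF this] obtain q where q: "\<And>i. i \<in> J' \<Longrightarrow> hpoly (b i - 1) (q i)"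
        "\<And>i x. i \<in> J' \<Longrightarrow> h i x - h i (s *v x) = l x * q i x" by blast
      have q': "h i x - h i (s *v x) = 0" if "i \<in> J" "i \<notin> J'" for i x
      proof -
        have "b i = 0" "hpoly (b i) (h i)" using that Suc.prems(4)[of i] by (auto simp: J'_def)
        then show ?thesis
          using hpoly_divided_difference[of "b i" "h i", OF _ \<alpha>(3)[rule_format]] by simp
      qed
      have fin: "finite J'" using Suc.prems(3) by (simp add: J'_def)
      have deg: "a i + (b i - 1) = D - 1" if "i \<in> J'" for i
        using that Suc.prems(4)[of i] by (auto simp: J'_def)
      have D: "a0 + b0 = D - 1" using Suc.prems(2) by simp
      have "(\<lambda>x. f0 x * q0 x) = (\<lambda>x. \<Sum>i\<in>J'. f i x * q i x)"
      proof (rule hpoly_cancel[OF l])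
        show "hpoly (D - 1) (\<lambda>x. f0 x * q0 x)"
          unfolding D[symmetric] using assms(2) q0(1) by (rule hpoly_mult)
        show "hpoly (D - 1) (\<lambda>x. \<Sum>i\<in>J'. f i x * q i x)"
        proof (rule hpoly_sum)
          fix i assume i: "i \<in> J'"
          then have "hpoly (a i) (f i)" using Suc.prems(4)[of i] by (simp add: J'_def)
          from hpoly_mult[OF this q(1)[OF i]] show "hpoly (D - 1) (\<lambda>x. f i x * q i x)"
            unfolding deg[OF i] .
        qed
        show "\<exists>x. l x \<noteq> 0" using \<alpha>(2) by (simp add: l_def)
        fix x
        have f0s: "f0 (s *v x) = f0 x" using assms(1) s(1) by (simp add: invariant_def)
        have fs: "f i (s *v x) = f i x" if "i \<in> J" for i
          using Suc.prems(4)[OF that] s(1) by (simp add: invariant_def)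
        have "l x * (f0 x * q0 x) = f0 x * (h0 x - h0 (s *v x))" by (simp add: q0(2))
        also have "\<dots> = f0 x * h0 x - f0 (s *v x) * h0 (s *v x)" by (simp add: f0s right_diff_distrib)
        also have "\<dots> = (\<Sum>i\<in>J. f i x * h i x) - (\<Sum>i\<in>J. f i (s *v x) * h i (s *v x))"
          by (simp only: Suc.prems(5))
        also have "\<dots> = (\<Sum>i\<in>J. f i x * (h i x - h i (s *v x)))"
          by (simp add: fs right_diff_distrib sum_subtractf)
        also have "\<dots> = (\<Sum>i\<in>J'. f i x * (h i x - h i (s *v x)))"
        proof (rule sum.mono_neutral_right[OF Suc.prems(3)])
          show "\<forall>i\<in>J - J'. f i x * (h i x - h i (s *v x)) = 0"
            using q' by (metis DiffD1 DiffD2 mult_zero_right)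
        qed (auto simp: J'_def)
        also have "\<dots> = l x * (\<Sum>i\<in>J'. f i x * q i x)"
          unfolding sum_distrib_left by (rule sum.cong) (simp_all add: q(2) mult.left_commute)
        finally show "l x * (f0 x * q0 x) = l x * (\<Sum>i\<in>J'. f i x * q i x)" .
      qed
      then have eq: "f0 x * q0 x = (\<Sum>i\<in>J'. f i x * q i x)" for x by (rule fun_cong)
      have "inv_ideal W b0 q0 \<or> (\<exists>r. (\<forall>i\<in>J'. r i = (\<lambda>x. 0) \<or> (\<exists>c. hpoly c (r i) \<and> a i + c = a0)) \<and>
          (\<forall>x. f0 x = (\<Sum>i\<in>J'. r i x * f i x)))"
      proof (rule Suc.IH[OF q0(1) D fin _ eq])
        fix i assume "i \<in> J'"
        then show "invariant W (f i) \<and> hpoly (a i) (f i) \<and> hpoly (b i - 1) (q i) \<and> a i + (b i - 1) = D - 1"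
          using Suc.prems(4)[of i] q(1) deg by (simp add: J'_def)
      qed
      then have "inv_ideal W b0 q0"
      proof
        assume "\<exists>r. (\<forall>i\<in>J'. r i = (\<lambda>x. 0) \<or> (\<exists>c. hpoly c (r i) \<and> a i + c = a0)) \<and>
          (\<forall>x. f0 x = (\<Sum>i\<in>J'. r i x * f i x))"
        then obtain r where r: "\<forall>i\<in>J'. r i = (\<lambda>x. 0) \<or> (\<exists>c. hpoly c (r i) \<and> a i + c = a0)"
          "\<And>x. f0 x = (\<Sum>i\<in>J'. r i x * f i x)" by blast
        define r' where "r' = (\<lambda>i. if i \<in> J' then r i else (\<lambda>x. 0))"
        have "f0 x = (\<Sum>i\<in>J. r' i x * f i x)" for x
          unfolding r(2) by (rule sum.mono_neutral_cong_left)
            (auto simp: r'_def J'_def Suc.prems(3))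
        moreover have "\<forall>i\<in>J. r' i = (\<lambda>x. 0) \<or> (\<exists>c. hpoly c (r' i) \<and> a i + c = a0)"
          using r(1) by (simp add: r'_def)
        ultimately show ?thesis using no by blast
      qed
      from inv_ideal_mult[OF this l] show "inv_ideal W (Suc b0) (\<lambda>x. h0 x - h0 (s *v x))"
        by (simp add: q0(2) mult.commute)
    qed simp
  qed
qed

end

section \<open>Generators over the invariants\<close>

lemma hpoly_mult_nonzero:
  assumes "hpoly k p" "hpoly l q" "p \<noteq> (\<lambda>x. 0)" "q \<noteq> (\<lambda>x. 0)"
  shows "(\<lambda>x. p x * q x) \<noteq> (\<lambda>x. 0)"
proof
  assume *: "(\<lambda>x. p x * q x) = (\<lambda>x. 0)"
  have "p x * q x = p x * 0" for x using fun_cong[OF *, of x] by simp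
  moreover have "\<exists>x. p x \<noteq> 0" using assms(3) by blast
  ultimately have "q = (\<lambda>x. 0)"
    using hpoly_cancel[OF assms(1,2) hpoly_zero] by blast
  with assms(4) show False by contradiction
qed

text \<open>
  Elimination without denominators. The degrees \<open>b i\<close> of the columns are carried along, because the
  solution has to be homogeneous again; multiplying by the pivot raises all of them by the same amount.
\<close>
lemma hpoly_underdetermined_system:
  assumes "finite K" "finite I" "card K < card I"
    and "\<And>k i. k \<in> K \<Longrightarrow> i \<in> I \<Longrightarrow> hpoly (b i) (A k i)"
  shows "\<exists>c a D. (\<forall>i\<in>I. c i = (\<lambda>x. 0) \<or> hpoly (a i) (c i) \<and> a i + b i = D) \<and>
    (\<exists>i\<in>I. c i \<noteq> (\<lambda>x. 0)) \<and> (\<forall>k\<in>K. \<forall>x. (\<Sum>i\<in>I. c i x * A k i x) = 0)"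
  using assms
proof (induction K arbitrary: I b A)
  case empty
  then obtain i0 where "i0 \<in> I" by fastforce
  then show ?case
    by (intro exI[of _ "\<lambda>i x. if i = i0 then 1 else 0"] exI[of _ "\<lambda>i. 0"] exI[of _ "b i0"])
      (auto intro: hpoly_const simp: fun_eq_iff)
next
  case (insert k K)
  show ?case
  proof (cases "\<forall>i\<in>I. A k i = (\<lambda>x. 0)")
    case True
    have "card K < card I" using insert by simp
    from insert.IH[OF insert.prems(1) this, of b A] insert.prems(3)
    obtain c a D where "\<forall>i\<in>I. c i = (\<lambda>x. 0) \<or> hpoly (a i) (c i) \<and> a i + b i = D"
      "\<exists>i\<in>I. c i \<noteq> (\<lambda>x. 0)" "\<forall>k\<in>K. \<forall>x. (\<Sum>i\<in>I. c i x * A k i x) = 0" by auto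
    with True show ?thesis by (intro exI[of _ c] exI[of _ a] exI[of _ D]) simp
  next
    case False
    then obtain i1 where i1: "i1 \<in> I" "A k i1 \<noteq> (\<lambda>x. 0)" by blast
    define I' where "I' = I - {i1}"
    define A' where "A' = (\<lambda>l i x. A k i1 x * A l i x - A k i x * A l i1 x)"
    have I': "finite I'" "card K < card I'" "i1 \<notin> I'" "I = insert i1 I'"
      using insert.prems(1,2) insert.hyps i1 by (auto simp: I'_def)
    have hA: "hpoly (b i) (A l i)" if "l \<in> insert k K" "i \<in> I" for l i
      using insert.prems(3) that .
    have hA': "hpoly (b i + b i1) (A' l i)" if "l \<in> K" "i \<in> I'" for l i
      unfolding A'_def
      using hpoly_mult[OF hA[of k i1] hA[of l i]] hpoly_mult[OF hA[of k i] hA[of l i1]] that I' i1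
      by (intro hpoly_diff) (auto simp: add.commute)
    have "\<exists>c a D. (\<forall>i\<in>I'. c i = (\<lambda>x. 0) \<or> hpoly (a i) (c i) \<and> a i + (b i + b i1) = D) \<and>
        (\<exists>i\<in>I'. c i \<noteq> (\<lambda>x. 0)) \<and> (\<forall>k\<in>K. \<forall>x. (\<Sum>i\<in>I'. c i x * A' k i x) = 0)"
      by (rule insert.IH[OF I'(1,2)]) (rule hA')
    then
    obtain c' a' D where *: "\<forall>i\<in>I'. c' i = (\<lambda>x. 0) \<or> hpoly (a' i) (c' i) \<and> a' i + (b i + b i1) = D"
      "\<exists>i\<in>I'. c' i \<noteq> (\<lambda>x. 0)" "\<forall>l\<in>K. \<forall>x. (\<Sum>i\<in>I'. c' i x * A' l i x) = 0"
      by (elim exE conjE)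
    note c' = *(1)[rule_format] *(2) *(3)[rule_format]
    obtain i2 where i2: "i2 \<in> I'" "c' i2 \<noteq> (\<lambda>x. 0)" using c'(2) by blast
    define c where "c = (\<lambda>i. if i = i1 then (\<lambda>x. - (\<Sum>j\<in>I'. c' j x * A k j x))
      else (\<lambda>x. c' i x * A k i1 x))"
    define a where "a = (\<lambda>i. if i = i1 then D - b i1 else a' i + b i1)"
    have D: "b i1 \<le> D" using c'(1)[OF i2(1)] i2(2) by auto
    show ?thesis
    proof (intro exI[of _ c] exI[of _ a] exI[of _ D] conjI ballI allI)
      fix i assume i: "i \<in> I"
      show "c i = (\<lambda>x. 0) \<or> hpoly (a i) (c i) \<and> a i + b i = D"
      proof (cases "i = i1")
        case True
        have "hpoly (D - b i1) (\<lambda>x. c' j x * A k j x)" if j: "j \<in> I'" for j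
          using c'(1)[OF j]
        proof
          assume "c' j = (\<lambda>x. 0)" then show ?thesis by (simp add: hpoly_zero)
        next
          assume *: "hpoly (a' j) (c' j) \<and> a' j + (b j + b i1) = D"
          then have "hpoly (a' j + b j) (\<lambda>x. c' j x * A k j x)"
            using hA[of k j] j I' by (intro hpoly_mult) auto
          moreover have "a' j + b j = D - b i1" using * by linarith
          ultimately show ?thesis by simp
        qed
        then have "hpoly (D - b i1) (c i)"
          unfolding c_def using True by (simp add: hpoly_uminus hpoly_sum)
        with D True show ?thesis by (simp add: a_def)
      next
        case False
        with i have "i \<in> I'" by (simp add: I'_def)
        from c'(1)[OF this] False show ?thesis
          using hpoly_mult[of "a' i" "c' i" "b i1" "A k i1"] hA[of k i1] i1
          by (auto simp: c_def a_def)
      qed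
    next
      have "c i2 \<noteq> (\<lambda>x. 0)"
      proof -
        have "i2 \<noteq> i1" using i2(1) I'(3) by auto
        moreover have "(\<lambda>x. c' i2 x * A k i1 x) \<noteq> (\<lambda>x. 0)"
          using c'(1)[OF i2(1)] i2(2) hA[of k i1] i1
          by (intro hpoly_mult_nonzero[of "a' i2" _ "b i1"]) auto
        ultimately show ?thesis by (simp add: c_def)
      qed
      then show "\<exists>i\<in>I. c i \<noteq> (\<lambda>x. 0)" using i2(1) I' by blast
    next
      fix l x assume l: "l \<in> insert k K"
      have "(\<Sum>i\<in>I'. c i x * A l i x) = (\<Sum>i\<in>I'. c' i x * A k i1 x * A l i x)"
        using I'(3) by (intro sum.cong) (auto simp: c_def)
      then have "(\<Sum>i\<in>I. c i x * A l i x) =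
          - (\<Sum>i\<in>I'. c' i x * A k i x) * A l i1 x + (\<Sum>i\<in>I'. c' i x * A k i1 x * A l i x)"
        using I' by (simp add: c_def)
      also have "\<dots> = (\<Sum>i\<in>I'. c' i x * A' l i x)"
        by (simp add: A'_def sum_distrib_right right_diff_distrib sum_subtractf mult.assoc)
      also have "\<dots> = 0"
        using c'(3)[of l x] l by (cases "l = k") (auto simp: A'_def)
      finally show "(\<Sum>i\<in>I. c i x * A l i x) = 0" .
    qed
  qed
qed

lemma interpolation_poly:
  fixes l :: "'b \<Rightarrow> complex"
  assumes "finite S" "inj_on l S"
  shows "\<exists>P. \<forall>s\<in>S. poly P (l s) = \<phi> s"
  using assms
proof (induction S)
  case (insert a S)
  then obtain P where P: "\<forall>s\<in>S. poly P (l s) = \<phi> s" by auto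
  define R where "R = (\<Prod>s\<in>S. [:- l s, 1:])"
  have R: "poly R z = (\<Prod>s\<in>S. z - l s)" for z
    unfolding R_def poly_prod by (intro prod.cong) auto
  have "poly R (l s) = 0" if "s \<in> S" for s
    using that insert.hyps(1) by (auto simp: R)
  moreover have "poly R (l a) \<noteq> 0"
    using insert.hyps insert.prems by (auto simp: R)
  ultimately show ?case using P
    by (intro exI[of _ "P + [:(\<phi> a - poly P (l a)) / poly R (l a):] * R"]) auto
qed auto

text \<open>
  A linear form separates two vectors unless its coefficients satisfy a nontrivial linear equation.
\<close>
lemma separating_form:
  assumes "finite S"
  shows "\<exists>\<alpha>. inj_on (\<lambda>v::complex^'n. \<Sum>i\<in>UNIV. \<alpha> i * v $ i) S"
proof -
  let ?J = "{(u, v) \<in> S \<times> S. u \<noteq> v}"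
  have "\<exists>a::complex^'n. \<forall>p\<in>?J. (\<Sum>i\<in>UNIV. (fst p - snd p) $ i * a $ i) \<noteq> 0"
  proof (rule hpoly_common_nonzero[where k = "\<lambda>_. 1"
        and p = "\<lambda>p a. \<Sum>i\<in>UNIV. (fst p - snd p) $ i * a $ i"])
    show "finite ?J" by (rule finite_subset[of _ "S \<times> S"]) (use assms in auto)
    fix p assume "p \<in> ?J"
    then obtain j where "(fst p - snd p) $ j \<noteq> 0" by (auto simp: vec_eq_iff)
    then have "(\<Sum>i\<in>UNIV. (fst p - snd p) $ i * (axis j 1 :: complex^'n) $ i) \<noteq> 0"
      by (simp add: axis_def if_distrib cong: if_cong)
    then show "hpoly 1 (\<lambda>x. \<Sum>i\<in>UNIV. (fst p - snd p) $ i * x $ i) \<and>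
        (\<exists>x. (\<Sum>i\<in>UNIV. (fst p - snd p) $ i * x $ i) \<noteq> 0)"
      using hpoly_linear_form[of "\<lambda>i. (fst p - snd p) $ i"] by blast
  qed
  then obtain a :: "complex^'n" where a: "\<forall>p\<in>?J. (\<Sum>i\<in>UNIV. (fst p - snd p) $ i * a $ i) \<noteq> 0"
    by (rule exE)
  have "inj_on (\<lambda>v. \<Sum>i\<in>UNIV. a $ i * v $ i) S"
  proof (rule inj_onI, rule ccontr)
    fix u v assume *: "u \<in> S" "v \<in> S" "(\<Sum>i\<in>UNIV. a $ i * u $ i) = (\<Sum>i\<in>UNIV. a $ i * v $ i)" "u \<noteq> v"
    then have "(\<Sum>i\<in>UNIV. (u - v) $ i * a $ i) \<noteq> 0" using bspec[OF a, of "(u, v)"] by simp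
    moreover have "(\<Sum>i\<in>UNIV. (u - v) $ i * a $ i) = (\<Sum>i\<in>UNIV. a $ i * u $ i) - (\<Sum>i\<in>UNIV. a $ i * v $ i)"
      unfolding sum_subtractf[symmetric] by (rule sum.cong) (simp_all add: algebra_simps)
    ultimately show False using *(3) by simp
  qed
  then show ?thesis by blast
qed

context reflection_group
begin

text \<open>
  Linear independence in the coinvariant algebra, the quotient of the polynomial functions by the
  Hilbert ideal. As the ideal is homogeneous, it is a condition in each degree \<open>k\<close>.
\<close>
definition indep_mod_ideal :: "'i set \<Rightarrow> ('i \<Rightarrow> nat) \<Rightarrow> ('i \<Rightarrow> complex^'n \<Rightarrow> complex) \<Rightarrow> bool"
  where "indep_mod_ideal J b e \<longleftrightarrow> (\<forall>i\<in>J. hpoly (b i) (e i)) \<and>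
    (\<forall>k c. inv_ideal W k (\<lambda>x. \<Sum>i\<in>{i\<in>J. b i = k}. c i * e i x) \<longrightarrow> (\<forall>i\<in>J. b i = k \<longrightarrow> c i = 0))"

lemma indep_mod_idealD:
  assumes "indep_mod_ideal J b e" "inv_ideal W k (\<lambda>x. \<Sum>i\<in>{i\<in>J. b i = k}. c i * e i x)"
  shows "\<forall>i\<in>J. b i = k \<longrightarrow> c i = 0"
  using assms unfolding indep_mod_ideal_def by blast

lemma indep_mod_ideal_subset:
  assumes "indep_mod_ideal J b e" "J' \<subseteq> J" "finite J"
  shows "indep_mod_ideal J' b e"
  unfolding indep_mod_ideal_def
proof (intro conjI ballI allI impI)
  show "hpoly (b i) (e i)" if "i \<in> J'" for i
    using assms(1,2) that by (auto simp: indep_mod_ideal_def)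
  fix k c i assume *: "inv_ideal W k (\<lambda>x. \<Sum>i\<in>{i\<in>J'. b i = k}. c i * e i x)" "i \<in> J'" "b i = k"
  have "(\<Sum>i\<in>{i\<in>J'. b i = k}. c i * e i x) =
      (\<Sum>i\<in>{i\<in>J. b i = k}. (if i \<in> J' then c i else 0) * e i x)" for x
    using assms(2,3) by (intro sum.mono_neutral_cong_left) auto
  with *(1) have "inv_ideal W k (\<lambda>x. \<Sum>i\<in>{i\<in>J. b i = k}. (if i \<in> J' then c i else 0) * e i x)"
    by simp
  then have "\<forall>i\<in>J. b i = k \<longrightarrow> (if i \<in> J' then c i else 0) = 0"
    by (rule indep_mod_idealD[OF assms(1)])
  with *(2,3) assms(2) show "c i = 0" by (auto split: if_splits)
qed

text \<open>
  Independence modulo the Hilbert ideal implies independence over the ring of invariants. In a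
  relation with all \<open>f i\<close> nonzero, let \<open>f i0\<close> have least degree. By Chevalley's lemma \<open>f i0\<close> is a
  combination of the other \<open>f j\<close>, as \<open>e i0\<close> is not in the ideal, and the coefficients are constants
  because of the choice of \<open>i0\<close>. Substituting it gives a shorter relation between the functions
  \<open>e j + c j * e i0\<close>, which are again independent modulo the ideal.
\<close>
lemma invariant_independent:
  assumes "finite J" "indep_mod_ideal J b e"
    and "\<And>i. i \<in> J \<Longrightarrow> f i = (\<lambda>x. 0) \<or> invariant W (f i) \<and> hpoly (a i) (f i) \<and> a i + b i = D"
    and "\<And>x. (\<Sum>i\<in>J. f i x * e i x) = 0" "i \<in> J"
  shows "f i = (\<lambda>x. 0)"
  using assms
proof (induction "card J" arbitrary: J e i rule: less_induct)
  case less
  note fin = less.prems(1) and ind = less.prems(2) and f = less.prems(3) and rel = less.prems(4)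
  show ?case
  proof (cases "\<exists>j\<in>J. f j = (\<lambda>x. 0)")
    case True
    then obtain j where j: "j \<in> J" "f j = (\<lambda>x. 0)" by blast
    show ?thesis
    proof (cases "i = j")
      case False
      have "(\<Sum>i\<in>J - {j}. f i x * e i x) = 0" for x
        using rel[of x] j by (simp add: sum.remove[OF fin j(1)])
      moreover have "card (J - {j}) < card J" using fin j(1) by (rule card_Diff1_less)
      moreover have "indep_mod_ideal (J - {j}) b e"
        using indep_mod_ideal_subset[OF ind _ fin] by blast
      ultimately show ?thesis
        using less.hyps[of "J - {j}" e i] fin f less.prems(5) False by auto
    qed (simp add: j)
  next
    case False
    then have f: "invariant W (f j)" "hpoly (a j) (f j)" "a j + b j = D" "f j \<noteq> (\<lambda>x. 0)" if "j \<in> J" for j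
      using f that by auto
    obtain i0 where i0: "i0 \<in> J" "\<And>j. j \<in> J \<Longrightarrow> a i0 \<le> a j"
      using arg_min_if_finite(1)[OF fin, of a] arg_min_least[OF fin, of _ a] less.prems(5) by blast
    define J' where "J' = J - {i0}"
    have J': "finite J'" "i0 \<notin> J'" "J = insert i0 J'" "J' \<subseteq> J" "card J' < card J"
      using fin i0(1) card_Diff1_less[OF fin i0(1)] by (auto simp: J'_def)
    have he: "hpoly (b j) (e j)" if "j \<in> J" for j
      using ind that by (simp add: indep_mod_ideal_def)
    have "inv_ideal W (b i0) (e i0) \<or>
      (\<exists>r. (\<forall>j\<in>J'. r j = (\<lambda>x. 0) \<or> (\<exists>c. hpoly c (r j) \<and> a j + c = a i0)) \<and>
        (\<forall>x. f i0 x = (\<Sum>j\<in>J'. r j x * f j x)))"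
    proof (rule chevalley_syzygy[OF f(1,2)[OF i0(1)] he[OF i0(1)] f(3)[OF i0(1)] J'(1)])
      show "invariant W (f j) \<and> hpoly (a j) (f j) \<and> hpoly (b j) (\<lambda>x. - e j x) \<and> a j + b j = D"
        if "j \<in> J'" for j
        using f[of j] he[of j] hpoly_uminus[of "b j" "e j"] J'(4) that by auto
      show "f i0 x * e i0 x = (\<Sum>j\<in>J'. f j x * - e j x)" for x
        using rel[of x] J' by (simp add: sum_negf add_eq_0_iff)
    qed
    moreover have "\<not> inv_ideal W (b i0) (e i0)"
    proof
      assume "inv_ideal W (b i0) (e i0)"
      moreover have "(\<Sum>j\<in>{j\<in>J. b j = b i0}. of_bool (j = i0) * e j x) = e i0 x" for x
        using i0(1) fin by (subst sum.remove[of _ i0]) auto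
      ultimately have "inv_ideal W (b i0) (\<lambda>x. \<Sum>j\<in>{j\<in>J. b j = b i0}. of_bool (j = i0) * e j x)"
        by simp
      then have "\<forall>j\<in>J. b j = b i0 \<longrightarrow> of_bool (j = i0) = (0::complex)"
        by (rule indep_mod_idealD[OF ind])
      then show False using i0(1) by auto
    qed
    ultimately obtain r where r: "\<And>j. j \<in> J' \<Longrightarrow> r j = (\<lambda>x. 0) \<or> (\<exists>c. hpoly c (r j) \<and> a j + c = a i0)"
      "\<And>x. f i0 x = (\<Sum>j\<in>J'. r j x * f j x)" by blast
    define c where "c = (\<lambda>j. r j 0)"
    \<comment> \<open>by minimality of the degree of \<open>f i0\<close> the multipliers have degree 0\<close>
    have rc: "r j = (\<lambda>x. c j)" "c j \<noteq> 0 \<Longrightarrow> b j = b i0" if j: "j \<in> J'" for j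
    proof -
      have "r j = (\<lambda>x. c j) \<and> (c j \<noteq> 0 \<longrightarrow> b j = b i0)"
      proof (cases "r j = (\<lambda>x. 0)")
        case False
        then obtain d where d: "hpoly d (r j)" "a j + d = a i0" using r(1)[OF j] by blast
        moreover have "a i0 \<le> a j" using i0(2) j J'(4) by blast
        ultimately have "d = 0" "a j = a i0" by auto
        then show ?thesis
          using hpoly_0_const[of "r j"] d(1) f(3)[of j] f(3)[OF i0(1)] j J'(4) by (auto simp: c_def)
      qed (simp add: c_def)
      then show "r j = (\<lambda>x. c j)" "c j \<noteq> 0 \<Longrightarrow> b j = b i0" by auto
    qed
    define e' where "e' = (\<lambda>j x. e j x + c j * e i0 x)"
    have rel': "(\<Sum>j\<in>J'. f j x * e' j x) = 0" for x
    proof -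
      have "0 = f i0 x * e i0 x + (\<Sum>j\<in>J'. f j x * e j x)" using rel[of x] J' by simp
      also have "f i0 x = (\<Sum>j\<in>J'. c j * f j x)" unfolding r(2) by (rule sum.cong) (simp_all add: rc)
      finally show ?thesis
        by (simp add: e'_def distrib_left sum.distrib sum_distrib_left sum_distrib_right mult_ac add.commute)
    qed
    have "indep_mod_ideal J' b e'"
      unfolding indep_mod_ideal_def
    proof (intro conjI ballI allI impI)
      show "hpoly (b j) (e' j)" if j: "j \<in> J'" for j
      proof -
        have "hpoly (b j) (\<lambda>x. c j * e i0 x)"
        proof (cases "c j = 0")
          case False
          then show ?thesis using rc(2)[OF j] hpoly_scale[OF he[OF i0(1)]] by simp
        qed (simp add: hpoly_zero)
        then show ?thesis unfolding e'_def using he j J'(4) by (intro hpoly_add) auto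
      qed
      fix k q j assume q: "inv_ideal W k (\<lambda>x. \<Sum>j\<in>{j\<in>J'. b j = k}. q j * e' j x)" "j \<in> J'" "b j = k"
      define q' where "q' = (\<lambda>j. if j = i0 then (\<Sum>j\<in>{j\<in>J'. b j = k}. q j * c j) else q j)"
      have "(\<Sum>j\<in>{j\<in>J'. b j = k}. q j * e' j x) = (\<Sum>j\<in>{j\<in>J. b j = k}. q' j * e j x)" for x
      proof -
        have "(\<Sum>j\<in>{j\<in>J'. b j = k}. q j * e' j x) =
          (\<Sum>j\<in>{j\<in>J'. b j = k}. q j * e j x) + q' i0 * e i0 x"
          by (simp add: e'_def q'_def distrib_left sum.distrib sum_distrib_right mult.assoc)
        also have "(\<Sum>j\<in>{j\<in>J'. b j = k}. q j * e j x) = (\<Sum>j\<in>{j\<in>J'. b j = k}. q' j * e j x)"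
          using J'(2) by (intro sum.cong) (auto simp: q'_def)
        also have "\<dots> + q' i0 * e i0 x = (\<Sum>j\<in>{j\<in>J. b j = k}. q' j * e j x)"
        proof (cases "b i0 = k")
          case True
          then have "{j\<in>J. b j = k} = insert i0 {j\<in>J'. b j = k}" using J' by auto
          then show ?thesis using J' by simp
        next
          case False
          then have "{j\<in>J. b j = k} = {j\<in>J'. b j = k}" using J' by auto
          moreover have "q' i0 = 0"
            unfolding q'_def using rc(2) False by (auto intro!: sum.neutral)
          ultimately show ?thesis by simp
        qed
        finally show ?thesis .
      qed
      with q(1) have "inv_ideal W k (\<lambda>x. \<Sum>j\<in>{j\<in>J. b j = k}. q' j * e j x)" by simp
      then have "\<forall>j\<in>J. b j = k \<longrightarrow> q' j = 0"
        by (rule indep_mod_idealD[OF ind])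
      then have "q' j = 0" using q(2,3) J'(4) by blast
      then show "q j = 0" using q(2) J'(2) by (auto simp: q'_def split: if_splits)
    qed
    then have "f j = (\<lambda>x. 0)" if "j \<in> J'" for j
      using less.hyps[OF J'(5,1) _ _ rel' that] less.prems(3) J'(4) by blast
    with f(4) J'(4) have "J' = {}" by blast
    then have "f i0 = (\<lambda>x. 0)" using r(2) by auto
    with f(4) i0(1) show ?thesis by blast
  qed
qed

end

context reflection_group
begin

text \<open>
  For more than \<open>card W\<close> functions \<open>e i\<close> there is a nontrivial \<open>c\<close> that annihilates all the rows
  \<open>e i \<circ> g\<close>. Then every translate of \<open>c\<close> annihilates \<open>e\<close> itself, and so do the sums of the translates
  of \<open>l ^ t * c i\<close>, which are invariant. These sums must therefore vanish for all \<open>t\<close>; but if \<open>l\<close> separates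
  the orbit of \<open>y\<close>, they determine the values of \<open>c\<close> at \<open>y\<close>.
\<close>
lemma card_indep_mod_ideal_le:
  assumes J: "finite J" and ind: "indep_mod_ideal J b e"
  shows "card J \<le> card W"
proof (rule ccontr)
  assume "\<not> card J \<le> card W"
  then have less: "card W < card J" by simp
  have he: "hpoly (b j) (e j)" if "j \<in> J" for j
    using ind that by (simp add: indep_mod_ideal_def)
  have "\<exists>c a D. (\<forall>i\<in>J. c i = (\<lambda>x. 0) \<or> hpoly (a i) (c i) \<and> a i + b i = D) \<and>
    (\<exists>i\<in>J. c i \<noteq> (\<lambda>x. 0)) \<and> (\<forall>k\<in>W. \<forall>x. (\<Sum>i\<in>J. c i x * e i (k *v x)) = 0)"
    by (rule hpoly_underdetermined_system[OF finite_W J less]) (intro hpoly_compose he)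
  then obtain c a D where c: "\<forall>i\<in>J. c i = (\<lambda>x. 0) \<or> hpoly (a i) (c i) \<and> a i + b i = D"
    "\<exists>i\<in>J. c i \<noteq> (\<lambda>x. 0)" "\<forall>k\<in>W. \<forall>x. (\<Sum>i\<in>J. c i x * e i (k *v x)) = 0"
    by (elim exE conjE)
  obtain i0 where i0: "i0 \<in> J" "c i0 \<noteq> (\<lambda>x. 0)" using c(2) by blast
  then obtain y where y: "c i0 y \<noteq> 0" by blast
  obtain \<alpha> where \<alpha>: "inj_on (\<lambda>v. \<Sum>i\<in>UNIV. \<alpha> i * v $ i) ((\<lambda>g. g *v y) ` W)"
    using separating_form[of "(\<lambda>g. g *v y) ` W"] finite_W by blast
  define l where "l = (\<lambda>v::complex^'n. \<Sum>i\<in>UNIV. \<alpha> i * v $ i)"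
  have l: "hpoly 1 l" unfolding l_def by (rule hpoly_linear_form)
  define f where "f = (\<lambda>t i x. \<Sum>g\<in>W. l (g *v x) ^ t * c i (g *v x))"
  have "f t i = (\<lambda>x. 0)" if "i \<in> J" for t i
  proof (rule invariant_independent[OF J ind _ _ that])
    show "f t i = (\<lambda>x. 0) \<or> invariant W (f t i) \<and> hpoly (t + a i) (f t i) \<and> t + a i + b i = t + D"
      if i: "i \<in> J" for i
    proof (cases "c i = (\<lambda>x. 0)")
      case True then show ?thesis by (simp add: f_def)
    next
      case False
      then have c': "hpoly (a i) (c i)" "a i + b i = D" using c(1) i by auto
      have "hpoly (t + a i) (\<lambda>x. l x ^ t * c i x)"
        using hpoly_mult[OF hpoly_power[OF l, of t] c'(1)] by simp
      then have "hpoly (t + a i) (f t i)"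
        unfolding f_def by (intro hpoly_sum hpoly_compose[of _ "\<lambda>x. l x ^ t * c i x"])
      moreover have "invariant W (f t i)"
        using sum_right_mult[of _ "\<lambda>u. l (u *v _) ^ t * c i (u *v _)"]
        by (simp add: invariant_def f_def matrix_vector_mul_assoc)
      ultimately show ?thesis using c'(2) by simp
    qed
    fix x
    have "(\<Sum>i\<in>J. c i (g *v x) * e i x) = 0" if g: "g \<in> W" for g
    proof -
      obtain g' where g': "g' \<in> W" "g' ** g = mat 1" using W_inverse[OF g] by metis
      from c(3)[rule_format, OF g'(1), of "g *v x"] show ?thesis
        by (simp add: matrix_vector_mul_assoc g'(2))
    qed
    then have "(\<Sum>g\<in>W. l (g *v x) ^ t * (\<Sum>i\<in>J. c i (g *v x) * e i x)) = 0" by simp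
    also have "(\<Sum>g\<in>W. l (g *v x) ^ t * (\<Sum>i\<in>J. c i (g *v x) * e i x)) = (\<Sum>i\<in>J. f t i x * e i x)"
      unfolding f_def sum_distrib_left sum_distrib_right
      by (subst sum.swap) (simp add: mult.assoc)
    finally show "(\<Sum>i\<in>J. f t i x * e i x) = 0" .
  qed
  then have f0: "f t i0 y = 0" for t using i0(1) by simp
  \<comment> \<open>a combination of the averages that isolates the value of \<open>c i0\<close> at \<open>y\<close>\<close>
  obtain P where P: "\<forall>v\<in>(\<lambda>g. g *v y) ` W. poly P (l v) = (if v = y then 1 else 0)"
    using interpolation_poly[of "(\<lambda>g. g *v y) ` W" l "\<lambda>v. if v = y then 1 else 0"] finite_W \<alpha>
    unfolding l_def by blast
  have "(\<Sum>t\<le>Polynomial.degree P. Polynomial.coeff P t * f t i0 y) = (\<Sum>g\<in>W. poly P (l (g *v y)) * c i0 (g *v y))"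
    unfolding f_def poly_altdef sum_distrib_left sum_distrib_right
    by (subst sum.swap) (simp add: mult.assoc)
  also have "\<dots> = (\<Sum>g\<in>W. if g *v y = y then c i0 y else 0)"
    using P by (intro sum.cong) auto
  also have "\<dots> = of_nat (card {g\<in>W. g *v y = y}) * c i0 y"
    using finite_W by (simp add: sum.If_cases Int_def)
  finally have "of_nat (card {g\<in>W. g *v y = y}) * c i0 y = 0" using f0 by simp
  moreover have "card {g\<in>W. g *v y = y} \<noteq> 0"
    using finite_W W_one by (auto simp: card_eq_0_iff)
  ultimately show False using y by simp
qed

text \<open>
  The coefficients are arbitrary invariant functions: only their being constant on orbits matters.
\<close>
definition generated_by :: "'i set \<Rightarrow> ('i \<Rightarrow> complex^'n \<Rightarrow> complex) \<Rightarrow> (complex^'n \<Rightarrow> complex) \<Rightarrow> bool"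
  where "generated_by J e h \<longleftrightarrow>
    (\<exists>f. (\<forall>i\<in>J. invariant W (f i)) \<and> (\<forall>x. h x = (\<Sum>i\<in>J. f i x * e i x)))"

lemma generated_by_zero: "generated_by J e (\<lambda>x. 0)"
  unfolding generated_by_def by (intro exI[of _ "\<lambda>i x. 0"]) (simp add: invariant_def)

lemma generated_by_add:
  assumes "generated_by J e h" "generated_by J e h'"
  shows "generated_by J e (\<lambda>x. h x + h' x)"
proof -
  obtain f f' where "\<forall>i\<in>J. invariant W (f i)" "\<forall>x. h x = (\<Sum>i\<in>J. f i x * e i x)"
    "\<forall>i\<in>J. invariant W (f' i)" "\<forall>x. h' x = (\<Sum>i\<in>J. f' i x * e i x)"
    using assms unfolding generated_by_def by blast
  then show ?thesis
    unfolding generated_by_def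
    by (intro exI[of _ "\<lambda>i x. f i x + f' i x"]) (auto simp: invariant_def distrib_right sum.distrib)
qed

lemma generated_by_mult:
  assumes "generated_by J e h" "invariant W p"
  shows "generated_by J e (\<lambda>x. p x * h x)"
proof -
  obtain f where "\<forall>i\<in>J. invariant W (f i)" "\<forall>x. h x = (\<Sum>i\<in>J. f i x * e i x)"
    using assms unfolding generated_by_def by blast
  then show ?thesis
    unfolding generated_by_def using assms(2)
    by (intro exI[of _ "\<lambda>i x. p x * f i x"]) (auto simp: invariant_def sum_distrib_left mult.assoc)
qed

lemma generated_by_scale: "generated_by J e h \<Longrightarrow> generated_by J e (\<lambda>x. c * h x)"
  using generated_by_mult[of J e h "\<lambda>x. c"] by (simp add: invariant_def)

lemma generated_by_sum:
  assumes "\<And>t. t \<in> T \<Longrightarrow> generated_by J e (h t)"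
  shows "generated_by J e (\<lambda>x. \<Sum>t\<in>T. h t x)"
proof (cases "finite T")
  case True
  then show ?thesis using assms
    by (induction T) (auto intro: generated_by_zero generated_by_add)
qed (simp add: generated_by_zero)

lemma generated_by_self:
  assumes "finite J" "j \<in> J" shows "generated_by J e (e j)"
proof -
  have "e j x = (\<Sum>i\<in>J. of_bool (i = j) * e i x)" for x
    using assms by (subst sum.remove[of _ j]) auto
  then show ?thesis
    unfolding generated_by_def by (intro exI[of _ "\<lambda>i x. of_bool (i = j)"]) (auto simp: invariant_def)
qed

lemma generated_by_inv_ideal:
  assumes "inv_ideal W k h" "\<And>j q. j < k \<Longrightarrow> hpoly j q \<Longrightarrow> generated_by J e q"
  shows "generated_by J e h"
  using assms
proof (induction rule: inv_ideal.induct)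
  case (inv_ideal_gen p a b q)
  have "b < a + b" using inv_ideal_gen.hyps(3) by simp
  then have "generated_by J e q" using inv_ideal_gen.hyps(4) by (rule inv_ideal_gen.prems)
  then show ?case using inv_ideal_gen.hyps(1) by (rule generated_by_mult)
qed (auto intro: generated_by_zero generated_by_add)

text \<open>
  Let \<open>e\<close> be a family of greatest size among those that are independent modulo the Hilbert ideal.
  It spans the polynomial functions modulo the ideal, and induction on the degree (the graded Nakayama
  lemma) turns this into generation over the invariants.
\<close>
theorem hpoly_generators:
  shows "\<exists>m (b :: nat \<Rightarrow> nat) e. m \<le> card W \<and> (\<forall>i<m. hpoly (b i) (e i)) \<and>
    (\<forall>k h. hpoly k h \<longrightarrow> generated_by {..<m} e h)"
proof -
  define M where "M = {m. \<exists>(b :: nat \<Rightarrow> nat) e. indep_mod_ideal {..<m} b e}"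
  have bound: "m \<le> card W" if "m \<in> M" for m
    using that card_indep_mod_ideal_le[of "{..<m}"] unfolding M_def by force
  then have "finite M" by (rule finite_nat_set_iff_bounded_le[THEN iffD2, OF exI, OF ballI])
  moreover have "0 \<in> M" by (simp add: M_def indep_mod_ideal_def)
  ultimately have m: "Max M \<in> M" by (intro Max_in) auto
  define m where "m = Max M"
  obtain b :: "nat \<Rightarrow> nat" and e where ind: "indep_mod_ideal {..<m} b e"
    using m unfolding m_def M_def by blast
  have max: "Suc m \<notin> M"
    using Max_ge[OF \<open>finite M\<close>, of "Suc m"] unfolding m_def by auto
  have he: "hpoly (b i) (e i)" if "i < m" for i using ind that by (simp add: indep_mod_ideal_def)
  have "generated_by {..<m} e h" if "hpoly k h" for k h
    using that
  proof (induction k arbitrary: h rule: less_induct)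
    case (less k)
    define b' where "b' = b(m := k)"
    define e' where "e' = e(m := h)"
    have "\<not> indep_mod_ideal {..<Suc m} b' e'" using max by (auto simp: M_def)
    moreover have "\<forall>i\<in>{..<Suc m}. hpoly (b' i) (e' i)"
      using he less.prems by (auto simp: b'_def e'_def less_Suc_eq)
    ultimately obtain k' c i1 where k': "inv_ideal W k' (\<lambda>x. \<Sum>i\<in>{i\<in>{..<Suc m}. b' i = k'}. c i * e' i x)"
      "i1 < Suc m" "b' i1 = k'" "c i1 \<noteq> 0"
      unfolding indep_mod_ideal_def by auto
    have old: "(\<Sum>i\<in>{i\<in>{..<m}. b' i = k'}. c i * e' i x) = (\<Sum>i\<in>{i\<in>{..<m}. b i = k'}. c i * e i x)" for x
      by (intro sum.cong) (auto simp: b'_def e'_def)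
    have "k' = k \<and> c m \<noteq> 0"
    proof (rule ccontr)
      assume *: "\<not> (k' = k \<and> c m \<noteq> 0)"
      have eq: "(\<Sum>i\<in>{i\<in>{..<Suc m}. b' i = k'}. c i * e' i x) = (\<Sum>i\<in>{i\<in>{..<m}. b' i = k'}. c i * e' i x)" for x
        using * by (intro sum.mono_neutral_right) (auto simp: b'_def less_Suc_eq)
      have "inv_ideal W k' (\<lambda>x. \<Sum>i\<in>{i\<in>{..<m}. b i = k'}. c i * e i x)"
        using k'(1) by (simp only: eq old)
      then have "\<forall>i\<in>{..<m}. b i = k' \<longrightarrow> c i = 0" by (rule indep_mod_idealD[OF ind])
      then show False using k'(2-4) * by (auto simp: b'_def less_Suc_eq split: if_splits)
    qed
    then have cm: "k' = k" "c m \<noteq> 0" by auto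
    have "{i\<in>{..<Suc m}. b' i = k'} = insert m {i\<in>{..<m}. b' i = k'}"
      using cm by (auto simp: b'_def less_Suc_eq)
    then have split: "(\<Sum>i\<in>{i\<in>{..<Suc m}. b' i = k'}. c i * e' i x) =
        c m * h x + (\<Sum>i\<in>{i\<in>{..<m}. b i = k'}. c i * e i x)" for x
      using old by (simp add: e'_def)
    have "generated_by {..<m} e (\<lambda>x. c m * h x + (\<Sum>i\<in>{i\<in>{..<m}. b i = k'}. c i * e i x))"
    proof (rule generated_by_inv_ideal)
      show "inv_ideal W k' (\<lambda>x. c m * h x + (\<Sum>i\<in>{i\<in>{..<m}. b i = k'}. c i * e i x))"
        using k'(1) unfolding split .
    qed (use less.IH cm(1) in blast)
    moreover have "generated_by {..<m} e (\<lambda>x. - 1 * (\<Sum>i\<in>{i\<in>{..<m}. b i = k'}. c i * e i x))"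
      by (intro generated_by_scale generated_by_sum generated_by_self) auto
    ultimately have "generated_by {..<m} e (\<lambda>x. 1 / c m * ((c m * h x + (\<Sum>i\<in>{i\<in>{..<m}. b i = k'}. c i * e i x))
        + - 1 * (\<Sum>i\<in>{i\<in>{..<m}. b i = k'}. c i * e i x)))"
      by (rule generated_by_scale[OF generated_by_add])
    then show ?case using cm(2) by simp
  qed
  then show ?thesis using bound[OF m] he unfolding m_def[symmetric] by blast
qed

end

section \<open>Determinants of variable size\<close>

text \<open>
  A determinant whose size is a number and not a type, since the size will be the order of the group.
\<close>
definition leibniz_det :: "nat \<Rightarrow> (nat \<Rightarrow> nat \<Rightarrow> complex) \<Rightarrow> complex"
  where "leibniz_det n A = (\<Sum>p | p permutes {..<n}. of_int (sign p) * (\<Prod>i<n. A i (p i)))"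

lemma leibniz_det_cong:
  assumes "\<And>i j. i < n \<Longrightarrow> j < n \<Longrightarrow> A i j = B i j"
  shows "leibniz_det n A = leibniz_det n B"
  unfolding leibniz_det_def
proof (intro sum.cong refl)
  fix p assume "p \<in> {p. p permutes {..<n}}"
  then have "p i < n" if "i < n" for i using that permutes_in_image[of p "{..<n}" i] by auto
  then show "of_int (sign p) * (\<Prod>i<n. A i (p i)) = of_int (sign p) * (\<Prod>i<n. B i (p i))"
    using assms by simp
qed

lemma leibniz_det_permute_rows:
  assumes q: "q permutes {..<n}"
  shows "leibniz_det n (\<lambda>i. A (q i)) = of_int (sign q) * leibniz_det n A"
proof -
  have qp: "permutation q" using q by (auto simp: permutation_permutes)
  have "leibniz_det n (\<lambda>i. A (q i)) =
      (\<Sum>p | p permutes {..<n}. of_int (sign (p \<circ> q)) * (\<Prod>i<n. A (q i) ((p \<circ> q) i)))"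
    unfolding leibniz_det_def by (rule sum_permutations_compose_right[OF q])
  also have "\<dots> = (\<Sum>p | p permutes {..<n}. of_int (sign q) * (of_int (sign p) * (\<Prod>i<n. A i (p i))))"
  proof (intro sum.cong refl)
    fix p assume "p \<in> {p. p permutes {..<n}}"
    then have "permutation p" by (auto simp: permutation_permutes)
    then have "of_int (sign (p \<circ> q)) = (of_int (sign q) * of_int (sign p) :: complex)"
      using qp by (simp add: sign_compose mult.commute)
    moreover have "(\<Prod>i<n. A (q i) ((p \<circ> q) i)) = (\<Prod>i<n. A i (p i))"
      using prod.reindex_bij_betw[OF permutes_imp_bij[OF q], of "\<lambda>i. A i (p i)"] by simp
    ultimately show "of_int (sign (p \<circ> q)) * (\<Prod>i<n. A (q i) ((p \<circ> q) i)) =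
        of_int (sign q) * (of_int (sign p) * (\<Prod>i<n. A i (p i)))"
      by (simp add: mult.assoc)
  qed
  finally show ?thesis by (simp add: leibniz_det_def sum_distrib_left)
qed

lemma leibniz_det_equal_rows:
  assumes "i < n" "j < n" "i \<noteq> j" "\<And>k. A i k = A j k"
  shows "leibniz_det n A = 0"
proof -
  let ?t = "Transposition.transpose i j"
  have "A (?t k) = A k" for k using assms(4) by (auto simp: Transposition.transpose_def)
  then have "leibniz_det n A = leibniz_det n (\<lambda>k. A (?t k))" by simp
  also have "\<dots> = of_int (sign ?t) * leibniz_det n A"
    by (rule leibniz_det_permute_rows) (use assms in \<open>auto intro: permutes_swap_id\<close>)
  finally show ?thesis using assms(3) by (simp add: sign_swap_id)
qed

text \<open>
  Expanding the products of sums gives a sum over all functions \<open>f\<close> of determinants of matrices with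
  rows \<open>B (f i)\<close>; those with two equal rows vanish, so that only permutations remain.
\<close>
lemma leibniz_det_mult:
  "leibniz_det n (\<lambda>i k. \<Sum>j<n. A i j * B j k) = leibniz_det n A * leibniz_det n B"
proof -
  let ?F = "{..<n} \<rightarrow>\<^sub>E {..<n}"
  have "leibniz_det n (\<lambda>i k. \<Sum>j<n. A i j * B j k) =
    (\<Sum>p | p permutes {..<n}. \<Sum>f\<in>?F. of_int (sign p) * (\<Prod>i<n. A i (f i) * B (f i) (p i)))"
    unfolding leibniz_det_def by (simp add: prod_sum_PiE sum_distrib_left)
  also have "\<dots> = (\<Sum>f\<in>?F. (\<Prod>i<n. A i (f i)) * leibniz_det n (\<lambda>i. B (f i)))"
    unfolding leibniz_det_def by (subst sum.swap) (simp add: sum_distrib_left prod.distrib mult_ac)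
  also have "\<dots> = (\<Sum>f\<in>{f\<in>?F. inj_on f {..<n}}. (\<Prod>i<n. A i (f i)) * leibniz_det n (\<lambda>i. B (f i)))"
  proof (rule sum.mono_neutral_right)
    show "\<forall>f\<in>?F - {f \<in> ?F. inj_on f {..<n}}. (\<Prod>i<n. A i (f i)) * leibniz_det n (\<lambda>i. B (f i)) = 0"
    proof
      fix f assume "f \<in> ?F - {f \<in> ?F. inj_on f {..<n}}"
      then obtain i j where "i < n" "j < n" "i \<noteq> j" "f i = f j" by (auto simp: inj_on_def)
      then have "leibniz_det n (\<lambda>i. B (f i)) = 0" by (intro leibniz_det_equal_rows[of i n j]) auto
      then show "(\<Prod>i<n. A i (f i)) * leibniz_det n (\<lambda>i. B (f i)) = 0" by simp
    qed
  qed (auto intro: finite_PiE)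
  also have "\<dots> = (\<Sum>q | q permutes {..<n}. (\<Prod>i<n. A i (q i)) * leibniz_det n (\<lambda>i. B (q i)))"
  proof (rule sum.reindex_bij_witness[of _ "\<lambda>q. restrict q {..<n}" "\<lambda>f i. if i < n then f i else i"])
    fix f assume f: "f \<in> {f \<in> ?F. inj_on f {..<n}}"
    let ?q = "\<lambda>i. if i < n then f i else i"
    show "restrict ?q {..<n} = f" using f by (auto simp: PiE_def extensional_def)
    have "inj_on ?q {..<n}" using f by (auto simp: inj_on_def)
    moreover have "?q ` {..<n} \<subseteq> {..<n}" using f by auto
    ultimately have "bij_betw ?q {..<n} {..<n}"
      unfolding bij_betw_def using endo_inj_surj[of "{..<n}" ?q] by blast
    then have "?q permutes {..<n}" by (rule bij_imp_permutes) simp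
    then show "?q \<in> {q. q permutes {..<n}}" by simp
    show "(\<Prod>i<n. A i (?q i)) * leibniz_det n (\<lambda>i. B (?q i)) = (\<Prod>i<n. A i (f i)) * leibniz_det n (\<lambda>i. B (f i))"
      by (intro arg_cong2[of _ _ _ _ "(*)"] prod.cong leibniz_det_cong) auto
  next
    fix q assume "q \<in> {q. q permutes {..<n}}"
    then have q: "q permutes {..<n}" by simp
    show "(\<lambda>i. if i < n then restrict q {..<n} i else i) = q"
      using permutes_not_in[OF q] by auto
    show "restrict q {..<n} \<in> {f \<in> ?F. inj_on f {..<n}}"
      using permutes_in_image[OF q] permutes_inj_on[OF q, of "{..<n}"] by (auto simp: inj_on_def)
  qed
  also have "\<dots> = leibniz_det n A * leibniz_det n B"
    unfolding leibniz_det_def[of n A] sum_distrib_right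
    by (intro sum.cong refl) (simp add: leibniz_det_permute_rows)
  finally show ?thesis .
qed

lemma leibniz_det_one: "leibniz_det n (\<lambda>i j. if i = j then 1 else 0) = 1"
proof -
  have "leibniz_det n (\<lambda>i j. if i = j then 1 else 0) = (\<Sum>p\<in>{id}. of_int (sign p) * (\<Prod>i<n. if i = p i then 1 else 0))"
    unfolding leibniz_det_def
  proof (rule sum.mono_neutral_right)
    show "\<forall>p\<in>{p. p permutes {..<n}} - {id}. of_int (sign p) * (\<Prod>i<n. if i = p i then 1 else 0) = (0::complex)"
    proof
      fix p assume "p \<in> {p. p permutes {..<n}} - {id}"
      then have p: "p permutes {..<n}" "p \<noteq> id" by auto
      then obtain i where "p i \<noteq> i" by (auto simp: fun_eq_iff)
      then have "i < n" using permutes_not_in[OF p(1), of i] by auto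
      with \<open>p i \<noteq> i\<close> show "of_int (sign p) * (\<Prod>i<n. if i = p i then 1 else 0) = (0::complex)"
        by (force intro: bexI[of _ i])
    qed
  qed (auto simp: permutes_id finite_permutations)
  then show ?thesis by simp
qed

section \<open>Steinberg's fixed point theorem\<close>

lemma leibniz_det_holomorphic:
  assumes "\<And>i j. i < n \<Longrightarrow> j < n \<Longrightarrow> (\<lambda>t. A t i j) holomorphic_on S"
  shows "(\<lambda>t. leibniz_det n (A t)) holomorphic_on S"
  unfolding leibniz_det_def
proof (intro holomorphic_on_sum holomorphic_on_mult holomorphic_on_const holomorphic_on_prod)
  fix p i assume "p \<in> {p. p permutes {..<n}}" "i \<in> {..<n}"
  then show "(\<lambda>t. A t i (p i)) holomorphic_on S"
    using assms[of i "p i"] permutes_in_image[of p "{..<n}" i] by auto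
qed

lemma leibniz_det_continuous:
  assumes "\<And>i j. i < n \<Longrightarrow> j < n \<Longrightarrow> continuous_on S (\<lambda>t. A t i j)"
  shows "continuous_on S (\<lambda>t. leibniz_det n (A t))"
  unfolding leibniz_det_def
proof (intro continuous_on_sum continuous_on_mult continuous_on_const continuous_on_prod)
  fix p i assume "p \<in> {p. p permutes {..<n}}" "i \<in> {..<n}"
  then show "continuous_on S (\<lambda>t. A t i (p i))"
    using assms[of i "p i"] permutes_in_image[of p "{..<n}" i] by auto
qed

context reflection_group
begin

text \<open>
  Take at most \<open>card W\<close> generators over the invariants, pad them with zeros, and let \<open>\<Delta> y\<close> be the
  determinant of their values on the translates of \<open>y\<close>. If the translates are distinct, each function
  on the orbit is interpolated by a polynomial, which is a combination of the generators with
  coefficients that are constant on the orbit; so the columns span and \<open>\<Delta> y\<close> is not zero. If \<open>g\<close>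
  fixes \<open>y\<close>, the rows of \<open>g\<close> and of the identity agree.
\<close>
lemma stabilizer_detecting_function:
  obtains \<Delta> :: "complex^'n \<Rightarrow> complex" where
    "\<And>y. (\<forall>g\<in>W. g *v y = y \<longrightarrow> g = mat 1) \<Longrightarrow> \<Delta> y \<noteq> 0"
    "\<And>y g. g \<in> W \<Longrightarrow> g *v y = y \<Longrightarrow> g \<noteq> mat 1 \<Longrightarrow> \<Delta> y = 0"
    "continuous_on UNIV \<Delta>" "\<And>y z S. (\<lambda>t. \<Delta> (y + t *s z)) holomorphic_on S"
proof -
  obtain m and b :: "nat \<Rightarrow> nat" and e where m: "m \<le> card W" and he: "\<forall>i<m. hpoly (b i) (e i)"
    and gen: "\<forall>k h. hpoly k h \<longrightarrow> generated_by {..<m} e h"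
    using hpoly_generators by blast
  define n where "n = card W"
  obtain w where w: "bij_betw w {..<n} W"
    using ex_bij_betw_nat_finite[OF finite_W] unfolding n_def atLeast0LessThan by blast
  have wW: "w i \<in> W" if "i < n" for i using w that by (auto simp: bij_betw_def)
  \<comment> \<open>zero columns make the matrix square\<close>
  define E where "E = (\<lambda>j. if j < m then e j else (\<lambda>x. 0))"
  have hE: "\<exists>k. hpoly k (E j)" for j using he hpoly_zero by (auto simp: E_def)
  define \<Delta> where "\<Delta> = (\<lambda>y. leibniz_det n (\<lambda>i j. E j (w i *v y)))"
  show ?thesis
  proof (rule that[of \<Delta>])
    fix y assume free: "\<forall>g\<in>W. g *v y = y \<longrightarrow> g = mat 1"
    have inj: "inj_on (\<lambda>i. w i *v y) {..<n}"
    proof (rule inj_onI)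
      fix i j assume ij: "i \<in> {..<n}" "j \<in> {..<n}" "w i *v y = w j *v y"
      obtain u where u: "u \<in> W" "u ** w j = mat 1" "w j ** u = mat 1"
        using W_inverse[of "w j"] wW ij(2) by (metis lessThan_iff)
      have "(u ** w i) *v y = u *v (w j *v y)" by (simp add: ij(3)[symmetric] matrix_vector_mul_assoc)
      also have "\<dots> = y" by (simp add: u matrix_vector_mul_assoc)
      finally have "u ** w i = mat 1" using free u(1) wW ij(1) W_mult by auto
      then have "w j ** (u ** w i) = w j" by simp
      then have "w i = w j" by (simp add: matrix_mul_assoc u(3))
      then show "i = j" using ij(1,2) w by (auto simp: bij_betw_def inj_on_def)
    qed
    obtain \<alpha> where \<alpha>: "inj_on (\<lambda>v. \<Sum>i\<in>UNIV. \<alpha> i * v $ i) ((\<lambda>i. w i *v y) ` {..<n})"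
      using separating_form[of "(\<lambda>i. w i *v y) ` {..<n}"] by blast
    define l where "l = (\<lambda>v::complex^'n. \<Sum>i\<in>UNIV. \<alpha> i * v $ i)"
    have l: "hpoly 1 l" unfolding l_def by (rule hpoly_linear_form)
    have injl: "inj_on (\<lambda>i. l (w i *v y)) {..<n}"
      using comp_inj_on[OF inj \<alpha>] by (simp add: l_def o_def)
    have "\<exists>f. \<forall>i<n. (\<Sum>j<n. E j (w i *v y) * f j) = (if i = k then 1 else 0)" for k
    proof -
      obtain P where P: "\<forall>i\<in>{..<n}. poly P (l (w i *v y)) = (if i = k then 1 else 0)"
        using interpolation_poly[OF _ injl, of "\<lambda>i. if i = k then 1 else 0"] by blast
      have "generated_by {..<m} e (\<lambda>x. \<Sum>t\<le>Polynomial.degree P. Polynomial.coeff P t * l x ^ t)"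
        using gen hpoly_power[OF l] by (intro generated_by_sum generated_by_scale) auto
      then obtain f where f: "\<forall>j\<in>{..<m}. invariant W (f j)" "\<forall>x. poly P (l x) = (\<Sum>j<m. f j x * e j x)"
        unfolding generated_by_def poly_altdef by blast
      have "(\<Sum>j<n. E j (w i *v y) * f j y) = (if i = k then 1 else 0)" if i: "i < n" for i
      proof -
        have "(\<Sum>j<n. E j (w i *v y) * f j y) = (\<Sum>j<m. f j (w i *v y) * e j (w i *v y))"
          using m f(1) wW[OF i] unfolding n_def[symmetric]
          by (intro sum.mono_neutral_cong_right) (auto simp: E_def invariant_def)
        also have "\<dots> = poly P (l (w i *v y))" using f(2) by simp
        finally show ?thesis using P i by simp
      qed
      then show ?thesis by (intro exI[of _ "\<lambda>j. f j y"]) simp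
    qed
    then have "\<forall>k. \<exists>f. \<forall>i<n. (\<Sum>j<n. E j (w i *v y) * f j) = (if i = k then 1 else 0)" by (rule allI)
    from choice[OF this]
    obtain f where f: "\<forall>k. \<forall>i<n. (\<Sum>j<n. E j (w i *v y) * f k j) = (if i = k then 1 else 0)"
      by (rule exE)
    have "leibniz_det n (\<lambda>i j. E j (w i *v y)) * leibniz_det n (\<lambda>j k. f k j) =
        leibniz_det n (\<lambda>i k. \<Sum>j<n. E j (w i *v y) * f k j)"
      by (rule leibniz_det_mult[symmetric])
    also have "\<dots> = leibniz_det n (\<lambda>i k. if i = k then 1 else 0)"
      by (intro leibniz_det_cong) (rule f[rule_format])
    finally have "leibniz_det n (\<lambda>i j. E j (w i *v y)) * leibniz_det n (\<lambda>j k. f k j) = 1"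
      by (simp add: leibniz_det_one)
    then show "\<Delta> y \<noteq> 0" unfolding \<Delta>_def by force
  next
    fix y g assume g: "g \<in> W" "g *v y = y" "g \<noteq> mat 1"
    have "W = w ` {..<n}" using w by (auto simp: bij_betw_def)
    with g(1) W_one obtain i j where ij: "i < n" "w i = g" "j < n" "w j = mat 1"
      by (metis imageE lessThan_iff)
    then show "\<Delta> y = 0"
      unfolding \<Delta>_def using g(2,3) by (intro leibniz_det_equal_rows[of i n j]) auto
  next
    show "continuous_on UNIV \<Delta>"
      unfolding \<Delta>_def
    proof (rule leibniz_det_continuous)
      fix i j
      obtain k where "hpoly k (E j)" using hE by blast
      from hpoly_continuous_on[OF hpoly_compose[OF this]]
      show "continuous_on UNIV (\<lambda>y. E j (w i *v y))" .
    qed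
    show "(\<lambda>t. \<Delta> (y + t *s z)) holomorphic_on S" for y z S
      unfolding \<Delta>_def
    proof (rule leibniz_det_holomorphic)
      fix i j
      obtain k where "hpoly k (E j)" using hE by blast
      from hpoly_on_line[OF hpoly_compose[OF this], of "w i" y z]
      obtain P where "\<forall>t. E j (w i *v (y + t *s z)) = poly P t" by blast
      then show "(\<lambda>t. E j (w i *v (y + t *s z))) holomorphic_on S"
        by (simp add: holomorphic_intros)
    qed
  qed
qed

text \<open>
  The vanishing of the minors means that \<open>u - 1\<close> maps everything to multiples of \<open>(u - 1) b\<close>, so
  its kernel is a complement of the line spanned by \<open>b\<close>.
\<close>
lemma fixed_hyperplane_if_rank_one:
  fixes u :: "complex^'n^'n"
  assumes u: "u \<in> W" and b: "u *v b \<noteq> b"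
    and rank: "\<And>a i j. (u *v a - a) $ i * (u *v b - b) $ j = (u *v a - a) $ j * (u *v b - b) $ i"
  shows "reflection_along u {x. u *v x = x}"
proof -
  let ?H = "{x. u *v x = x}"
  obtain j where j: "(u *v b - b) $ j \<noteq> 0" using b by (auto simp: vec_eq_iff)
  define l where "l = (\<lambda>a. (u *v a - a) $ j / (u *v b - b) $ j)"
  have eq: "u *v a - a = l a *s (u *v b - b)" for a
  proof (rule vec_eq_iff[THEN iffD2], rule allI)
    fix i
    have "(u *v a - a) $ i = (u *v a - a) $ j * (u *v b - b) $ i / (u *v b - b) $ j"
      using rank[of a i j] j nonzero_eq_divide_eq by metis
    then show "(u *v a - a) $ i = (l a *s (u *v b - b)) $ i"
      unfolding l_def vector_smult_component by simp
  qed
  have sub: "vec.subspace ?H"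
    by (auto simp: vec.subspace_def matrix_vector_right_distrib vec.scale)
  have "a \<in> vec.span (insert b ?H)" for a
  proof -
    have "u *v (a - l a *s b) = a - l a *s b"
      using eq[of a] by (simp add: vec.diff vec.scale vec.scale_right_diff_distrib algebra_simps)
    then have "a - l a *s b \<in> vec.span ?H" by (intro vec.span_base) simp
    then show ?thesis by (auto simp: vec.span_insert)
  qed
  then have "vec.span (insert b ?H) = UNIV" by blast
  then have "vec.dim (insert b ?H) = CARD('n)"
    using vec.dim_eq_full[of "insert b ?H"] by (simp add: vec.dimension_def card_cart_basis)
  moreover have span: "vec.span ?H = ?H" using sub by (simp add: vec.span_eq_iff)
  have "b \<notin> vec.span ?H" unfolding span using b by simp
  ultimately have "vec.dim ?H + 1 = CARD('n)" by (simp add: vec.dim_insert)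
  moreover have "u \<in> carrier GL" using u subgroup.mem_carrier[OF subgroup_W] by blast
  ultimately show ?thesis using sub b by (auto simp: reflection_along_def hyperplane_def)
qed

text \<open>
  Steinberg's fixed point theorem, for points off the reflecting hyperplanes. Suppose that \<open>v\<close> is
  fixed by nontrivial elements. None of them is a reflection, so their fixed spaces have codimension
  at least two, and for generic \<open>a\<close> and \<open>b\<close> the small discs \<open>v + \<epsilon> a + s b\<close> in the variable \<open>s\<close> avoid
  them as soon as \<open>\<epsilon> \<noteq> 0\<close>, whereas the disc with \<open>\<epsilon> = 0\<close> meets them only in its centre. So \<open>\<Delta>\<close> is
  bounded away from 0 on the boundary circles of these discs, uniformly in \<open>\<epsilon>\<close>, and by the maximum
  modulus principle for \<open>1 / \<Delta>\<close> also at their centres \<open>v + \<epsilon> a\<close> with \<open>\<epsilon> \<noteq> 0\<close>. This contradicts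
  \<open>\<Delta> v = 0\<close>: a hypersurface has no isolated piece of codimension two.
\<close>
theorem steinberg:
  assumes g: "g \<in> W" "g *v v = v" and v: "v \<in> hyperplane_complement W"
  shows "g = mat 1"
proof (rule ccontr)
  assume ne: "g \<noteq> mat 1"
  obtain \<Delta> :: "complex^'n \<Rightarrow> complex" where
    \<Delta>: "\<And>y. (\<forall>g\<in>W. g *v y = y \<longrightarrow> g = mat 1) \<Longrightarrow> \<Delta> y \<noteq> 0"
    "\<And>y g. g \<in> W \<Longrightarrow> g *v y = y \<Longrightarrow> g \<noteq> mat 1 \<Longrightarrow> \<Delta> y = 0"
    "continuous_on UNIV \<Delta>" "\<And>y z S. (\<lambda>t. \<Delta> (y + t *s z)) holomorphic_on S"
    using stabilizer_detecting_function by blast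
  have \<Delta>v: "\<Delta> v = 0" using \<Delta>(2) g ne by blast
  define F where "F = {u\<in>W. u *v v = v \<and> u \<noteq> mat 1}"
  have finF: "finite F" using finite_W by (simp add: F_def)
  have lin: "hpoly 1 (\<lambda>x. (u *v x - x) $ i)" for u :: "complex^'n^'n" and i
  proof -
    have "(\<Sum>j\<in>UNIV. (u - mat 1) $ i $ j * x $ j) = (u *v x - x) $ i" for x
    proof -
      have "u *v x - x = (u - mat 1) *v x" by (simp add: matrix_vector_mult_diff_rdistrib)
      then show ?thesis by (simp only: matrix_vector_mult_def vec_lambda_beta)
    qed
    then show ?thesis using hpoly_linear_form[of "\<lambda>j. (u - mat 1) $ i $ j"] by (simp only:)
  qed
  have "\<forall>u\<in>F. \<exists>i. \<exists>x. (u *v x - x) $ i \<noteq> 0"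
  proof
    fix u assume "u \<in> F"
    then have "u \<noteq> mat 1" by (simp add: F_def)
    then obtain x where "u *v x \<noteq> x" by (metis matrix_eq matrix_vector_mul_lid)
    then show "\<exists>i. \<exists>x. (u *v x - x) $ i \<noteq> 0" by (auto simp: vec_eq_iff)
  qed
  from bchoice[OF this] obtain i where i: "\<forall>u\<in>F. \<exists>x. (u *v x - x) $ i u \<noteq> 0" by blast
  have "\<exists>b. \<forall>u\<in>F. (u *v b - b) $ i u \<noteq> 0"
    by (rule hpoly_common_nonzero[OF finF, where k = "\<lambda>_. 1"]) (use i lin in blast)
  then obtain b where "\<forall>u\<in>F. (u *v b - b) $ i u \<noteq> 0" by blast
  then have b: "u *v b \<noteq> b" if "u \<in> F" for u using that by fastforce
  \<comment> \<open>the minors of \<open>(u - 1) a\<close> and \<open>(u - 1) b\<close>; they do not all vanish, as \<open>u\<close> is not a reflection\<close>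
  define M where "M = (\<lambda>u i j a. (u *v b - b) $ j * (u *v a - a) $ i - (u *v b - b) $ i * (u *v a - a) $ j)"
  have M: "hpoly 1 (M u i j)" for u i j
    unfolding M_def by (intro hpoly_diff hpoly_scale lin)
  have "\<forall>u\<in>F. \<exists>p. \<exists>a. M u (fst p) (snd p) a \<noteq> 0"
  proof (rule ballI, rule ccontr)
    fix u assume u: "u \<in> F" and none: "\<not> (\<exists>p. \<exists>a. M u (fst p) (snd p) a \<noteq> 0)"
    have "(u *v a - a) $ i * (u *v b - b) $ j = (u *v a - a) $ j * (u *v b - b) $ i" for a i j
    proof -
      have "M u i j a = 0" using none by (metis fst_conv snd_conv)
      then show ?thesis unfolding M_def by (simp only: eq_iff_diff_eq_0[symmetric] mult.commute)
    qed
    then have "reflection_along u {x. u *v x = x}"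
      using b[OF u] u by (intro fixed_hyperplane_if_rank_one) (auto simp: F_def)
    then have "{x. u *v x = x} \<in> reflecting_hyperplanes W"
      using u by (auto simp: F_def reflecting_hyperplanes_def)
    then show False using v u by (auto simp: F_def hyperplane_complement_def)
  qed
  from bchoice[OF this] obtain p where p: "\<forall>u\<in>F. \<exists>a. M u (fst (p u)) (snd (p u)) a \<noteq> 0" by blast
  have "\<exists>a. \<forall>u\<in>F. M u (fst (p u)) (snd (p u)) a \<noteq> 0"
    by (rule hpoly_common_nonzero[OF finF, where k = "\<lambda>_. 1"]) (use p M in blast)
  then obtain a where a: "\<forall>u\<in>F. M u (fst (p u)) (snd (p u)) a \<noteq> 0" by blast
  define y where "y = (\<lambda>(\<epsilon>::real) s. v + (of_real \<epsilon> *s a + s *s b))"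
  have nofix: "u *v y \<epsilon> s \<noteq> y \<epsilon> s" if u: "u \<in> F" and ne: "\<epsilon> \<noteq> 0 \<or> s \<noteq> 0" for u \<epsilon> s
  proof
    assume "u *v y \<epsilon> s = y \<epsilon> s"
    moreover have "u *v v = v" using u by (simp add: F_def)
    ultimately have *: "of_real \<epsilon> *s (u *v a - a) + s *s (u *v b - b) = 0"
      by (simp add: y_def matrix_vector_right_distrib vec.scale vec.scale_right_diff_distrib algebra_simps)
    have **: "of_real \<epsilon> * (u *v a - a) $ k + s * (u *v b - b) $ k = 0" for k
      using arg_cong[OF *, of "\<lambda>v. v $ k"]
      by (simp only: vector_add_component vector_smult_component zero_index)
    have "\<epsilon> = 0"
    proof -
      let ?i = "fst (p u)" and ?j = "snd (p u)"
      have "of_real \<epsilon> * M u ?i ?j a =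
        (of_real \<epsilon> * (u *v a - a) $ ?i + s * (u *v b - b) $ ?i) * (u *v b - b) $ ?j -
        (of_real \<epsilon> * (u *v a - a) $ ?j + s * (u *v b - b) $ ?j) * (u *v b - b) $ ?i"
        by (simp add: M_def algebra_simps)
      also have "\<dots> = 0" by (simp only: **) simp
      finally show ?thesis using a u by auto
    qed
    with ne have "s \<noteq> 0" by simp
    with * \<open>\<epsilon> = 0\<close> have "u *v b - b = 0" by (simp add: vec.scale_eq_0_iff)
    with b[OF u] show False by simp
  qed
  have "open (\<Inter>u\<in>{u\<in>W. u *v v \<noteq> v}. {x. u *v x \<noteq> x})"
    using finite_W by (intro open_INT ballI open_Collect_neq) (auto intro!: continuous_intros)
  moreover have "v \<in> (\<Inter>u\<in>{u\<in>W. u *v v \<noteq> v}. {x. u *v x \<noteq> x})" by auto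
  ultimately obtain \<delta> where \<delta>: "\<delta> > 0" "ball v \<delta> \<subseteq> (\<Inter>u\<in>{u\<in>W. u *v v \<noteq> v}. {x. u *v x \<noteq> x})"
    using open_contains_ball by meson
  have ns: "norm (c *s x) = cmod c * norm x" for c and x :: "complex^'n"
    by (simp add: norm_vec_def L2_set_right_distrib norm_mult)
  define N where "N = norm a + norm b + 1"
  define r where "r = \<delta> / (2 * N)"
  have pos: "0 < N" by (simp add: N_def add_nonneg_pos)
  then have r: "r > 0" using \<delta>(1) by (simp add: r_def)
  have near: "y \<epsilon> s \<in> ball v \<delta>" if "\<bar>\<epsilon>\<bar> \<le> r" "cmod s \<le> r" for \<epsilon> s
  proof -
    have "dist v (y \<epsilon> s) \<le> \<bar>\<epsilon>\<bar> * norm a + cmod s * norm b"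
      using norm_triangle_ineq[of "of_real \<epsilon> *s a" "s *s b"]
      unfolding y_def by (subst dist_commute) (simp add: dist_norm ns)
    also have "\<dots> \<le> r * norm a + r * norm b" using that by (intro add_mono mult_right_mono) auto
    also have "\<dots> \<le> r * N" using r by (simp add: N_def distrib_left)
    also have "\<dots> = \<delta> / 2" using pos unfolding r_def by simp
    also have "\<dots> < \<delta>" using \<delta>(1) by simp
    finally show ?thesis by simp
  qed
  have nz: "\<Delta> (y \<epsilon> s) \<noteq> 0" if "\<bar>\<epsilon>\<bar> \<le> r" "cmod s \<le> r" "\<epsilon> \<noteq> 0 \<or> s \<noteq> 0" for \<epsilon> s
  proof (rule \<Delta>(1), intro ballI impI, rule ccontr)
    fix u assume u: "u \<in> W" "u *v y \<epsilon> s = y \<epsilon> s" "u \<noteq> mat 1"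
    show False
    proof (cases "u *v v = v")
      case True
      then show ?thesis using nofix[of u \<epsilon> s] u that(3) by (simp add: F_def)
    next
      case False
      then show ?thesis using near[OF that(1,2)] \<delta>(2) u by blast
    qed
  qed
  have contK: "continuous_on UNIV (\<lambda>z. \<Delta> (y (fst z) (snd z)))"
    unfolding y_def
    by (rule continuous_on_compose2[OF \<Delta>(3)])
      (auto intro!: continuous_intros simp: vector_scalar_mult_def continuous_on_vec_lambda)
  \<comment> \<open>the bound has to hold uniformly, so the circle with \<open>\<epsilon> = 0\<close> is included here\<close>
  let ?K = "{0..r} \<times> sphere (0::complex) r"
  have "compact ?K" "?K \<noteq> {}" using r by (auto intro!: compact_Times)
  then obtain z0 where z0: "z0 \<in> ?K" "\<And>z. z \<in> ?K \<Longrightarrow>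
      cmod (\<Delta> (y (fst z0) (snd z0))) \<le> cmod (\<Delta> (y (fst z) (snd z)))"
    using continuous_attains_inf[of ?K "\<lambda>z. cmod (\<Delta> (y (fst z) (snd z)))"]
      continuous_on_norm[OF continuous_on_subset[OF contK, of ?K]] by blast
  define c where "c = cmod (\<Delta> (y (fst z0) (snd z0)))"
  have "\<Delta> (y (fst z0) (snd z0)) \<noteq> 0" using z0(1) r by (intro nz) auto
  then have c: "c > 0" by (simp add: c_def)
  have lower: "c \<le> cmod (\<Delta> (y \<epsilon> 0))" if \<epsilon>: "0 < \<epsilon>" "\<epsilon> \<le> r" for \<epsilon>
  proof -
    have hol: "(\<lambda>s. \<Delta> (y \<epsilon> s)) holomorphic_on S" for S
      using \<Delta>(4)[of "v + of_real \<epsilon> *s a" b S] by (simp add: y_def add.assoc)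
    have nz': "\<Delta> (y \<epsilon> s) \<noteq> 0" if "s \<in> cball 0 r" for s
      using that \<epsilon> by (intro nz) auto
    have hol': "(\<lambda>s. 1 / \<Delta> (y \<epsilon> s)) holomorphic_on cball 0 r"
      by (intro holomorphic_on_divide holomorphic_on_const hol nz')
    have "norm (1 / \<Delta> (y \<epsilon> 0)) \<le> 1 / c"
    proof (rule maximum_modulus_frontier[of "\<lambda>s. 1 / \<Delta> (y \<epsilon> s)" "cball 0 r"])
      show "(\<lambda>s. 1 / \<Delta> (y \<epsilon> s)) holomorphic_on interior (cball 0 r)"
        using hol' interior_subset by (rule holomorphic_on_subset)
      show "continuous_on (closure (cball 0 r)) (\<lambda>s. 1 / \<Delta> (y \<epsilon> s))"
        using holomorphic_on_imp_continuous_on[OF hol'] by simp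
      fix s :: complex assume "s \<in> frontier (cball 0 r)"
      then have "(\<epsilon>, s) \<in> ?K" using \<epsilon> by (simp add: frontier_cball)
      from z0(2)[OF this] show "norm (1 / \<Delta> (y \<epsilon> s)) \<le> 1 / c"
        using c by (simp add: norm_divide c_def frac_le)
    qed (use r in auto)
    then have "1 / cmod (\<Delta> (y \<epsilon> 0)) \<le> 1 / c" by (simp add: norm_divide)
    moreover have "cmod (\<Delta> (y \<epsilon> 0)) > 0" using nz'[of 0] r by simp
    ultimately show ?thesis using c by (simp add: field_simps)
  qed
  have "isCont (\<lambda>\<epsilon>. \<Delta> (y \<epsilon> 0)) 0"
    using continuous_on_compose2[OF contK, of UNIV "\<lambda>\<epsilon>::real. (\<epsilon>, 0)"]
    by (auto simp: continuous_on_eq_continuous_at intro!: continuous_intros)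
  then have "((\<lambda>\<epsilon>. \<Delta> (y \<epsilon> 0)) \<longlongrightarrow> \<Delta> (y 0 0)) (at_right 0)"
    unfolding isCont_def by (rule tendsto_mono[rotated]) (simp add: at_le)
  then have lim: "((\<lambda>\<epsilon>. cmod (\<Delta> (y \<epsilon> 0))) \<longlongrightarrow> cmod (\<Delta> (y 0 0))) (at_right 0)"
    by (rule tendsto_norm)
  have "eventually (\<lambda>\<epsilon>. c \<le> cmod (\<Delta> (y \<epsilon> 0))) (at_right 0)"
    using lower r by (auto simp: eventually_at_right_field intro!: exI[of _ r])
  from tendsto_lowerbound[OF lim this] have "c \<le> cmod (\<Delta> (y 0 0))" by simp
  also have "y 0 0 = v" by (simp add: y_def)
  finally show False using c \<Delta>v by simp
qed

end

section \<open>Lifting paths and homotopies from the orbit space\<close>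

context reflection_group
begin

abbreviation "X \<equiv> hyperplane_complement W"
abbreviation "\<pi> \<equiv> orbit_of W"

lemma reflecting_hyperplane_fixed_space:
  assumes "reflection_along s H" shows "H = {x. s *v x = x}"
proof -
  obtain \<alpha> r where \<alpha>: "H = {x. (\<Sum>i\<in>UNIV. \<alpha> i * x $ i) = 0}"
    "\<exists>x. (\<Sum>i\<in>UNIV. \<alpha> i * x $ i) \<noteq> 0"
    "\<forall>x. s *v x = x + (\<Sum>i\<in>UNIV. \<alpha> i * x $ i) *s r"
    by (rule reflection_along_form[OF assms])
  have "r \<noteq> 0"
  proof
    assume "r = 0"
    then have "\<forall>x. s *v x = x" using \<alpha>(3) by simp
    then have "s = mat 1" by (metis matrix_eq matrix_vector_mul_lid)
    then show False using assms by (simp add: reflection_along_def)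
  qed
  then show ?thesis using \<alpha>(1,3) by (auto simp: vec.scale_eq_0_iff)
qed

lemma in_complement_iff: "y \<in> X \<longleftrightarrow> (\<forall>g\<in>W. g *v y = y \<longrightarrow> g = mat 1)"
proof
  assume "y \<in> X" then show "\<forall>g\<in>W. g *v y = y \<longrightarrow> g = mat 1" using steinberg by blast
next
  assume *: "\<forall>g\<in>W. g *v y = y \<longrightarrow> g = mat 1"
  show "y \<in> X"
  proof (rule ccontr)
    assume "y \<notin> X"
    then obtain s H where "s \<in> W" "reflection_along s H" "y \<in> H"
      by (auto simp: hyperplane_complement_def reflecting_hyperplanes_def)
    with * show False by (auto simp: reflection_along_def)
  qed
qed

lemma finite_reflecting_hyperplanes: "finite (reflecting_hyperplanes W)"
proof (rule finite_subset)
  show "reflecting_hyperplanes W \<subseteq> (\<lambda>s. {x. s *v x = x}) ` W"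
    using reflecting_hyperplane_fixed_space by (auto simp: reflecting_hyperplanes_def)
qed (simp add: finite_W)

lemma continuous_on_mv [continuous_intros]:
  "continuous_on S f \<Longrightarrow> continuous_on S (\<lambda>z. (A :: complex^'n^'n) *v f z)"
  unfolding matrix_vector_mult_def by (intro continuous_intros)

lemma open_complement: "open X"
proof -
  have "X = (\<Inter>g\<in>W - {mat 1}. {y. g *v y \<noteq> y})" using in_complement_iff by auto
  moreover have "open (\<Inter>g\<in>W - {mat 1}. {y. g *v y \<noteq> y})"
    using finite_W by (intro open_INT ballI open_Collect_neq) (auto intro!: continuous_intros)
  ultimately show ?thesis by simp
qed

lemma complement_stable:
  assumes g: "g \<in> W" and y: "y \<in> X" shows "g *v y \<in> X"
  unfolding in_complement_iff
proof (intro ballI impI)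
  fix u assume u: "u \<in> W" "u *v (g *v y) = g *v y"
  obtain g' where g': "g' \<in> W" "g' ** g = mat 1" "g ** g' = mat 1" using W_inverse[OF g] by metis
  have "(g' ** (u ** g)) *v y = (g' ** g) *v y"
    using u(2) by (simp add: matrix_vector_mul_assoc[symmetric])
  then have "(g' ** (u ** g)) *v y = y" by (simp add: g'(2))
  moreover have "g' ** (u ** g) \<in> W" using g' u g by (intro W_mult)
  ultimately have "g' ** (u ** g) = mat 1" using y in_complement_iff by blast
  then have "g ** (g' ** (u ** g)) ** g' = g ** g'" by simp
  moreover have "g ** (g' ** (u ** g)) ** g' = (g ** g') ** u ** (g ** g')" by (simp add: matrix_mul_assoc)
  ultimately show "u = mat 1" by (simp add: g'(3))
qed

lemma orbit_of_self: "y \<in> \<pi> y"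
  unfolding orbit_of_def by (rule image_eqI[OF _ W_one]) simp

lemma orbit_of_W:
  assumes "g \<in> W" shows "\<pi> (g *v y) = \<pi> y"
proof -
  have "\<pi> (g *v y) = (\<lambda>u. u *v y) ` (\<lambda>u. u ** g) ` W"
    by (simp add: orbit_of_def image_image matrix_vector_mul_assoc)
  also have "(\<lambda>u. u ** g) ` W = W" using bij_right_mult[OF assms] by (simp add: bij_betw_def)
  finally show ?thesis by (simp only: orbit_of_def)
qed

lemma orbit_of_eq_iff: "\<pi> y = \<pi> z \<longleftrightarrow> (\<exists>g\<in>W. z = g *v y)"
proof
  assume "\<pi> y = \<pi> z"
  then have "z \<in> \<pi> y" using orbit_of_self by simp
  then show "\<exists>g\<in>W. z = g *v y" by (auto simp: orbit_of_def)
qed (auto simp: orbit_of_W)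

lemma topspace_orbit_space: "topspace (orbit_space W) = \<pi> ` X"
  by (simp add: orbit_space_def topspace_quotient_topology)

lemma continuous_orbit_of: "continuous_map (top_of_set X) (orbit_space W) \<pi>"
  by (simp add: orbit_space_def quotient_imp_continuous_map quotient_map_quotient_topology)

lemma open_W_image:
  assumes "open B" "u \<in> W" shows "open ((*v) u ` B)"
proof -
  obtain u' where u': "u' \<in> W" "u' ** u = mat 1" "u ** u' = mat 1" using W_inverse[OF assms(2)] by metis
  have "(*v) u ` B = (*v) u' -` B"
  proof (intro equalityI subsetI)
    fix y assume "y \<in> (*v) u' -` B"
    moreover have "y = u *v (u' *v y)" by (simp add: matrix_vector_mul_assoc u')
    ultimately show "y \<in> (*v) u ` B" by blast
  qed (auto simp: matrix_vector_mul_assoc u')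
  moreover have "open ((*v) u' -` B)"
    using assms(1) by (intro open_vimage) (auto intro!: continuous_intros)
  ultimately show ?thesis by simp
qed

lemma openin_orbit_image:
  assumes "open B" "B \<subseteq> X" shows "openin (orbit_space W) (\<pi> ` B)"
proof -
  have "{y \<in> X. \<pi> y \<in> \<pi> ` B} = (\<Union>u\<in>W. (*v) u ` B)"
  proof (intro equalityI subsetI)
    fix y assume "y \<in> {y \<in> X. \<pi> y \<in> \<pi> ` B}"
    then obtain z where "z \<in> B" "\<pi> z = \<pi> y" by auto
    then show "y \<in> (\<Union>u\<in>W. (*v) u ` B)" using orbit_of_eq_iff by auto
  next
    fix y assume "y \<in> (\<Union>u\<in>W. (*v) u ` B)"
    then show "y \<in> {y \<in> X. \<pi> y \<in> \<pi> ` B}"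
      using assms(2) complement_stable orbit_of_W by auto
  qed
  then have "open {y \<in> X. \<pi> y \<in> \<pi> ` B}" using open_W_image[OF assms(1)] by auto
  then show ?thesis
    using assms(2) unfolding orbit_space_def openin_quotient_topology
    by (auto intro: open_subset)
qed

text \<open>
  The nontrivial elements are finitely many and move \<open>y\<close>, so that each of them moves some ball around
  \<open>y\<close> off itself.
\<close>
lemma evenly_covered_ball:
  assumes "y \<in> X"
  obtains B where "open B" "y \<in> B" "B \<subseteq> X"
    "\<forall>g\<in>W. \<forall>b\<in>B. g *v b \<in> B \<longrightarrow> g = mat 1"
proof -
  have "\<forall>g\<in>W - {mat 1}. \<exists>e>0. \<forall>b\<in>ball y e. g *v b \<notin> ball y e"
  proof
    fix g assume g: "g \<in> W - {mat 1}"
    have "g *v y \<noteq> y" using g assms in_complement_iff by auto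
    then obtain U V where UV: "open U" "open V" "g *v y \<in> U" "y \<in> V" "U \<inter> V = {}"
      using hausdorff[of "g *v y" y] by auto
    have "open (V \<inter> (*v) g -` U)"
      using UV by (intro open_Int open_vimage) (auto intro!: continuous_intros)
    moreover have "y \<in> V \<inter> (*v) g -` U" using UV by simp
    ultimately obtain e where e: "e > 0" "ball y e \<subseteq> V \<inter> (*v) g -` U"
      unfolding open_contains_ball by blast
    then have "\<forall>b\<in>ball y e. g *v b \<notin> ball y e" using UV(5) by fast
    then show "\<exists>e>0. \<forall>b\<in>ball y e. g *v b \<notin> ball y e" using e(1) by blast
  qed
  from bchoice[OF this]
  obtain e where "\<forall>g\<in>W - {mat 1}. e g > (0::real) \<and> (\<forall>b\<in>ball y (e g). g *v b \<notin> ball y (e g))"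
    by (rule exE)
  then have e: "\<And>g. g \<in> W - {mat 1} \<Longrightarrow> e g > (0::real)"
    "\<And>g b. g \<in> W - {mat 1} \<Longrightarrow> b \<in> ball y (e g) \<Longrightarrow> g *v b \<notin> ball y (e g)" by blast+
  let ?B = "X \<inter> (\<Inter>g\<in>W - {mat 1}. ball y (e g))"
  show ?thesis
  proof (rule that[of ?B])
    show "open ?B" using open_complement finite_W by (intro open_Int open_INT) auto
    show "y \<in> ?B" using assms e(1) by auto
    show "\<forall>g\<in>W. \<forall>b\<in>?B. g *v b \<in> ?B \<longrightarrow> g = mat 1"
      using e(2) by fast
  qed auto
qed

text \<open>
  At each point the two lifts differ by exactly one element of \<open>W\<close>. The sets on which it is a given
  element are closed and finite in number, hence also open.
\<close>
lemma lift_unique: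
  assumes S: "connected S" and G: "continuous_on S G" "G ` S \<subseteq> X"
    and G': "continuous_on S G'" "G' ` S \<subseteq> X"
    and eq: "\<And>z. z \<in> S \<Longrightarrow> \<pi> (G z) = \<pi> (G' z)" and z0: "z0 \<in> S" "G z0 = G' z0" and z: "z \<in> S"
  shows "G z = G' z"
proof -
  let ?A = "\<lambda>u. {z \<in> S. u *v G z = G' z}"
  have closed: "closedin (top_of_set S) (?A u)" for u
  proof -
    have "continuous_on S (\<lambda>z. u *v G z - G' z)" using G(1) G'(1) by (intro continuous_intros)
    from continuous_closedin_preimage_constant[OF this, of 0] show ?thesis by simp
  qed
  have "S - ?A (mat 1) = (\<Union>u\<in>W - {mat 1}. ?A u)"
  proof (intro equalityI subsetI)
    fix z assume z: "z \<in> S - ?A (mat 1)"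
    then obtain u where "u \<in> W" "G' z = u *v G z" using eq[of z] orbit_of_eq_iff by blast
    with z show "z \<in> (\<Union>u\<in>W - {mat 1}. ?A u)" by (intro UN_I[of u]) auto
  next
    fix z assume "z \<in> (\<Union>u\<in>W - {mat 1}. ?A u)"
    then obtain u where u: "u \<in> W" "u \<noteq> mat 1" "z \<in> S" "u *v G z = G' z" by blast
    moreover have "G z \<in> X" using G(2) u(3) by blast
    ultimately show "z \<in> S - ?A (mat 1)" using in_complement_iff by auto
  qed
  moreover have "closedin (top_of_set S) (\<Union>u\<in>W - {mat 1}. ?A u)"
    using closed finite_W by (intro closedin_Union) blast+
  ultimately have "openin (top_of_set S) (?A (mat 1))"
    unfolding openin_closedin_eq by (simp only: topspace_euclidean_subtopology) blast
  then have "?A (mat 1) = {} \<or> ?A (mat 1) = S"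
    using S closed[of "mat 1"] unfolding connected_clopen by metis
  moreover have "z0 \<in> ?A (mat 1)" using z0 by simp
  ultimately show ?thesis using z by auto
qed

text \<open>
  The covering of the orbit space is pulled back along \<open>h\<close> to the set \<open>E\<close> of pairs of a point \<open>z\<close> of
  \<open>S\<close> and a point of the orbit \<open>h z\<close>. In contrast to the orbit space, \<open>E\<close> and \<open>S\<close> are subsets of
  normed spaces, so that the lifting theorem for covering spaces applies to the projection of \<open>E\<close> to
  \<open>S\<close>; a section of it is a lift of \<open>h\<close>.
\<close>
lemma lift_exists:
  fixes S :: "'b::real_normed_vector set"
  assumes S: "convex S" and h: "continuous_map (top_of_set S) (orbit_space W) h"
  obtains G where "continuous_on S G" "G ` S \<subseteq> X" "\<forall>z\<in>S. \<pi> (G z) = h z"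
proof -
  define E where "E = {(z, y). z \<in> S \<and> y \<in> X \<and> \<pi> y = h z}"
  have cov: "covering_space E fst S"
  proof
    show "continuous_on E fst" by (intro continuous_intros)
    have ex: "\<exists>y\<in>X. \<pi> y = h z" if "z \<in> S" for z
    proof -
      have "h z \<in> \<pi> ` X"
        using continuous_map_image_subset_topspace[OF h] that unfolding topspace_orbit_space by auto
      then show ?thesis by (elim imageE) auto
    qed
    show "fst ` E = S"
    proof (intro equalityI subsetI)
      fix z assume z: "z \<in> S"
      obtain y where "y \<in> X" "\<pi> y = h z" using ex[OF z] by (rule bexE)
      with z have "(z, y) \<in> E" by (simp add: E_def)
      then show "z \<in> fst ` E" by (rule rev_image_eqI) simp
    qed (auto simp: E_def)
    fix z0 assume "z0 \<in> S"
    obtain y0 where y0: "y0 \<in> X" "\<pi> y0 = h z0" using ex[OF \<open>z0 \<in> S\<close>] by (rule bexE)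
    obtain B where B: "open B" "y0 \<in> B" "B \<subseteq> X"
      and B4: "\<forall>g\<in>W. \<forall>b\<in>B. g *v b \<in> B \<longrightarrow> g = mat 1"
      by (rule evenly_covered_ball[OF y0(1)])
    note B = B B4[rule_format]
    define T where "T = {z \<in> S. h z \<in> \<pi> ` B}"
    have pre: "openin (top_of_set S) {z \<in> S. h z \<in> \<pi> ` U}" if "open U" "U \<subseteq> X" for U
      using openin_continuous_map_preimage[OF h openin_orbit_image[OF that]] by simp
    define V where "V = (\<lambda>u. {(z, y) \<in> E. y \<in> (*v) u ` B})"
    have sub: "(*v) u ` B \<subseteq> X" if "u \<in> W" for u using B(3) complement_stable[OF that] by auto
    have inT: "z \<in> T" if z: "z \<in> S" "y \<in> (*v) u ` B" "u \<in> W" "\<pi> y = h z" for z y u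
    proof -
      obtain b where "b \<in> B" "y = u *v b" using z(2) by blast
      then have "h z = \<pi> b" using z(4) orbit_of_W[OF z(3)] by simp
      then show ?thesis using z(1) \<open>b \<in> B\<close> by (simp add: T_def)
    qed
    have uniq: "u = u' \<and> y = y'" if *: "u \<in> W" "u' \<in> W" "y \<in> (*v) u ` B" "y' \<in> (*v) u' ` B" "\<pi> y = \<pi> y'"
      "u = u' \<or> y = y'" for u u' y y'
    proof -
      obtain b b' where b: "b \<in> B" "y = u *v b" "b' \<in> B" "y' = u' *v b'" using * by blast
      then have "\<pi> b = \<pi> b'" using * orbit_of_W by metis
      then obtain g where g: "g \<in> W" "b' = g *v b" using orbit_of_eq_iff by blast
      then have "b' = b" using B(4)[of g b] b by simp
      then show ?thesis
      proof (cases "u = u'")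
        case False
        then have "y = y'" using *(6) by blast
        then have "u *v b = u' *v b" using b(2,4) \<open>b' = b\<close> by simp
        obtain v where v: "v \<in> W" "v ** u = mat 1" "u ** v = mat 1" using W_inverse[OF *(1)] by metis
        have "(v ** u') *v b = v *v (u *v b)"
          by (simp add: \<open>u *v b = u' *v b\<close> matrix_vector_mul_assoc)
        then have "(v ** u') *v b = b" by (simp add: matrix_vector_mul_assoc v(2))
        then have "v ** u' = mat 1" using B(4)[of "v ** u'" b] b(1) v(1) *(2) W_mult by simp
        then have "u ** (v ** u') = u" by simp
        then show ?thesis using False by (simp add: matrix_mul_assoc v(3))
      qed (use b \<open>b' = b\<close> in simp)
    qed
    show "\<exists>T. z0 \<in> T \<and> openin (top_of_set S) T \<and>
        (\<exists>v. \<Union>v = E \<inter> fst -` T \<and> (\<forall>u\<in>v. openin (top_of_set E) u) \<and> pairwise disjnt v \<and>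
          (\<forall>u\<in>v. \<exists>q. homeomorphism u T fst q))"
    proof (intro exI conjI)
      show "z0 \<in> T" unfolding T_def using \<open>z0 \<in> S\<close> y0(2) imageI[OF B(2), of \<pi>] by simp
      show "openin (top_of_set S) T" unfolding T_def by (rule pre[OF B(1,3)])
      show "\<Union>(V ` W) = E \<inter> fst -` T"
      proof (intro equalityI subsetI)
        fix p assume "p \<in> \<Union>(V ` W)"
        then obtain u where u: "u \<in> W" "p \<in> V u" by blast
        obtain z y where p: "p = (z, y)" by fastforce
        then show "p \<in> E \<inter> fst -` T" using u inT[of z y u] by (auto simp: V_def E_def)
      next
        fix p assume "p \<in> E \<inter> fst -` T"
        then obtain z y b where p: "p = (z, y)" "p \<in> E" "\<pi> y = \<pi> b" "b \<in> B"
          by (auto simp: T_def E_def)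
        then obtain u where "u \<in> W" "y = u *v b" using orbit_of_eq_iff[of b y] by auto
        with p show "p \<in> \<Union>(V ` W)" by (auto simp: V_def)
      qed
      show "\<forall>U\<in>V ` W. openin (top_of_set E) U"
      proof
        fix U assume "U \<in> V ` W"
        then obtain u where u: "u \<in> W" "U = V u" by blast
        have "V u = E \<inter> (UNIV \<times> (*v) u ` B)" by (auto simp: V_def)
        moreover have "open (UNIV \<times> (*v) u ` B :: ('b \<times> (complex^'n)) set)"
          using open_W_image[OF B(1) u(1)] by (intro open_Times) auto
        ultimately show "openin (top_of_set E) U" unfolding u(2) by (simp add: openin_open_Int)
      qed
      show "pairwise disjnt (V ` W)"
      proof (rule pairwiseI)
        fix U U' assume "U \<in> V ` W" "U' \<in> V ` W" "U \<noteq> U'"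
        then obtain u u' where "u \<in> W" "u' \<in> W" "U = V u" "U' = V u'" "u \<noteq> u'" by blast
        then show "disjnt U U'" using uniq[of u u'] by (auto simp: disjnt_def V_def)
      qed
      show "\<forall>U\<in>V ` W. \<exists>q. homeomorphism U T fst q"
      proof
        fix U assume "U \<in> V ` W"
        then obtain u where u: "u \<in> W" "U = V u" by blast
        have "\<forall>z\<in>T. \<exists>y. y \<in> (*v) u ` B \<and> \<pi> y = h z"
        proof
          fix z assume "z \<in> T"
          then obtain b where "b \<in> B" "h z = \<pi> b" by (auto simp: T_def)
          then show "\<exists>y. y \<in> (*v) u ` B \<and> \<pi> y = h z"
            by (intro exI[of _ "u *v b"]) (simp add: orbit_of_W[OF u(1)])
        qed
        from bchoice[OF this] obtain \<sigma> where \<sigma>: "\<forall>z\<in>T. \<sigma> z \<in> (*v) u ` B \<and> \<pi> (\<sigma> z) = h z" by blast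
        have "continuous_on T \<sigma>"
          unfolding continuous_on_open_invariant
        proof (intro allI impI)
          fix O' :: "(complex^'n) set" assume O': "open O'"
          let ?P = "{z \<in> S. h z \<in> \<pi> ` ((*v) u ` B \<inter> O')}"
          have P: "openin (top_of_set S) ?P"
            using O' open_W_image[OF B(1) u(1)] sub[OF u(1)] by (intro pre) auto
          have "\<sigma> -` O' \<inter> T = ?P \<inter> T"
          proof (intro equalityI subsetI)
            fix z assume "z \<in> \<sigma> -` O' \<inter> T"
            then have "\<sigma> z \<in> (*v) u ` B \<inter> O'" "h z = \<pi> (\<sigma> z)" "z \<in> T" using \<sigma> by auto
            then show "z \<in> ?P \<inter> T" by (simp add: T_def)
          next
            fix z assume z: "z \<in> ?P \<inter> T"
            then obtain y where "y \<in> (*v) u ` B" "y \<in> O'" "h z = \<pi> y" by auto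
            then have "\<sigma> z = y" using uniq[of u u "\<sigma> z" y] u(1) \<sigma> z by auto
            then show "z \<in> \<sigma> -` O' \<inter> T" using z \<open>y \<in> O'\<close> by simp
          qed
          moreover obtain A where "open A" "?P = S \<inter> A" using P by (meson openin_open)
          ultimately show "\<exists>A. open A \<and> A \<inter> T = \<sigma> -` O' \<inter> T"
            by (intro exI[of _ A]) (auto simp: T_def)
        qed
        then have "homeomorphism (V u) T fst (\<lambda>z. (z, \<sigma> z))"
        proof (intro homeomorphismI)
          show "fst ` V u \<subseteq> T"
            using inT[OF _ _ u(1)] unfolding V_def E_def by fastforce
          show "(\<lambda>z. (z, \<sigma> z)) ` T \<subseteq> V u"
            using \<sigma> sub[OF u(1)] by (auto simp: V_def E_def T_def)
          show "(fst p, \<sigma> (fst p)) = p" if p: "p \<in> V u" for p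
          proof -
            obtain z y where zy: "p = (z, y)" "z \<in> S" "y \<in> (*v) u ` B" "\<pi> y = h z"
              using p by (auto simp: V_def E_def)
            then have "z \<in> T" using inT[OF _ _ u(1)] by blast
            then have "\<sigma> z = y" using uniq[of u u "\<sigma> z" y] u(1) \<sigma> zy by auto
            then show ?thesis using zy by simp
          qed
        qed (auto intro!: continuous_intros)
        then show "\<exists>q. homeomorphism U T fst q" using u(2) by blast
      qed
    qed
  qed
  obtain g where g: "continuous_on S g" "g \<in> S \<rightarrow> E" "\<And>z. z \<in> S \<Longrightarrow> fst (g z) = id z"
    by (rule covering_space_lift[OF cov, of S id])
      (use S in \<open>auto intro: convex_imp_simply_connected convex_imp_locally_path_connected continuous_on_id\<close>)
  have gE: "fst (g z) = z \<and> snd (g z) \<in> X \<and> \<pi> (snd (g z)) = h z" if "z \<in> S" for z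
  proof -
    have "g z \<in> E" "fst (g z) = z" using g(2,3) that by auto
    then show ?thesis by (auto simp: E_def case_prod_beta)
  qed
  show ?thesis
    by (rule that[of "\<lambda>z. snd (g z)"]) (use g(1) gE in \<open>auto intro!: continuous_intros\<close>)
qed

lemma lift_exists_at:
  fixes S :: "'b::real_normed_vector set"
  assumes S: "convex S" and h: "continuous_map (top_of_set S) (orbit_space W) h"
    and z0: "z0 \<in> S" "y0 \<in> X" "\<pi> y0 = h z0"
  obtains G where "continuous_on S G" "G ` S \<subseteq> X" "\<forall>z\<in>S. \<pi> (G z) = h z" "G z0 = y0"
proof -
  obtain G where G: "continuous_on S G" "G ` S \<subseteq> X" "\<forall>z\<in>S. \<pi> (G z) = h z"
    by (rule lift_exists[OF S h])
  obtain g where g: "g \<in> W" "y0 = g *v G z0"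
    using bspec[OF G(3) z0(1)] z0(3) orbit_of_eq_iff[of "G z0" y0] by auto
  show ?thesis
  proof (rule that[of "\<lambda>z. g *v G z"])
    show "continuous_on S (\<lambda>z. g *v G z)" using G(1) by (intro continuous_intros)
  qed (use G g complement_stable orbit_of_W in auto)
qed

lemma loop_lift:
  assumes f: "f \<in> loops (orbit_space W) (\<pi> x)" and x: "x \<in> X"
  obtains p g where "path p" "path_image p \<subseteq> X" "pathstart p = x" "g \<in> W" "pathfinish p = g *v x"
    "\<forall>t\<in>{0..1}. \<pi> (p t) = f t"
proof -
  have f': "continuous_map (top_of_set {0..1}) (orbit_space W) f" "f 0 = \<pi> x" "f 1 = \<pi> x"
    using f by (auto simp: loops_def pathin_def)
  obtain p where p: "continuous_on {0..1} p" "p ` {0..1} \<subseteq> X" "\<forall>t\<in>{0..1}. \<pi> (p t) = f t" "p 0 = x"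
    by (rule lift_exists_at[OF _ f'(1), of 0 x]) (use f'(2) x in auto)
  have "\<pi> x = \<pi> (p 1)" using p(3) f'(3) by simp
  then obtain g where "g \<in> W" "p 1 = g *v x" using orbit_of_eq_iff by blast
  with p show ?thesis
    by (intro that[of p g]) (auto simp: path_def path_image_def pathstart_def pathfinish_def)
qed

text \<open>
  Lift the homotopy, beginning at \<open>x\<close>. On the two edges of the square that correspond to the ends of
  the loops the lift is constant, and on the other two it is \<open>p\<close> and \<open>q\<close>, by uniqueness.
\<close>
lemma homotopic_projections_same_end:
  assumes hom: "loop_homotopic (orbit_space W) (\<pi> x) (\<pi> \<circ> p) (\<pi> \<circ> q)"
    and p: "path p" "path_image p \<subseteq> X" "pathstart p = x"
    and q: "path q" "path_image q \<subseteq> X" "pathstart q = x"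
  shows "pathfinish p = pathfinish q"
proof -
  let ?I = "{0..1::real}"
  have II: "prod_topology (top_of_set ?I) (top_of_set ?I) = top_of_set (?I \<times> ?I)"
    by (simp add: euclidean_product_topology flip: subtopology_Times)
  obtain h where h: "continuous_map (top_of_set (?I \<times> ?I)) (orbit_space W) h"
    "\<And>t. h (0, t) = \<pi> (p t)" "\<And>t. h (1, t) = \<pi> (q t)"
    "\<And>s. s \<in> ?I \<Longrightarrow> h (s, 0) = \<pi> x \<and> h (s, 1) = \<pi> x"
    using hom unfolding loop_homotopic_def homotopic_with_def II by auto
  have x: "x \<in> X" using p pathstart_in_path_image by blast
  have "convex (?I \<times> ?I)" by (intro convex_Times) auto
  then obtain G where G: "continuous_on (?I \<times> ?I) G" "G ` (?I \<times> ?I) \<subseteq> X"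
    "\<forall>z\<in>?I \<times> ?I. \<pi> (G z) = h z" "G (0, 0) = x"
    by (rule lift_exists_at[OF _ h(1), of "(0, 0)" x]) (use h(4)[of 0] x in auto)
  have side: "continuous_on ?I (\<lambda>t. G (a, t))" "continuous_on ?I (\<lambda>t. G (t, a))"
    "(\<lambda>t. G (a, t)) ` ?I \<subseteq> X" "(\<lambda>t. G (t, a)) ` ?I \<subseteq> X" if "a \<in> ?I" for a
    using G(2) that by (auto intro!: continuous_on_compose2[OF G(1)] continuous_intros)
  have I: "connected ?I" by simp
  have bottom: "G (s, 0) = x" if "s \<in> ?I" for s
    by (rule lift_unique[OF I, of "\<lambda>s. G (s, 0)" "\<lambda>s. x" 0])
      (use side[of 0] G(3,4) h(4) x that in auto)
  have "G (0, 1) = p 1"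
    by (rule lift_unique[OF I, of "\<lambda>t. G (0, t)" p 0])
      (use side[of 0] G(3,4) h(2) p in \<open>auto simp: path_def path_image_def pathstart_def\<close>)
  moreover have "G (1, 1) = q 1"
    by (rule lift_unique[OF I, of "\<lambda>t. G (1, t)" q 0])
      (use side[of 1] G(3) h(3) q bottom[of 1] in \<open>auto simp: path_def path_image_def pathstart_def\<close>)
  moreover have "G (1, 1) = G (0, 1)"
    by (rule lift_unique[OF I, of "\<lambda>s. G (s, 1)" "\<lambda>s. G (0, 1)" 0])
      (use side[of 1] side[of 0] G(3) h(4) in auto)
  ultimately show ?thesis by (simp add: pathfinish_def)
qed

end

section \<open>Braids as lifted paths\<close>

lemma homotopic_paths_append_back:
  fixes p q :: "real \<Rightarrow> 'a::real_normed_vector"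
  assumes "path p" "path q" "path_image p \<subseteq> S" "path_image q \<subseteq> S" "pathfinish q = pathfinish p"
  shows "homotopic_paths S ((p +++ reversepath q) +++ q) p"
proof -
  have "homotopic_paths S (p +++ (reversepath q +++ q)) ((p +++ reversepath q) +++ q)"
    using assms by (intro homotopic_paths_assoc) auto
  moreover have "homotopic_paths S (p +++ (reversepath q +++ q)) (p +++ linepath (pathfinish p) (pathfinish p))"
    using assms homotopic_paths_linv[of q S] by (intro homotopic_paths_join) auto
  moreover have "homotopic_paths S (p +++ linepath (pathfinish p) (pathfinish p)) p"
    using assms by (intro homotopic_paths_rid)
  ultimately show ?thesis using homotopic_paths_trans homotopic_paths_sym by meson
qed

context reflection_group
begin

abbreviation act :: "complex^'n^'n \<Rightarrow> (real \<Rightarrow> complex^'n) \<Rightarrow> real \<Rightarrow> complex^'n"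
  where "act g p \<equiv> (\<lambda>t. g *v p t)"

lemma act_join: "act g (p +++ q) = act g p +++ act g q"
  by (auto simp: joinpaths_def)

lemma act_reversepath: "act g (reversepath p) = reversepath (act g p)"
  by (auto simp: reversepath_def)

lemma path_act [simp]: "path p \<Longrightarrow> path (act g p)"
  unfolding path_def by (rule continuous_on_mv)

lemma path_image_act:
  assumes "g \<in> W" "path_image p \<subseteq> X" shows "path_image (act g p) \<subseteq> X"
  using assms complement_stable[OF assms(1)] by (auto simp: path_image_def)

lemma pathstart_act [simp]: "pathstart (act g p) = g *v pathstart p"
  and pathfinish_act [simp]: "pathfinish (act g p) = g *v pathfinish p"
  by (simp_all add: pathstart_def pathfinish_def)

lemma homotopic_loops_act:
  assumes "homotopic_loops X p q" "g \<in> W"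
  shows "homotopic_loops X (act g p) (act g q)"
  using homotopic_loops_continuous_image[OF assms(1), of "(*v) g" X] complement_stable[OF assms(2)]
  by (auto simp: o_def intro!: continuous_intros)

lemma projected_homotopy:
  assumes "homotopic_paths X p q" "pathstart p = y" "\<pi> (pathfinish p) = \<pi> y"
  shows "loop_homotopic (orbit_space W) (\<pi> y) (\<pi> \<circ> p) (\<pi> \<circ> q)"
  unfolding loop_homotopic_def
proof (rule homotopic_with_compose_continuous_map_left[OF _ continuous_orbit_of])
  show "homotopic_with (\<lambda>r. pathstart r = pathstart p \<and> pathfinish r = pathfinish p) (top_of_set {0..1}) (top_of_set X) p q"
    using assms(1) by (simp add: homotopic_paths_def)
qed (use assms in \<open>auto simp: pathstart_def pathfinish_def\<close>)

end

locale based_reflection_group = reflection_group W for W :: "(complex^'n^'n) set" +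
  fixes x :: "complex^'n"
  assumes x: "x \<in> hyperplane_complement W"
begin

abbreviation "B \<equiv> braid_group W x"
abbreviation "Q \<equiv> quasi_abelianized_braid_group W x"

text \<open>
  A path in the complement from \<open>x\<close> to \<open>g x\<close> projects to a loop in the orbit space. All braids arise
  in this way, and \<open>g\<close> is then the image of the braid in \<open>W\<close>; so braids can be handled by paths in a
  vector space.
\<close>
definition lifts :: "complex^'n^'n \<Rightarrow> (real \<Rightarrow> complex^'n) \<Rightarrow> bool"
  where "lifts g p \<longleftrightarrow> g \<in> W \<and> path p \<and> path_image p \<subseteq> X \<and> pathstart p = x \<and> pathfinish p = g *v x"

definition braid :: "(real \<Rightarrow> complex^'n) \<Rightarrow> (real \<Rightarrow> (complex^'n) set) set"
  where "braid p = loop_class (orbit_space W) (\<pi> x) (\<pi> \<circ> p)"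

definition commutators :: "(real \<Rightarrow> (complex^'n) set) set set"
  where "commutators = pure_braid_incl W x ` derived (pure_braid_group W x) (carrier (pure_braid_group W x))"

definition qbraid :: "(real \<Rightarrow> complex^'n) \<Rightarrow> (real \<Rightarrow> (complex^'n) set) set set"
  where "qbraid p = commutators #>\<^bsub>B\<^esub> braid p"

lemma group_B: "group B" using group_braid_group[OF x] .

lemma carrier_B: "carrier B = loop_class (orbit_space W) (\<pi> x) ` loops (orbit_space W) (\<pi> x)"
  by (simp add: braid_group_def pi1_def)

lemma lifts_projected_loop:
  assumes "lifts g p" shows "\<pi> \<circ> p \<in> loops (orbit_space W) (\<pi> x)"
proof -
  have "homotopic_paths X p p" using assms by (simp add: lifts_def)
  from loop_homotopic_loops(1)[OF projected_homotopy[OF this]] assms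
  show ?thesis by (auto simp: lifts_def orbit_of_W)
qed

lemma braid_in_carrier: "lifts g p \<Longrightarrow> braid p \<in> carrier B"
  unfolding braid_def carrier_B by (rule imageI[OF lifts_projected_loop])

lemma braid_cong:
  assumes "homotopic_paths X p q" "lifts g p" shows "braid p = braid q"
  unfolding braid_def
  by (rule loop_class_eq[OF projected_homotopy[OF assms(1)]])
    (use assms(2) in \<open>auto simp: lifts_def orbit_of_W\<close>)

lemma lifts_join:
  assumes "lifts u p" "lifts v q" shows "lifts (u ** v) (p +++ act u q)"
  using assms path_image_act[of u q] W_mult[of u v]
  by (auto simp: lifts_def path_image_join matrix_vector_mul_assoc)

text \<open>
  The second path has to be moved by \<open>u\<close> so that it starts where the first one ends; this does not
  change its projection.
\<close>
lemma braid_mult: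
  assumes "lifts u p" "lifts v q"
  shows "braid p \<otimes>\<^bsub>B\<^esub> braid q = braid (p +++ act u q)"
proof -
  have "loop_join (\<pi> \<circ> p) (\<pi> \<circ> q) = \<pi> \<circ> (p +++ act u q)"
  proof
    fix t
    have "\<pi> (u *v q s) = \<pi> (q s)" for s using assms(1) by (simp add: lifts_def orbit_of_W)
    then show "loop_join (\<pi> \<circ> p) (\<pi> \<circ> q) t = (\<pi> \<circ> (p +++ act u q)) t"
      by (simp add: loop_join_def joinpaths_def)
  qed
  then show ?thesis
    unfolding braid_def braid_group_def
      pi1_mult[OF lifts_projected_loop[OF assms(1)] lifts_projected_loop[OF assms(2)]] by simp
qed

lemma braid_surj:
  assumes "b \<in> carrier B" obtains g p where "lifts g p" "b = braid p"
proof -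
  obtain f where f: "f \<in> loops (orbit_space W) (\<pi> x)" "b = loop_class (orbit_space W) (\<pi> x) f"
    using assms unfolding carrier_B by blast
  obtain p g where p: "path p" "path_image p \<subseteq> X" "pathstart p = x" "g \<in> W" "pathfinish p = g *v x"
    and eq: "\<forall>t\<in>{0..1}. \<pi> (p t) = f t"
    by (rule loop_lift[OF f(1) x])
  have l: "lifts g p" using p by (simp add: lifts_def)
  have "loop_homotopic (orbit_space W) (\<pi> x) f (\<pi> \<circ> p)"
    unfolding loop_homotopic_def
    using f(1) lifts_projected_loop[OF l] eq
    by (intro homotopic_with_equal) (auto simp: loops_def pathin_def)
  then have "b = braid p" unfolding f(2) braid_def by (rule loop_class_eq)
  with l show ?thesis by (rule that)
qed

text \<open>
  This says that the map from the braid group to \<open>W\<close> is well defined. It needs \<open>W\<close> to act freely on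
  the complement.
\<close>
lemma braid_eq_same_lift:
  assumes "braid p = braid q" "lifts g p" "lifts h q" shows "g = h"
proof -
  have "\<pi> \<circ> q \<in> loop_class (orbit_space W) (\<pi> x) (\<pi> \<circ> p)"
    using assms(1) loop_class_self[OF lifts_projected_loop[OF assms(3)]] by (simp add: braid_def)
  from homotopic_projections_same_end[OF loop_class_memD[OF this]]
  have "g *v x = h *v x" using assms(2,3) by (simp add: lifts_def)
  obtain h' where h': "h' \<in> W" "h' ** h = mat 1" "h ** h' = mat 1"
    using W_inverse[of h] assms(3) by (metis lifts_def)
  have "(h' ** g) *v x = h' *v (h *v x)"
    by (simp add: \<open>g *v x = h *v x\<close>[symmetric] matrix_vector_mul_assoc)
  also have "\<dots> = x" by (simp add: matrix_vector_mul_assoc h'(2))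
  finally have "h' ** g = mat 1"
    using in_complement_iff[of x] x h'(1) assms(2) W_mult[of h' g] by (auto simp: lifts_def)
  then have "h ** (h' ** g) = h" by simp
  then show ?thesis by (simp add: matrix_mul_assoc h'(3))
qed

abbreviation "pure_loop p \<equiv> lifts (mat 1) p"

definition pure_braids :: "(real \<Rightarrow> (complex^'n) set) set set"
  where "pure_braids = {braid p | p. pure_loop p}"

lemma pure_loop_iff: "pure_loop p \<longleftrightarrow> p \<in> loops (top_of_set X) x"
  using W_one by (auto simp: lifts_def loops_def pathin_def path_def path_image_def pathstart_def pathfinish_def)

lemma pure_braid_incl_image: "pure_braid_incl W x ` carrier (pure_braid_group W x) = pure_braids"
proof -
  have "pure_braid_incl W x (loop_class (top_of_set X) x f) = braid f" if "f \<in> loops (top_of_set X) x" for f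
    unfolding pure_braid_incl_def braid_def by (rule pi1_map_class(2)[OF continuous_orbit_of that])
  then show ?thesis
    unfolding pure_braids_def pure_loop_iff by (force simp: pure_braid_group_def pi1_def)
qed

lemma group_hom_incl: "group_hom (pure_braid_group W x) B (pure_braid_incl W x)"
  using group_pure_braid_group[OF x] group_B pure_braid_incl_hom
  by (simp add: group_hom_def group_hom_axioms_def)

text \<open>
  A homomorphism maps the commutator subgroup of a group onto that of its image. In this form the
  normality of the pure braid group passes to \<open>commutators\<close>.
\<close>
lemma commutators_derived: "commutators = derived B pure_braids"
  unfolding commutators_def pure_braid_incl_image[symmetric]
  using group_hom.derived_img[OF group_hom_incl, of "carrier (pure_braid_group W x)"] by simp

lemma conjugate_pure_braid:
  assumes q: "lifts g q" and p: "pure_loop p"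
  shows "pure_loop ((q +++ act g p) +++ reversepath q)"
    and "braid q \<otimes>\<^bsub>B\<^esub> braid p = braid ((q +++ act g p) +++ reversepath q) \<otimes>\<^bsub>B\<^esub> braid q"
proof -
  let ?r = "(q +++ act g p) +++ reversepath q"
  show r: "pure_loop ?r"
    using p q path_image_act[of g p] W_one by (auto simp: lifts_def path_image_join)
  have qp: "lifts g (q +++ act g p)" using lifts_join[OF q p] by simp
  have "homotopic_paths X (?r +++ q) (q +++ act g p)"
    using qp q by (intro homotopic_paths_append_back) (auto simp: lifts_def)
  from braid_cong[OF homotopic_paths_sym[OF this] qp]
  show "braid q \<otimes>\<^bsub>B\<^esub> braid p = braid ?r \<otimes>\<^bsub>B\<^esub> braid q"
    unfolding braid_mult[OF q p] braid_mult[OF r q] by simp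
qed

lemma pure_braids_normal: "pure_braids \<lhd> B"
  unfolding group.normal_inv_iff[OF group_B]
proof (intro conjI ballI)
  interpret h: group_hom "pure_braid_group W x" B "pure_braid_incl W x" by (rule group_hom_incl)
  show "subgroup pure_braids B"
    unfolding pure_braid_incl_image[symmetric]
    by (rule h.subgroup_img_is_subgroup[OF group.subgroup_self[OF h.G.is_group]])
  fix b c assume "b \<in> carrier B" "c \<in> pure_braids"
  then obtain g q p where qp: "lifts g q" "b = braid q" "pure_loop p" "c = braid p"
    unfolding pure_braids_def by (auto elim: braid_surj)
  note conj = conjugate_pure_braid[OF qp(1,3)]
  have "b \<otimes>\<^bsub>B\<^esub> c \<otimes>\<^bsub>B\<^esub> inv\<^bsub>B\<^esub> b = braid ((q +++ act g p) +++ reversepath q)"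
    unfolding qp(2,4) conj(2)
    using braid_in_carrier[OF qp(1)] braid_in_carrier[OF conj(1)] by (simp add: h.H.m_assoc)
  then show "b \<otimes>\<^bsub>B\<^esub> c \<otimes>\<^bsub>B\<^esub> inv\<^bsub>B\<^esub> b \<in> pure_braids"
    using conj(1) by (auto simp: pure_braids_def)
qed

lemma commutators_normal: "commutators \<lhd> B"
  unfolding commutators_derived by (rule group.derived_is_normal[OF group_B pure_braids_normal])

lemma Q_eq: "Q = B Mod commutators"
  by (simp add: quasi_abelianized_braid_group_def commutators_def)

lemma group_Q: "group Q"
  unfolding Q_eq by (rule normal.factorgroup_is_group[OF commutators_normal])

lemma qbraid_in_carrier: "lifts g p \<Longrightarrow> qbraid p \<in> carrier Q"
  unfolding Q_eq qbraid_def FactGroup_def RCOSETS_def using braid_in_carrier by auto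

lemma qbraid_cong:
  assumes "homotopic_paths X p q" "lifts g p" shows "qbraid p = qbraid q"
  unfolding qbraid_def braid_cong[OF assms] ..

lemma qbraid_mult:
  assumes "lifts u p" "lifts v q"
  shows "qbraid p \<otimes>\<^bsub>Q\<^esub> qbraid q = qbraid (p +++ act u q)"
  unfolding Q_eq qbraid_def braid_mult[OF assms, symmetric]
  using normal.rcos_sum[OF commutators_normal braid_in_carrier[OF assms(1)] braid_in_carrier[OF assms(2)]]
  by (simp add: FactGroup_def)

lemma qbraid_pure_commute:
  assumes p: "pure_loop p" and q: "pure_loop q"
  shows "qbraid p \<otimes>\<^bsub>Q\<^esub> qbraid q = qbraid q \<otimes>\<^bsub>Q\<^esub> qbraid p"
proof -
  interpret B: group B by (rule group_B)
  interpret N: normal commutators B by (rule commutators_normal)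
  let ?a = "braid p" and ?b = "braid q"
  have car: "?a \<in> carrier B" "?b \<in> carrier B" using braid_in_carrier p q by auto
  have "?a \<otimes>\<^bsub>B\<^esub> ?b \<otimes>\<^bsub>B\<^esub> inv\<^bsub>B\<^esub> ?a \<otimes>\<^bsub>B\<^esub> inv\<^bsub>B\<^esub> ?b \<in> derived_set B pure_braids"
    using p q unfolding pure_braids_def by blast
  then have comm: "?a \<otimes>\<^bsub>B\<^esub> ?b \<otimes>\<^bsub>B\<^esub> inv\<^bsub>B\<^esub> ?a \<otimes>\<^bsub>B\<^esub> inv\<^bsub>B\<^esub> ?b \<in> commutators"
    unfolding commutators_derived derived_def by (rule generate.incl)
  have "?a \<otimes>\<^bsub>B\<^esub> ?b = (?a \<otimes>\<^bsub>B\<^esub> ?b \<otimes>\<^bsub>B\<^esub> inv\<^bsub>B\<^esub> ?a \<otimes>\<^bsub>B\<^esub> inv\<^bsub>B\<^esub> ?b) \<otimes>\<^bsub>B\<^esub> (?b \<otimes>\<^bsub>B\<^esub> ?a)"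
    using car by (simp add: B.m_assoc) (simp add: B.m_assoc[symmetric])
  then have "?a \<otimes>\<^bsub>B\<^esub> ?b \<in> commutators #>\<^bsub>B\<^esub> (?b \<otimes>\<^bsub>B\<^esub> ?a)"
    using comm unfolding r_coset_def by blast
  from B.repr_independence[OF this _ N.is_subgroup]
  have "commutators #>\<^bsub>B\<^esub> (?a \<otimes>\<^bsub>B\<^esub> ?b) = commutators #>\<^bsub>B\<^esub> (?b \<otimes>\<^bsub>B\<^esub> ?a)"
    using car by simp
  then show ?thesis
    unfolding qbraid_mult[OF p q] qbraid_mult[OF q p] unfolding qbraid_def
    by (simp only: braid_mult[OF p q] braid_mult[OF q p])
qed

text \<open>
  The homomorphism to \<open>W\<close> factors through the quotient, because commutators are pure braids.
\<close>
lemma qbraid_eq_pureD: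
  assumes "qbraid p = qbraid q" "lifts g p" "pure_loop q" shows "g = mat 1"
proof -
  interpret B: group B by (rule group_B)
  interpret N: normal commutators B by (rule commutators_normal)
  have sub: "subgroup pure_braids B" by (rule normal_imp_subgroup[OF pure_braids_normal])
  have "braid p \<in> commutators #>\<^bsub>B\<^esub> braid q"
    using B.rcos_self[OF braid_in_carrier[OF assms(2)] N.is_subgroup] assms(1) by (simp add: qbraid_def)
  then obtain c where c: "c \<in> commutators" "braid p = c \<otimes>\<^bsub>B\<^esub> braid q"
    unfolding r_coset_def by blast
  have "commutators \<subseteq> pure_braids"
    unfolding commutators_derived by (rule B.derived_incl[OF subset_refl sub])
  moreover have "braid q \<in> pure_braids" using assms(3) by (auto simp: pure_braids_def)
  ultimately have "braid p \<in> pure_braids"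
    unfolding c(2) using subgroup.m_closed[OF sub] c(1) by blast
  then obtain r where "braid p = braid r" "pure_loop r" by (auto simp: pure_braids_def)
  then show ?thesis using braid_eq_same_lift assms(2) by blast
qed

end

section \<open>Classes of closed paths\<close>

text \<open>
  Let \<open>u\<close> be the track of the base point during the homotopy. In the unit square one edge is homotopic,
  with fixed ends, to the path along the other three; the image of this is the claim.
\<close>
lemma homotopic_loops_imp_conjugate:
  fixes p q :: "real \<Rightarrow> 'a::real_normed_vector"
  assumes "homotopic_loops S p q"
  obtains u where "path u" "path_image u \<subseteq> S" "pathstart u = pathstart p" "pathfinish u = pathstart q"
    "homotopic_paths S p ((u +++ q) +++ reversepath u)"
proof -
  let ?I = "{0..1::real}"
  obtain h where h: "continuous_on (?I \<times> ?I) h" "h \<in> ?I \<times> ?I \<rightarrow> S"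
    "\<forall>t\<in>?I. h (0, t) = p t" "\<forall>t\<in>?I. h (1, t) = q t"
    "\<forall>s\<in>?I. pathfinish (h \<circ> Pair s) = pathstart (h \<circ> Pair s)"
    using assms unfolding homotopic_loops by (elim exE conjE)
  have ends: "h (s, 1) = h (s, 0)" if "s \<in> ?I" for s
    using bspec[OF h(5) that] by (simp add: pathfinish_def pathstart_def)
  define a :: "real \<Rightarrow> real \<times> real" where "a = linepath (0,0) (0,1)"
  define b :: "real \<Rightarrow> real \<times> real"
    where "b = (linepath (0,0) (1,0) +++ linepath (1,0) (1,1)) +++ reversepath (linepath (0,1) (1,1))"
  define u where "u = (\<lambda>s. h (s, 0))"
  have conv: "convex (?I \<times> ?I)" by (intro convex_Times) auto
  have seg: "closed_segment v w \<subseteq> ?I \<times> ?I" if "v \<in> ?I \<times> ?I" "w \<in> ?I \<times> ?I" for v w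
    using conv that by (rule closed_segment_subset[rotated 2])
  have "homotopic_paths (?I \<times> ?I) a b"
  proof -
    have sc: "simply_connected (?I \<times> ?I)" using conv by (rule convex_imp_simply_connected)
    have "path a" "path b" "path_image a \<subseteq> ?I \<times> ?I" "path_image b \<subseteq> ?I \<times> ?I"
      "pathstart b = pathstart a" "pathfinish b = pathfinish a"
      unfolding a_def b_def
      by (simp_all add: seg subset_path_image_join)
    then show ?thesis using sc unfolding simply_connected_eq_homotopic_paths by blast
  qed
  then have hom: "homotopic_paths S (h \<circ> a) (h \<circ> b)"
    using h(1,2) by (rule homotopic_paths_continuous_image)
  have "homotopic_paths S (h \<circ> a) p"
    using homotopic_paths_imp_path[OF hom] homotopic_paths_imp_subset[OF hom] h(3)
    by (intro homotopic_paths_eq) (auto simp: a_def linepath_def)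
  moreover have "homotopic_paths S (h \<circ> b) ((u +++ q) +++ reversepath u)"
  proof (rule homotopic_paths_eq)
    fix t :: real assume t: "t \<in> ?I"
    consider "t \<le> 1/4" | "1/4 < t" "t \<le> 1/2" | "1/2 < t" by linarith
    then show "(h \<circ> b) t = ((u +++ q) +++ reversepath u) t"
    proof cases
      case 1
      then show ?thesis by (simp add: b_def joinpaths_def linepath_def u_def)
    next
      case 2
      then have "4 * t - 1 \<in> ?I" by auto
      from bspec[OF h(4) this] 2 show ?thesis
        by (simp add: b_def joinpaths_def linepath_def u_def algebra_simps)
    next
      case 3
      then have "2 - 2 * t \<in> ?I" using t by auto
      from ends[OF this] 3 show ?thesis
        by (simp add: b_def joinpaths_def linepath_def u_def reversepath_def algebra_simps)
    qed
  qed (use homotopic_paths_imp_path[OF hom] homotopic_paths_imp_subset[OF hom] in auto)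
  ultimately have "homotopic_paths S p ((u +++ q) +++ reversepath u)"
    using hom homotopic_paths_trans homotopic_paths_sym by meson
  moreover have "path u"
    unfolding path_def u_def
    by (rule continuous_on_compose2[OF h(1)]) (auto intro!: continuous_intros)
  moreover have "path_image u \<subseteq> S" using h(2) by (auto simp: path_image_def u_def)
  moreover have "pathstart u = pathstart p" "pathfinish u = pathstart q"
    using h(3,4) by (auto simp: u_def pathstart_def pathfinish_def)
  ultimately show ?thesis by (intro that)
qed

lemma homotopic_paths_conjugate_join:
  fixes p :: "real \<Rightarrow> 'a::real_normed_vector"
  assumes p: "path p" "path_image p \<subseteq> S"
    and q: "path q" "path_image q \<subseteq> S" "pathstart q = pathfinish p" "pathfinish q = pathfinish p"
    and r: "path r" "path_image r \<subseteq> S" "pathstart r = pathfinish p" "pathfinish r = pathfinish p"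
  shows "homotopic_paths S ((p +++ q +++ reversepath p) +++ (p +++ r +++ reversepath p))
    (p +++ (q +++ r) +++ reversepath p)"
proof -
  let ?p' = "reversepath p"
  let ?w = "r +++ ?p'"
  note [simp] = path_image_join p q r
  have 1: "homotopic_paths S (p +++ ((q +++ ?p') +++ (p +++ ?w))) ((p +++ q +++ ?p') +++ (p +++ ?w))"
    by (intro homotopic_paths_assoc) auto
  have 2: "homotopic_paths S ((q +++ ?p') +++ (p +++ ?w)) (((q +++ ?p') +++ p) +++ ?w)"
    by (intro homotopic_paths_assoc) auto
  have "homotopic_paths S (((q +++ ?p') +++ p) +++ ?w) (q +++ ?w)"
    by (intro homotopic_paths_join homotopic_paths_append_back) auto
  moreover have "homotopic_paths S (q +++ ?w) ((q +++ r) +++ ?p')"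
    by (intro homotopic_paths_assoc) auto
  ultimately have "homotopic_paths S ((q +++ ?p') +++ (p +++ ?w)) ((q +++ r) +++ ?p')"
    using 2 homotopic_paths_trans by meson
  moreover have "homotopic_paths S p p" by simp
  moreover have "pathfinish p = pathstart ((q +++ ?p') +++ (p +++ ?w))" by simp
  ultimately have "homotopic_paths S (p +++ ((q +++ ?p') +++ (p +++ ?w))) (p +++ (q +++ r) +++ ?p')"
    by (metis homotopic_paths_join)
  with 1 show ?thesis using homotopic_paths_trans homotopic_paths_sym by meson
qed

text \<open>
  The complex line through two such points meets the zero sets in finitely many points, and the
  complex plane remains path connected when finitely many points are removed.
\<close>
lemma path_connected_avoiding_forms:
  fixes l :: "'i \<Rightarrow> complex^'n \<Rightarrow> complex"
  assumes V: "\<And>a b t. a \<in> V \<Longrightarrow> b \<in> V \<Longrightarrow> a + t *s (b - a) \<in> V" and I: "finite I"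
    and l: "\<And>i a b t. i \<in> I \<Longrightarrow> l i (a + t *s (b - a)) = l i a + t * (l i b - l i a)"
  shows "path_connected {y \<in> V. \<forall>i\<in>I. l i y \<noteq> 0}" (is "path_connected ?S")
  unfolding path_connected_component
proof (intro ballI)
  fix a b assume ab: "a \<in> ?S" "b \<in> ?S"
  define T where "T = - (\<Union>i\<in>I. {t. l i a + t * (l i b - l i a) = 0})"
  define f where "f = (\<lambda>t. a + t *s (b - a))"
  have "finite {t. l i a + t * (l i b - l i a) = 0}" if "i \<in> I" for i
  proof (cases "l i b = l i a")
    case True then show ?thesis using ab that by simp
  next
    case False
    then have "{t. l i a + t * (l i b - l i a) = 0} \<subseteq> {- l i a / (l i b - l i a)}"
      by (auto simp: field_simps eq_neg_iff_add_eq_0)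
    then show ?thesis by (rule finite_subset) simp
  qed
  then have "countable (\<Union>i\<in>I. {t. l i a + t * (l i b - l i a) = 0})"
    using I by (intro countable_finite) auto
  then have "path_connected T"
    unfolding T_def by (intro path_connected_complement_countable) auto
  moreover have "continuous_on T f"
    unfolding f_def vector_scalar_mult_def by (intro continuous_intros)
  ultimately have "path_connected (f ` T)" by (rule path_connected_continuous_image[rotated])
  moreover have "f ` T \<subseteq> ?S"
    using V ab l by (auto simp: f_def T_def)
  moreover have "a \<in> f ` T"
    by (rule image_eqI[of _ _ 0]) (use ab in \<open>auto simp: f_def T_def\<close>)
  moreover have "b \<in> f ` T"
    by (rule image_eqI[of _ _ 1]) (use ab in \<open>auto simp: f_def T_def\<close>)
  ultimately show "path_component ?S a b"
    by (meson path_component_of_subset path_connected_component)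
qed

context reflection_group
begin

abbreviation "\<A> \<equiv> reflecting_hyperplanes W"

definition form :: "(complex^'n) set \<Rightarrow> complex^'n \<Rightarrow> complex"
  where "form H = (SOME l. (\<exists>\<alpha>. l = (\<lambda>x. \<Sum>i\<in>UNIV. \<alpha> i * x $ i)) \<and> H = {x. l x = 0})"

lemma form_props:
  assumes "H \<in> \<A>"
  shows "(\<exists>\<alpha>. form H = (\<lambda>x. \<Sum>i\<in>UNIV. \<alpha> i * x $ i)) \<and> H = {x. form H x = 0}"
proof -
  obtain s where s: "reflection_along s H" using assms by (auto simp: reflecting_hyperplanes_def)
  obtain \<alpha> r where "H = {x. (\<Sum>i\<in>UNIV. \<alpha> i * x $ i) = 0}"
    "\<exists>x. (\<Sum>i\<in>UNIV. \<alpha> i * x $ i) \<noteq> 0" "\<forall>x. s *v x = x + (\<Sum>i\<in>UNIV. \<alpha> i * x $ i) *s r"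
    by (rule reflection_along_form[OF s])
  then have "\<exists>l. (\<exists>\<alpha>. l = (\<lambda>x. \<Sum>i\<in>UNIV. \<alpha> i * x $ i)) \<and> H = {x. l x = 0}" by blast
  from someI_ex[OF this] show ?thesis unfolding form_def .
qed

lemma form_linear:
  assumes "H \<in> \<A>"
  shows form_add: "form H (a + b) = form H a + form H b"
    and form_diff: "form H (a - b) = form H a - form H b"
    and form_scale: "form H (c *s a) = c * form H a"
proof -
  obtain \<alpha> where "form H = (\<lambda>x. \<Sum>i\<in>UNIV. \<alpha> i * x $ i)" using form_props[OF assms] by blast
  then show "form H (a + b) = form H a + form H b" "form H (a - b) = form H a - form H b"
    "form H (c *s a) = c * form H a"
    by (simp_all add: algebra_simps sum.distrib sum_subtractf sum_distrib_left)
qed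

lemma form_eq_0_iff: "H \<in> \<A> \<Longrightarrow> form H y = 0 \<longleftrightarrow> y \<in> H"
  using form_props by blast

lemma hpoly_form: "H \<in> \<A> \<Longrightarrow> hpoly 1 (form H)"
  using form_props hpoly_linear_form by metis

lemma continuous_on_form [continuous_intros]:
  assumes "H \<in> \<A>" "continuous_on S f" shows "continuous_on S (\<lambda>z. form H (f z))"
  using continuous_on_compose2[OF hpoly_continuous_on[OF hpoly_form[OF assms(1)]] assms(2) subset_UNIV] .

lemma complement_eq_forms: "X = {y. \<forall>H\<in>\<A>. form H y \<noteq> 0}"
  by (auto simp: hyperplane_complement_def form_eq_0_iff)

lemma path_connected_complement: "path_connected X"
proof -
  have "path_connected {y \<in> UNIV. \<forall>H\<in>\<A>. form H y \<noteq> 0}"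
    by (rule path_connected_avoiding_forms) (simp_all add: finite_reflecting_hyperplanes form_linear right_diff_distrib)
  then show ?thesis by (simp add: complement_eq_forms)
qed

end

context based_reflection_group
begin

lemma act_one [simp]: "act (mat 1) p = p" by simp

lemma qbraid_pure_mult:
  "pure_loop p \<Longrightarrow> pure_loop q \<Longrightarrow> qbraid p \<otimes>\<^bsub>Q\<^esub> qbraid q = qbraid (p +++ q)"
  using qbraid_mult[of "mat 1" p "mat 1" q] by simp

lemma qbraid_conjugate:
  assumes q: "lifts g q" and p: "pure_loop p"
  shows "qbraid q \<otimes>\<^bsub>Q\<^esub> qbraid p = qbraid ((q +++ act g p) +++ reversepath q) \<otimes>\<^bsub>Q\<^esub> qbraid q"
proof -
  note c = conjugate_pure_braid[OF q p]
  show ?thesis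
    unfolding qbraid_mult[OF q p] qbraid_mult[OF c(1) q] unfolding qbraid_def
    using c(2) by (simp only: braid_mult[OF q p] braid_mult[OF c(1) q])
qed

text \<open>
  Freely homotopic loops at the same base point are conjugate pure braids.
\<close>
lemma qbraid_freely_homotopic:
  assumes p: "pure_loop p" and q: "pure_loop q" and hom: "homotopic_loops X p q"
  shows "qbraid p = qbraid q"
proof -
  interpret Q: group Q by (rule group_Q)
  obtain u where u: "path u" "path_image u \<subseteq> X" "pathstart u = pathstart p" "pathfinish u = pathstart q"
    and conj: "homotopic_paths X p ((u +++ q) +++ reversepath u)"
    by (rule homotopic_loops_imp_conjugate[OF hom])
  have u': "pure_loop u" using u p q by (auto simp: lifts_def)
  have "qbraid p \<otimes>\<^bsub>Q\<^esub> qbraid u = qbraid u \<otimes>\<^bsub>Q\<^esub> qbraid q"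
    using qbraid_conjugate[OF u' q] qbraid_cong[OF conj p] by simp
  also have "\<dots> = qbraid q \<otimes>\<^bsub>Q\<^esub> qbraid u" by (rule qbraid_pure_commute[OF u' q])
  finally show ?thesis using qbraid_in_carrier p q u' by simp
qed

definition closed_path :: "(real \<Rightarrow> complex^'n) \<Rightarrow> bool"
  where "closed_path \<gamma> \<longleftrightarrow> path \<gamma> \<and> path_image \<gamma> \<subseteq> X \<and> pathfinish \<gamma> = pathstart \<gamma>"

text \<open>
  The class of a closed path in the abelianized pure braid group. As that group is abelian, the choice
  of a path to the base point does not influence the class.
\<close>
definition free_class :: "(real \<Rightarrow> complex^'n) \<Rightarrow> (real \<Rightarrow> (complex^'n) set) set set"
  where "free_class \<gamma> = qbraid (SOME \<delta>. pure_loop \<delta> \<and> homotopic_loops X \<gamma> \<delta>)"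

lemma free_class_eqI:
  assumes "pure_loop \<delta>" "homotopic_loops X \<gamma> \<delta>"
  shows "free_class \<gamma> = qbraid \<delta>"
proof -
  let ?\<delta>' = "SOME \<delta>. pure_loop \<delta> \<and> homotopic_loops X \<gamma> \<delta>"
  have "pure_loop ?\<delta>' \<and> homotopic_loops X \<gamma> ?\<delta>'" 
    by (rule someI[of "\<lambda>\<delta>. pure_loop \<delta> \<and> homotopic_loops X \<gamma> \<delta>" \<delta>]) (use assms in blast)
  then show ?thesis
    unfolding free_class_def using assms
    by (intro qbraid_freely_homotopic) (auto intro: homotopic_loops_trans homotopic_loops_sym)
qed

lemma pure_representative_conj:
  assumes "closed_path \<gamma>"
  obtains p where "path p" "path_image p \<subseteq> X" "pathstart p = x" "pathfinish p = pathstart \<gamma>"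
    "pure_loop (p +++ \<gamma> +++ reversepath p)" "homotopic_loops X \<gamma> (p +++ \<gamma> +++ reversepath p)"
proof -
  have "pathstart \<gamma> \<in> X" using assms pathstart_in_path_image by (auto simp: closed_path_def)
  then obtain p where p: "path p" "path_image p \<subseteq> X" "pathstart p = x" "pathfinish p = pathstart \<gamma>"
    using path_connected_complement x unfolding path_connected_def by blast
  have "homotopic_loops X (p +++ \<gamma> +++ reversepath p) \<gamma>"
    using p assms by (intro homotopic_loops_conjugate) (auto simp: closed_path_def)
  moreover have "pure_loop (p +++ \<gamma> +++ reversepath p)"
    using p assms W_one by (auto simp: lifts_def closed_path_def path_image_join)
  ultimately show ?thesis using p by (intro that) (auto intro: homotopic_loops_sym)
qed

lemma pure_representative:
  assumes "closed_path \<gamma>"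
  obtains \<delta> where "pure_loop \<delta>" "homotopic_loops X \<gamma> \<delta>" "free_class \<gamma> = qbraid \<delta>"
  using pure_representative_conj[OF assms] free_class_eqI by metis

lemma closed_path_homotopic:
  assumes "homotopic_loops X \<gamma> \<gamma>'" shows "closed_path \<gamma>" "closed_path \<gamma>'"
  using homotopic_loops_imp_path[OF assms] homotopic_loops_imp_subset[OF assms]
    homotopic_loops_imp_loop[OF assms] by (auto simp: closed_path_def)

lemma free_class_cong:
  assumes "homotopic_loops X \<gamma> \<gamma>'" shows "free_class \<gamma> = free_class \<gamma>'"
proof -
  obtain \<delta> where \<delta>: "pure_loop \<delta>" "homotopic_loops X \<gamma> \<delta>" "free_class \<gamma> = qbraid \<delta>"
    by (rule pure_representative[OF closed_path_homotopic(1)[OF assms]])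
  have "homotopic_loops X \<gamma>' \<delta>" using assms \<delta>(2) homotopic_loops_trans homotopic_loops_sym by blast
  from free_class_eqI[OF \<delta>(1) this] \<delta>(3) show ?thesis by simp
qed

lemma free_class_in_carrier: "closed_path \<gamma> \<Longrightarrow> free_class \<gamma> \<in> carrier Q"
  by (elim pure_representative) (simp add: qbraid_in_carrier)

lemma free_class_join:
  assumes \<gamma>: "closed_path \<gamma>" and \<gamma>': "closed_path \<gamma>'" and eq: "pathstart \<gamma>' = pathstart \<gamma>"
  shows "free_class (\<gamma> +++ \<gamma>') = free_class \<gamma> \<otimes>\<^bsub>Q\<^esub> free_class \<gamma>'"
proof -
  obtain p where p: "path p" "path_image p \<subseteq> X" "pathstart p = x" "pathfinish p = pathstart \<gamma>"
    "pure_loop (p +++ \<gamma> +++ reversepath p)" "homotopic_loops X \<gamma> (p +++ \<gamma> +++ reversepath p)"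
    by (rule pure_representative_conj[OF \<gamma>])
  let ?c = "\<lambda>\<gamma>. p +++ \<gamma> +++ reversepath p"
  have "homotopic_loops X (?c \<gamma>') \<gamma>'"
    using p(1-4) \<gamma>' eq by (intro homotopic_loops_conjugate) (auto simp: closed_path_def)
  moreover have "pure_loop (?c \<gamma>')"
    using p(1-4) \<gamma>' eq W_one by (auto simp: lifts_def closed_path_def path_image_join)
  ultimately have c': "pure_loop (?c \<gamma>')" "homotopic_loops X \<gamma>' (?c \<gamma>')"
    by (auto intro: homotopic_loops_sym)
  have join: "closed_path (\<gamma> +++ \<gamma>')"
    using \<gamma> \<gamma>' eq by (auto simp: closed_path_def path_image_join)
  have "homotopic_paths X (?c \<gamma> +++ ?c \<gamma>') (?c (\<gamma> +++ \<gamma>'))"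
    using p(1-4) \<gamma> \<gamma>' eq by (intro homotopic_paths_conjugate_join) (auto simp: closed_path_def)
  then have "homotopic_loops X (?c (\<gamma> +++ \<gamma>')) (?c \<gamma> +++ ?c \<gamma>')"
    using p(1-4) by (intro homotopic_loops_sym[OF homotopic_paths_imp_homotopic_loops]) auto
  moreover have "homotopic_loops X (\<gamma> +++ \<gamma>') (?c (\<gamma> +++ \<gamma>'))"
    using join p(1-4) by (intro homotopic_loops_sym[OF homotopic_loops_conjugate]) (auto simp: closed_path_def)
  ultimately have "homotopic_loops X (\<gamma> +++ \<gamma>') (?c \<gamma> +++ ?c \<gamma>')"
    using homotopic_loops_trans by blast
  moreover have "pure_loop (?c \<gamma> +++ ?c \<gamma>')" using lifts_join[OF p(5) c'(1)] by simp
  ultimately have "free_class (\<gamma> +++ \<gamma>') = qbraid (?c \<gamma> +++ ?c \<gamma>')" by (intro free_class_eqI)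
  also have "\<dots> = qbraid (?c \<gamma>) \<otimes>\<^bsub>Q\<^esub> qbraid (?c \<gamma>')" by (simp only: qbraid_pure_mult[OF p(5) c'(1)])
  also have "\<dots> = free_class \<gamma> \<otimes>\<^bsub>Q\<^esub> free_class \<gamma>'"
    using free_class_eqI[OF p(5,6)] free_class_eqI[OF c'] by simp
  finally show ?thesis .
qed

lemma free_class_split:
  assumes \<beta>: "closed_path \<beta>" and \<alpha>: "closed_path \<alpha>" and eq: "pathstart \<beta> = pathstart \<alpha>"
  shows "free_class \<beta> = free_class (\<beta> +++ reversepath \<alpha>) \<otimes>\<^bsub>Q\<^esub> free_class \<alpha>"
proof -
  have "closed_path (\<beta> +++ reversepath \<alpha>)"
    using \<alpha> \<beta> eq by (auto simp: closed_path_def path_image_join)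
  from free_class_join[OF this \<alpha>] eq
  have "free_class ((\<beta> +++ reversepath \<alpha>) +++ \<alpha>) = free_class (\<beta> +++ reversepath \<alpha>) \<otimes>\<^bsub>Q\<^esub> free_class \<alpha>"
    by simp
  moreover have "homotopic_paths X ((\<beta> +++ reversepath \<alpha>) +++ \<alpha>) \<beta>"
    using \<alpha> \<beta> eq by (intro homotopic_paths_append_back) (auto simp: closed_path_def)
  then have "homotopic_loops X ((\<beta> +++ reversepath \<alpha>) +++ \<alpha>) \<beta>"
    using \<alpha> \<beta> eq by (intro homotopic_paths_imp_homotopic_loops) (auto simp: closed_path_def)
  ultimately show ?thesis using free_class_cong by metis
qed

lemma free_class_const:
  assumes "y \<in> X" shows "free_class (\<lambda>t. y) = \<one>\<^bsub>Q\<^esub>"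
proof -
  interpret Q: group Q by (rule group_Q)
  have c: "closed_path (\<lambda>t. y)"
    using assms by (auto simp: closed_path_def path_def path_image_def pathstart_def pathfinish_def)
  have "(\<lambda>t. y) +++ (\<lambda>t. y) = (\<lambda>t. y)" by (auto simp: joinpaths_def)
  with free_class_join[OF c c] have "free_class (\<lambda>t. y) \<otimes>\<^bsub>Q\<^esub> free_class (\<lambda>t. y) = free_class (\<lambda>t. y)"
    by simp
  then show ?thesis using free_class_in_carrier[OF c] Q.r_cancel_one by blast
qed

text \<open>
  Conjugation by a braid over \<open>g\<close> acts on classes of loops as \<open>g\<close> acts on loops.
\<close>
lemma qbraid_free_class:
  assumes q: "lifts g q" and \<gamma>: "closed_path \<gamma>"
  shows "qbraid q \<otimes>\<^bsub>Q\<^esub> free_class \<gamma> = free_class (act g \<gamma>) \<otimes>\<^bsub>Q\<^esub> qbraid q"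
proof -
  obtain \<delta> where \<delta>: "pure_loop \<delta>" "homotopic_loops X \<gamma> \<delta>" "free_class \<gamma> = qbraid \<delta>"
    by (rule pure_representative[OF \<gamma>])
  have g: "g \<in> W" using q by (simp add: lifts_def)
  let ?c = "(q +++ act g \<delta>) +++ reversepath q"
  have d: "path (act g \<delta>)" "path_image (act g \<delta>) \<subseteq> X" "pathstart (act g \<delta>) = pathfinish q"
    "pathfinish (act g \<delta>) = pathfinish q"
    using \<delta>(1) q path_image_act[OF g, of \<delta>] by (auto simp: lifts_def)
  have "homotopic_paths X (q +++ act g \<delta> +++ reversepath q) ?c"
    using q d by (intro homotopic_paths_assoc) (auto simp: lifts_def)
  then have "homotopic_loops X (q +++ act g \<delta> +++ reversepath q) ?c"
    using d by (intro homotopic_paths_imp_homotopic_loops) auto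
  moreover have "homotopic_loops X (q +++ act g \<delta> +++ reversepath q) (act g \<delta>)"
    using q d by (intro homotopic_loops_conjugate) (auto simp: lifts_def)
  moreover have "homotopic_loops X (act g \<gamma>) (act g \<delta>)" by (rule homotopic_loops_act[OF \<delta>(2) g])
  ultimately have "homotopic_loops X (act g \<gamma>) ?c"
    using homotopic_loops_trans homotopic_loops_sym by meson
  with conjugate_pure_braid(1)[OF q \<delta>(1)] have "free_class (act g \<gamma>) = qbraid ?c"
    by (rule free_class_eqI)
  then show ?thesis using qbraid_conjugate[OF q \<delta>(1)] \<delta>(3) by simp
qed

end

section \<open>Loops around a puncture in an annulus\<close>

lemma homotopic_loopsI:
  fixes h :: "real \<Rightarrow> real \<Rightarrow> 'a::real_normed_vector"
  assumes "continuous_on ({0..1} \<times> {0..1}) (\<lambda>z. h (fst z) (snd z))"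
    and "\<And>s t. s \<in> {0..1} \<Longrightarrow> t \<in> {0..1} \<Longrightarrow> h s t \<in> S"
    and "\<And>s. s \<in> {0..1} \<Longrightarrow> h s 0 = h s 1"
  shows "homotopic_loops S (h 0) (h 1)"
  unfolding homotopic_loops
  by (rule exI[of _ "\<lambda>z. h (fst z) (snd z)"])
    (use assms in \<open>auto simp: pathfinish_def pathstart_def\<close>)

text \<open>
  A line in the direction of a point off the hyperplanes meets each hyperplane once. Scaled so that
  one of the intersection points is 1, a thin annulus around the unit circle contains no other
  intersection point if their moduli are distinct. The aim is to compare the circles inside and
  outside of the puncture.
\<close>
definition slit_annulus :: "real \<Rightarrow> complex set"
  where "slit_annulus \<eta> = {w. 1 - \<eta> \<le> cmod w \<and> cmod w \<le> 1 + \<eta> \<and> w \<noteq> 1}"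

lemma rcis_eq_1_imp:
  assumes "rcis r t = 1" "0 < r" shows "r = 1" "cis t = 1"
proof -
  have "cmod (rcis r t) = 1" using assms(1) by simp
  then show r: "r = 1" using assms(2) by simp
  then show "cis t = 1" using assms(1) by (simp add: rcis_def)
qed

text \<open>
  The circle of radius \<open>1 + e\<close> is deformed to a curve with the same sense of rotation that leaves from
  and returns to -1 on the unit circle and deviates from it so as to pass the puncture 1 on the same
  side as before.
\<close>
lemma homotopic_circle_detour:
  assumes e: "\<bar>e\<bar> \<le> \<eta>" "e \<noteq> 0" "\<eta> < 1"
  shows "homotopic_loops (slit_annulus \<eta>) (\<lambda>t. rcis (1 + e) (pi * (2 * t - 1)))
    (\<lambda>t. rcis (1 + e * sin (pi * t)) (- pi * cos (pi * t)))"
proof -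
  define h where "h = (\<lambda>s t. rcis (1 + e * ((1 - s) + s * sin (pi * t)))
    ((1 - s) * (pi * (2 * t - 1)) + s * (- pi * cos (pi * t))))"
  have "homotopic_loops (slit_annulus \<eta>) (h 0) (h 1)"
  proof (rule homotopic_loopsI)
    show "continuous_on ({0..1} \<times> {0..1}) (\<lambda>z. h (fst z) (snd z))"
      unfolding h_def by (intro continuous_intros)
    fix s t :: real assume s: "s \<in> {0..1}" and t: "t \<in> {0..1}"
    define m where "m = (1 - s) + s * sin (pi * t)"
    have "0 \<le> sin (pi * t)" using t by (intro sin_ge_zero) auto
    then have m: "0 \<le> m" "m \<le> 1"
      using s mult_left_le[of "sin (pi * t)" s] by (auto simp: m_def)
    then have em: "\<bar>e * m\<bar> \<le> \<eta>"
      using mult_mono[of "\<bar>e\<bar>" \<eta> m 1] e by (simp add: abs_mult)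
    then have pos: "0 < 1 + e * m" using e by linarith
    have "h s t \<noteq> 1"
    proof
      assume "h s t = 1"
      then have one: "rcis (1 + e * m) ((1 - s) * (pi * (2 * t - 1)) + s * (- pi * cos (pi * t))) = 1"
        by (simp add: h_def m_def)
      have "m = 0" using rcis_eq_1_imp(1)[OF one pos] e by simp
      then have "s = 1" "sin (pi * t) = 0"
        using s \<open>0 \<le> sin (pi * t)\<close> unfolding m_def
        by (auto simp: add_nonneg_eq_0_iff)
      have "sin (pi * t) > 0" if "0 < t" "t < 1" using that by (intro sin_gt_zero) auto
      with \<open>sin (pi * t) = 0\<close> t have "t = 0 \<or> t = 1" by fastforce
      then have "cis ((1 - s) * (pi * (2 * t - 1)) + s * (- pi * cos (pi * t))) = -1"
        using \<open>s = 1\<close> by (auto simp: complex_eq_iff)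
      then show False using rcis_eq_1_imp(2)[OF one pos] by simp
    qed
    moreover have "cmod (h s t) = 1 + e * m" using pos by (simp add: h_def m_def)
    ultimately show "h s t \<in> slit_annulus \<eta>" using em by (auto simp: slit_annulus_def)
  next
    fix s :: real
    show "h s 0 = h s 1"
      by (simp add: h_def rcis_def complex_eq_iff cos_diff sin_diff algebra_simps)
  qed
  then show ?thesis by (simp add: h_def)
qed

text \<open>
  The outer detour followed by the inner detour backwards is, in polar coordinates, a single ellipse
  around the puncture; the angle \<open>- pi * cos (pi * t)\<close> was chosen for this.
\<close>
lemma detour_difference:
  "(\<lambda>t. rcis (1 + \<eta> * sin (pi * t)) (- pi * cos (pi * t))) +++
    reversepath (\<lambda>t. rcis (1 + (- \<eta>) * sin (pi * t)) (- pi * cos (pi * t)))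
    = (\<lambda>t. rcis (1 + \<eta> * sin (2 * pi * t)) (- pi * cos (2 * pi * t)))"
proof
  fix t :: real
  have "sin (pi * (2 - 2 * t)) = - sin (2 * pi * t)" "cos (pi * (2 - 2 * t)) = cos (2 * pi * t)"
    by (simp_all add: right_diff_distrib sin_diff cos_diff mult.assoc mult.left_commute)
  then show "((\<lambda>t. rcis (1 + \<eta> * sin (pi * t)) (- pi * cos (pi * t))) +++
    reversepath (\<lambda>t. rcis (1 + (- \<eta>) * sin (pi * t)) (- pi * cos (pi * t)))) t
    = rcis (1 + \<eta> * sin (2 * pi * t)) (- pi * cos (2 * pi * t))"
    by (simp add: joinpaths_def reversepath_def mult.assoc mult.left_commute)
qed

lemma norm_cis_minus_one_le: "cmod (cis t - 1) \<le> \<bar>t\<bar>"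
proof -
  have "(cmod (cis t - 1))\<^sup>2 = (cos t)\<^sup>2 + (sin t)\<^sup>2 + 1 - 2 * cos t"
    by (simp add: cmod_power2 power2_diff)
  also have "\<dots> = 2 - 2 * cos t" by simp
  also have "cos t = 1 - 2 * (sin (t / 2))\<^sup>2" using cos_double_sin[of "t / 2"] by simp
  also have "2 - 2 * (1 - 2 * (sin (t / 2))\<^sup>2) = (2 * sin (t / 2))\<^sup>2" by (simp add: power_mult_distrib)
  also have "\<dots> \<le> \<bar>t\<bar>\<^sup>2"
    using abs_sin_x_le_abs_x[of "t / 2"] by (intro power2_le_iff_abs_le[THEN iffD2]) auto
  finally show ?thesis by (rule power2_le_imp_le) simp
qed

text \<open>
  The ellipse shrinks to a small one with semi-axes \<open>\<eta> / 2\<close> without meeting the puncture, since its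
  radius and its angle are never trivial at the same time. Then it is moved along segments to a round
  circle: both have an imaginary part of the sign opposite to that of \<open>cos (2 * pi * t)\<close>, and where
  the cosine vanishes they coincide and differ from 1.
\<close>
lemma homotopic_detour_difference_circle:
  assumes \<eta>: "0 < \<eta>" "\<eta> < 1"
  shows "homotopic_loops (slit_annulus \<eta>) (\<lambda>t. rcis (1 + \<eta> * sin (2 * pi * t)) (- pi * cos (2 * pi * t)))
    (\<lambda>t. 1 + of_real (\<eta> / 2) * (- \<i> * cis (2 * pi * t)))"
proof -
  define \<delta> where "\<delta> = \<eta> / 2"
  have \<delta>: "0 < \<delta>" "\<delta> < 1" "\<delta> < \<eta>" "2 * \<delta> = \<eta>" using \<eta> by (auto simp: \<delta>_def)
  define z where "z = (\<lambda>e k t. rcis (1 + e * sin (2 * pi * t)) (- k * cos (2 * pi * t)))"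
  have 1: "homotopic_loops (slit_annulus \<eta>) ((\<lambda>s. z ((1 - s) * \<eta> + s * \<delta>) ((1 - s) * pi + s * \<delta>)) 0)
    ((\<lambda>s. z ((1 - s) * \<eta> + s * \<delta>) ((1 - s) * pi + s * \<delta>)) 1)"
  proof (rule homotopic_loopsI)
    fix s t :: real assume s: "s \<in> {0..1}" and t: "t \<in> {0..1}"
    define e where "e = (1 - s) * \<eta> + s * \<delta>"
    define k where "k = (1 - s) * pi + s * \<delta>"
    have e: "0 < e" "e \<le> \<eta>" "e < 1"
    proof -
      have "e \<in> {\<delta>..\<eta>}"
        using convexD[of "{\<delta>..\<eta>}" \<eta> \<delta> "1 - s" s] s \<delta> by (auto simp: e_def)
      then show "0 < e" "e \<le> \<eta>" "e < 1" using \<delta> \<eta> by auto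
    qed
    have k: "0 < k" "k \<le> pi"
    proof -
      have "\<delta> \<le> pi" using \<delta> pi_gt3 by linarith
      then have "k \<in> {\<delta>..pi}"
        using convexD[of "{\<delta>..pi}" pi \<delta> "1 - s" s] s \<delta> by (auto simp: k_def)
      then show "0 < k" "k \<le> pi" using \<delta> by auto
    qed
    have es: "\<bar>e * sin (2 * pi * t)\<bar> \<le> \<eta>"
      using mult_mono[of "\<bar>e\<bar>" \<eta> "\<bar>sin (2 * pi * t)\<bar>" 1] e by (simp add: abs_mult)
    then have pos: "0 < 1 + e * sin (2 * pi * t)" using \<eta> by linarith
    have "z e k t \<noteq> 1"
    proof
      assume "z e k t = 1"
      then have one: "rcis (1 + e * sin (2 * pi * t)) (- k * cos (2 * pi * t)) = 1" by (simp add: z_def)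
      have "sin (2 * pi * t) = 0" using rcis_eq_1_imp(1)[OF one pos] e by simp
      then have "(cos (2 * pi * t))\<^sup>2 = 1" using sin_cos_squared_add[of "2 * pi * t"] by simp
      then have "cos (2 * pi * t) = 1 \<or> cos (2 * pi * t) = -1" by (simp add: power2_eq_1_iff)
      moreover have "cis (- k * cos (2 * pi * t)) = 1" using rcis_eq_1_imp(2)[OF one pos] .
      ultimately have "cos k = 1" by (auto simp: complex_eq_iff)
      moreover have "cos k < cos 0" using k by (intro cos_monotone_0_pi) auto
      ultimately show False by simp
    qed
    moreover have "cmod (z e k t) = 1 + e * sin (2 * pi * t)" using pos by (simp add: z_def)
    ultimately show "z ((1 - s) * \<eta> + s * \<delta>) ((1 - s) * pi + s * \<delta>) t \<in> slit_annulus \<eta>"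
      using es unfolding e_def[symmetric] k_def[symmetric] by (auto simp: slit_annulus_def)
  qed (auto simp: z_def intro!: continuous_intros)
  have 2: "homotopic_loops (slit_annulus \<eta>)
    ((\<lambda>s t. (1 - of_real s) * z \<delta> \<delta> t + of_real s * (1 + of_real \<delta> * (- \<i> * cis (2 * pi * t)))) 0)
    ((\<lambda>s t. (1 - of_real s) * z \<delta> \<delta> t + of_real s * (1 + of_real \<delta> * (- \<i> * cis (2 * pi * t)))) 1)"
  proof (rule homotopic_loopsI)
    fix s t :: real assume s: "s \<in> {0..1}" and t: "t \<in> {0..1}"
    define S where "S = sin (2 * pi * t)"
    define C where "C = cos (2 * pi * t)"
    let ?c = "1 + of_real \<delta> * (- \<i> * cis (2 * pi * t))"
    let ?w = "(1 - of_real s) * z \<delta> \<delta> t + of_real s * ?c"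
    have bounds: "\<bar>S\<bar> \<le> 1" "\<bar>C\<bar> \<le> 1" by (simp_all add: S_def C_def)
    have dS: "\<bar>\<delta> * S\<bar> \<le> \<delta>" "\<bar>\<delta> * C\<bar> \<le> \<delta>"
      using bounds \<delta> mult_left_mono[of "\<bar>S\<bar>" 1 \<delta>] mult_left_mono[of "\<bar>C\<bar>" 1 \<delta>] by (simp_all add: abs_mult)
    have pos: "0 < 1 + \<delta> * S" using dS \<delta> by linarith
    have "z \<delta> \<delta> t - 1 = (cis (- \<delta> * C) - 1) + of_real (\<delta> * S) * cis (- \<delta> * C)"
      by (simp add: z_def rcis_def S_def C_def algebra_simps)
    also have "cmod \<dots> \<le> cmod (cis (- \<delta> * C) - 1) + cmod (of_real (\<delta> * S) * cis (- \<delta> * C))"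
      by (rule norm_triangle_ineq)
    also have "\<dots> \<le> \<delta> + \<delta>"
      using norm_cis_minus_one_le[of "- \<delta> * C"] dS by (intro add_mono) (auto simp: norm_mult)
    finally have z1: "cmod (z \<delta> \<delta> t - 1) \<le> \<eta>" using \<delta> by simp
    have c1: "cmod (?c - 1) \<le> \<eta>" using \<delta> by (simp add: norm_mult)
    have "?w \<in> cball 1 \<eta>"
      using convexD[of "cball 1 \<eta>" "z \<delta> \<delta> t" ?c "1 - s" s] s z1 c1
      by (simp add: dist_norm norm_minus_commute scaleR_conv_of_real)
    then have near: "cmod (?w - 1) \<le> \<eta>" by (simp add: dist_norm norm_minus_commute)
    have mod: "1 - \<eta> \<le> cmod ?w" "cmod ?w \<le> 1 + \<eta>"
      using near norm_triangle_ineq2[of 1 ?w] norm_triangle_ineq2[of ?w 1] norm_minus_commute[of 1 ?w]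
      by (simp_all only: norm_one)
    have "?w \<noteq> 1"
    proof
      assume one: "?w = 1"
      have im: "(1 - s) * ((1 + \<delta> * S) * sin (\<delta> * C)) + s * (\<delta> * C) = 0"
        using arg_cong[OF one, of Im] by (simp add: z_def rcis_def S_def C_def)
      have C0: "C = 0"
      proof (rule ccontr)
        assume "C \<noteq> 0"
        have small: "\<bar>\<delta> * C\<bar> < pi" using dS \<delta> pi_gt3 by linarith
        have pos_sum: "0 < (1 - s) * ((1 + \<delta> * S) * sin (\<delta> * c)) + s * (\<delta> * c)"
          if "0 < c" "\<delta> * c < pi" for c
        proof -
          have dc: "0 < \<delta> * c" using \<delta>(1) that(1) by (rule mult_pos_pos)
          have "0 < (1 + \<delta> * S) * sin (\<delta> * c)"
            using pos sin_gt_zero[OF dc that(2)] by (rule mult_pos_pos)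
          then show ?thesis
            using s dc by (cases "s = 0") (auto intro!: add_nonneg_pos)
        qed
        consider "0 < C" | "0 < - C" using \<open>C \<noteq> 0\<close> by linarith
        then show False
        proof cases
          case 1
          then show False using pos_sum[of C] small im by linarith
        next
          case 2
          have "\<delta> * - C < pi" using small by simp
          from pos_sum[OF 2 this] show False using im by simp
        qed
      qed
      then have "S\<^sup>2 = 1" using sin_cos_squared_add[of "2 * pi * t"] by (simp add: S_def C_def)
      moreover have "(1 - s) * (1 + \<delta> * S) + s * (1 + \<delta> * S) = 1"
        using arg_cong[OF one, of Re] C0 by (simp add: z_def rcis_def S_def C_def)
      then have "\<delta> * S = 0" by (simp add: algebra_simps)
      ultimately show False using \<delta> by simp
    qed
    with mod show "?w \<in> slit_annulus \<eta>" by (simp add: slit_annulus_def)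
  qed (auto simp: z_def rcis_def complex_eq_iff intro!: continuous_intros)
  have "homotopic_loops (slit_annulus \<eta>) (z \<eta> pi) (z \<delta> \<delta>)" using 1 by simp
  moreover have "homotopic_loops (slit_annulus \<eta>) (z \<delta> \<delta>)
      (\<lambda>t. 1 + of_real \<delta> * (- \<i> * cis (2 * pi * t)))" using 2 by simp
  ultimately have "homotopic_loops (slit_annulus \<eta>) (z \<eta> pi)
      (\<lambda>t. 1 + of_real \<delta> * (- \<i> * cis (2 * pi * t)))" by (rule homotopic_loops_trans)
  then show ?thesis unfolding z_def \<delta>_def .
qed

section \<open>Meridians\<close>

lemma finite_pos_lower_bound:
  assumes "finite S" "\<And>i. i \<in> S \<Longrightarrow> (0::real) < f i"
  shows "\<exists>e>0. e < 1 \<and> (\<forall>i\<in>S. e < f i)"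
  using assms
proof (induction S)
  case empty show ?case by (rule exI[of _ "1/2"]) simp
next
  case (insert a S)
  then obtain e where "0 < e" "e < 1" "\<forall>i\<in>S. e < f i" by auto
  then show ?case
    using insert.prems[of a] by (intro exI[of _ "min e (f a / 2)"]) auto
qed

text \<open>
  The excluded translations form finitely many real lines and points in the plane, a null set.
\<close>
lemma ex_translate_distinct_moduli:
  fixes \<sigma> :: "'i \<Rightarrow> complex"
  assumes I: "finite I" and \<sigma>: "inj_on \<sigma> I"
  shows "\<exists>c. inj_on (\<lambda>i. cmod (\<sigma> i + c)) I \<and> (\<forall>i\<in>I. \<sigma> i + c \<noteq> 0)"
proof -
  define J where "J = {(i, j) \<in> I \<times> I. i \<noteq> j}"
  define N where "N = (\<Union>(i, j)\<in>J. {c. (\<sigma> i - \<sigma> j) \<bullet> c = ((cmod (\<sigma> j))\<^sup>2 - (cmod (\<sigma> i))\<^sup>2) / 2}) \<union> (\<lambda>i. - \<sigma> i) ` I"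
  have finJ: "finite J" unfolding J_def by (rule finite_subset[of _ "I \<times> I"]) (use I in auto)
  have "negligible N"
    unfolding N_def
  proof (intro negligible_Un negligible_Union)
    show "finite ((\<lambda>(i, j). {c. (\<sigma> i - \<sigma> j) \<bullet> c = ((cmod (\<sigma> j))\<^sup>2 - (cmod (\<sigma> i))\<^sup>2) / 2}) ` J)"
      using finJ by simp
    show "negligible ((\<lambda>i. - \<sigma> i) ` I)" using I by (simp add: negligible_finite)
    fix T assume "T \<in> (\<lambda>(i, j). {c. (\<sigma> i - \<sigma> j) \<bullet> c = ((cmod (\<sigma> j))\<^sup>2 - (cmod (\<sigma> i))\<^sup>2) / 2}) ` J"
    then obtain i j where "i \<in> I" "j \<in> I" "i \<noteq> j"
      "T = {c. (\<sigma> i - \<sigma> j) \<bullet> c = ((cmod (\<sigma> j))\<^sup>2 - (cmod (\<sigma> i))\<^sup>2) / 2}" by (auto simp: J_def)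
    then show "negligible T" using inj_on_eq_iff[OF \<sigma>] by (simp only:) (rule negligible_hyperplane, simp)
  qed
  then have "N \<noteq> UNIV" by (metis non_negligible_UNIV)
  then obtain c where c: "c \<notin> N" by blast
  have "inj_on (\<lambda>i. cmod (\<sigma> i + c)) I"
  proof (rule inj_onI, rule ccontr)
    fix i j assume ij: "i \<in> I" "j \<in> I" "cmod (\<sigma> i + c) = cmod (\<sigma> j + c)" "i \<noteq> j"
    have sq: "(cmod (\<sigma> k + c))\<^sup>2 = (cmod (\<sigma> k))\<^sup>2 + 2 * (\<sigma> k \<bullet> c) + (cmod c)\<^sup>2" for k
      by (simp add: power2_norm_eq_inner inner_add_left inner_add_right inner_commute)
    have "(cmod (\<sigma> i + c))\<^sup>2 = (cmod (\<sigma> j + c))\<^sup>2" using ij(3) by simp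
    then have "(\<sigma> i - \<sigma> j) \<bullet> c = ((cmod (\<sigma> j))\<^sup>2 - (cmod (\<sigma> i))\<^sup>2) / 2"
      unfolding sq inner_diff_left by simp
    then have "c \<in> N" using ij by (auto simp: N_def J_def)
    with c show False by contradiction
  qed
  moreover have "\<sigma> i + c \<noteq> 0" if "i \<in> I" for i
  proof
    assume "\<sigma> i + c = 0"
    then have "c = - \<sigma> i" by (simp add: eq_neg_iff_add_eq_0 add.commute)
    with c that show False by (auto simp: N_def)
  qed
  ultimately show ?thesis by blast
qed

definition circ :: "complex^'n \<Rightarrow> complex^'n \<Rightarrow> real \<Rightarrow> complex^'n"
  where "circ y a t = y + cis (2 * pi * t) *s a"

lemma cis_full_turn: "cis (2 * pi * 1) = cis (2 * pi * 0)"
  by (simp add: complex_eq_iff)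

context reflection_group
begin

lemma homotopic_circ:
  assumes Y: "continuous_on {0..1} Y" and A: "continuous_on {0..1} A"
    and avoid: "\<And>s H u. s \<in> {0..1} \<Longrightarrow> H \<in> \<A> \<Longrightarrow> cmod u = 1 \<Longrightarrow> form H (Y s) + u * form H (A s) \<noteq> 0"
  shows "homotopic_loops X (circ (Y 0) (A 0)) (circ (Y (1::real)) (A 1))"
proof (rule homotopic_loopsI[of "\<lambda>s. circ (Y s) (A s)"])
  have "continuous_on ({0..1} \<times> {0..1::real}) (\<lambda>z. Y (fst z))" "continuous_on ({0..1} \<times> {0..1::real}) (\<lambda>z. A (fst z))"
    by (auto intro!: continuous_on_compose2[OF Y] continuous_on_compose2[OF A] continuous_intros)
  then show "continuous_on ({0..1} \<times> {0..1}) (\<lambda>z. circ (Y (fst z)) (A (fst z)) (snd z))"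
    unfolding circ_def vector_scalar_mult_def by (intro continuous_intros)
  show "circ (Y s) (A s) t \<in> X" if "s \<in> {0..1}" for s t
    using avoid[OF that, of _ "cis (2 * pi * t)"] by (auto simp: complement_eq_forms circ_def form_linear)
  show "circ (Y s) (A s) 0 = circ (Y s) (A s) 1" for s
    unfolding circ_def cis_full_turn ..
qed

lemma reflecting_hyperplane_image:
  assumes H: "H \<in> \<A>" and g: "g \<in> W" shows "(*v) g ` H \<in> \<A>"
proof -
  obtain s where s: "s \<in> W" "reflection_along s H" using H by (auto simp: reflecting_hyperplanes_def)
  obtain \<alpha> r where \<alpha>: "H = {x. (\<Sum>i\<in>UNIV. \<alpha> i * x $ i) = 0}"
    "\<exists>x. (\<Sum>i\<in>UNIV. \<alpha> i * x $ i) \<noteq> 0" "\<forall>x. s *v x = x + (\<Sum>i\<in>UNIV. \<alpha> i * x $ i) *s r"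
    by (rule reflection_along_form[OF s(2)])
  define l where "l = (\<lambda>x::complex^'n. \<Sum>i\<in>UNIV. \<alpha> i * x $ i)"
  obtain g' where g': "g' \<in> W" "g' ** g = mat 1" "g ** g' = mat 1" using W_inverse[OF g] by metis
  define u where "u = g ** s ** g'"
  have u: "u \<in> W" using g g' s(1) by (simp add: u_def W_mult)
  have gg': "g *v (g' *v y) = y" "g' *v (g *v y) = y" for y
    by (simp_all add: matrix_vector_mul_assoc g')
  have "u *v a - a = l (g' *v a) *s (g *v r)" for a
  proof -
    have "u *v a = g *v (s *v (g' *v a))" by (simp add: u_def matrix_vector_mul_assoc matrix_mul_assoc)
    also have "\<dots> = g *v (g' *v a + l (g' *v a) *s r)" using \<alpha>(3) by (simp add: l_def)
    also have "\<dots> = a + l (g' *v a) *s (g *v r)" by (simp add: matrix_vector_right_distrib gg' vec.scale)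
    finally show ?thesis by simp
  qed
  then have ua: "(u *v a - a) $ i = l (g' *v a) * (g *v r) $ i" for a i by simp
  have fixed_iff: "u *v y = y \<longleftrightarrow> s *v (g' *v y) = g' *v y" for y
  proof
    assume "u *v y = y"
    then have "g' *v (g *v (s *v (g' *v y))) = g' *v y" by (simp add: u_def matrix_vector_mul_assoc matrix_mul_assoc)
    then show "s *v (g' *v y) = g' *v y" by (simp only: gg')
  next
    assume "s *v (g' *v y) = g' *v y"
    then show "u *v y = y" by (simp add: u_def matrix_vector_mul_assoc[symmetric] gg')
  qed
  obtain b where b: "s *v b \<noteq> b"
    using s(2) by (metis matrix_eq matrix_vector_mul_lid reflection_along_def)
  have "reflection_along u {x. u *v x = x}"
  proof (rule fixed_hyperplane_if_rank_one[OF u])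
    show "u *v (g *v b) \<noteq> g *v b" using fixed_iff[of "g *v b"] b by (simp add: gg')
    show "(u *v a - a) $ i * (u *v (g *v b) - g *v b) $ j = (u *v a - a) $ j * (u *v (g *v b) - g *v b) $ i"
      for a i j unfolding ua by (simp only: mult_ac)
  qed
  moreover have "{x. u *v x = x} = (*v) g ` H"
  proof (intro equalityI subsetI)
    fix y assume "y \<in> {x. u *v x = x}"
    then have "g' *v y \<in> H" using fixed_iff reflecting_hyperplane_fixed_space[OF s(2)] by auto
    then show "y \<in> (*v) g ` H" using gg'(1)[of y] by (metis imageI)
  next
    fix y assume "y \<in> (*v) g ` H"
    then show "y \<in> {x. u *v x = x}" using fixed_iff gg'(2) reflecting_hyperplane_fixed_space[OF s(2)] by auto
  qed
  ultimately show ?thesis using u by (auto simp: reflecting_hyperplanes_def)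
qed

text \<open>
  The circle with centre \<open>y\<close> on \<open>H\<close> in the complex direction \<open>a\<close> bounds a disc that meets \<open>H\<close> in
  its centre and no other hyperplane.
\<close>
definition small_circle :: "(complex^'n) set \<Rightarrow> complex^'n \<Rightarrow> complex^'n \<Rightarrow> bool"
  where "small_circle H y a \<longleftrightarrow> H \<in> \<A> \<and> y \<in> H \<and> a \<in> X \<and>
    (\<forall>H'\<in>\<A> - {H}. cmod (form H' a) < cmod (form H' y))"

lemma circle_avoids:
  assumes "H \<in> \<A>" "cmod (form H a) \<noteq> cmod (form H y)" "cmod u = 1"
  shows "form H y + u * form H a \<noteq> 0"
proof
  assume "form H y + u * form H a = 0"
  then have "form H y = - (u * form H a)" by (simp add: eq_neg_iff_add_eq_0)
  then have "cmod (form H y) = cmod (form H a)" using assms(3) by (simp add: norm_mult)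
  with assms(2) show False by simp
qed

lemma small_circle_shrink:
  assumes sc: "small_circle H y a" and e: "0 < e" "e \<le> 1"
  shows "homotopic_loops X (circ y a) (circ y (of_real e *s a))"
proof -
  have "homotopic_loops X (circ ((\<lambda>s::real. y) 0) ((\<lambda>s. of_real (1 - s + s * e) *s a) 0))
      (circ ((\<lambda>s. y) (1::real)) ((\<lambda>s. of_real (1 - s + s * e) *s a) 1))"
  proof (rule homotopic_circ)
    show "continuous_on {0..1} (\<lambda>s. of_real (1 - s + s * e) *s a)"
      unfolding vector_scalar_mult_def by (intro continuous_intros)
    fix s :: real and H' u assume s: "s \<in> {0..1}" and H': "H' \<in> \<A>" and u: "cmod u = 1"
    have "1 - s + s * e \<in> {e..1}"
      using convexD[of "{e..1}" 1 e "1 - s" s] s e by auto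
    then have q: "0 < 1 - s + s * e" "1 - s + s * e \<le> 1" using e by auto
    show "form H' y + u * form H' (of_real (1 - s + s * e) *s a) \<noteq> 0"
    proof (rule circle_avoids[OF H' _ u])
      have n: "cmod (form H' (of_real (1 - s + s * e) *s a)) = (1 - s + s * e) * cmod (form H' a)"
        using q H' by (simp add: form_linear norm_mult del: of_real_add of_real_diff of_real_mult)
      show "cmod (form H' (of_real (1 - s + s * e) *s a)) \<noteq> cmod (form H' y)"
      proof (cases "H' = H")
        case True
        then have "form H' y = 0" "form H' a \<noteq> 0"
          using sc form_eq_0_iff[OF H'] H' by (auto simp: small_circle_def complement_eq_forms)
        then show ?thesis using q unfolding n by simp
      next
        case False
        then have "cmod (form H' a) < cmod (form H' y)" using sc H' by (simp add: small_circle_def)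
        moreover have "(1 - s + s * e) * cmod (form H' a) \<le> 1 * cmod (form H' a)"
          using q by (intro mult_right_mono) auto
        ultimately show ?thesis unfolding n by linarith
      qed
    qed
  qed simp
  then show ?thesis by simp
qed

text \<open>
  The centres are joined within \<open>H\<close> off the other hyperplanes, the directions within the complement.
  By compactness the circles along the way are small after multiplication of the directions by a
  common factor \<open>e\<close>.
\<close>
lemma small_circles_homotopic:
  assumes sc: "small_circle H y a" and sc': "small_circle H y' a'"
  shows "homotopic_loops X (circ y a) (circ y' a')"
proof -
  have H: "H \<in> \<A>" using sc by (simp add: small_circle_def)
  let ?H0 = "{y \<in> H. \<forall>H'\<in>\<A> - {H}. form H' y \<noteq> 0}"
  have "path_connected ?H0"
  proof (rule path_connected_avoiding_forms)
    show "a + t *s (b - a) \<in> H" if "a \<in> H" "b \<in> H" for a b t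
      using that by (simp add: form_eq_0_iff[OF H, symmetric] form_linear[OF H])
  qed (auto simp: finite_reflecting_hyperplanes form_linear right_diff_distrib)
  moreover have "y \<in> ?H0" "y' \<in> ?H0"
  proof -
    have "form H' y \<noteq> 0" "form H' y' \<noteq> 0" if "H' \<in> \<A> - {H}" for H'
    proof -
      have "cmod (form H' a) < cmod (form H' y)" "cmod (form H' a') < cmod (form H' y')"
        using sc sc' that by (auto simp: small_circle_def)
      then show "form H' y \<noteq> 0" "form H' y' \<noteq> 0" by auto
    qed
    then show "y \<in> ?H0" "y' \<in> ?H0" using sc sc' by (auto simp: small_circle_def)
  qed
  ultimately obtain Y where Y: "path Y" "path_image Y \<subseteq> ?H0" "pathstart Y = y" "pathfinish Y = y'"
    unfolding path_connected_def by meson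
  have "a \<in> X" "a' \<in> X" using sc sc' by (auto simp: small_circle_def)
  then obtain A where A: "path A" "path_image A \<subseteq> X" "pathstart A = a" "pathfinish A = a'"
    using path_connected_complement unfolding path_connected_def by meson
  have YH: "Y s \<in> ?H0" "A s \<in> X" if "s \<in> {0..1}" for s
  proof -
    have "Y s \<in> path_image Y" "A s \<in> path_image A" using that by (auto simp: path_image_def)
    then show "Y s \<in> ?H0" "A s \<in> X" using Y(2) A(2) by blast+
  qed
  have "\<forall>H'\<in>\<A> - {H}. \<exists>m>0. \<forall>s\<in>{0..1}. m * cmod (form H' (A s)) \<le> cmod (form H' (Y s))"
  proof
    fix H' assume H': "H' \<in> \<A> - {H}"
    have nz: "form H' (A s) \<noteq> 0" "form H' (Y s) \<noteq> 0" if "s \<in> {0..1}" for s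
      using YH[OF that] H' unfolding complement_eq_forms by blast+
    have "continuous_on {0..1} (\<lambda>s. cmod (form H' (Y s)) / cmod (form H' (A s)))"
      using H' nz Y(1) A(1) by (intro continuous_intros) (auto simp: path_def)
    from continuous_attains_inf[OF compact_Icc _ this]
    obtain s0 where s0: "s0 \<in> {0..1}" "\<forall>s\<in>{0..1}. cmod (form H' (Y s0)) / cmod (form H' (A s0)) \<le>
      cmod (form H' (Y s)) / cmod (form H' (A s))" by auto
    show "\<exists>m>0. \<forall>s\<in>{0..1}. m * cmod (form H' (A s)) \<le> cmod (form H' (Y s))"
    proof (intro exI conjI ballI)
      show "0 < cmod (form H' (Y s0)) / cmod (form H' (A s0))" using nz[OF s0(1)] by simp
      fix s :: real assume s: "s \<in> {0..1}"
      then show "cmod (form H' (Y s0)) / cmod (form H' (A s0)) * cmod (form H' (A s)) \<le> cmod (form H' (Y s))"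
        using bspec[OF s0(2) s] nz[OF s] by (simp add: pos_le_divide_eq)
    qed
  qed
  from bchoice[OF this] obtain m where m: "\<forall>H'\<in>\<A> - {H}. 0 < m H' \<and>
    (\<forall>s\<in>{0..1}. m H' * cmod (form H' (A s)) \<le> cmod (form H' (Y s)))" by blast
  obtain e where e: "0 < e" "e < 1" "\<forall>H'\<in>\<A> - {H}. e < m H'"
    using finite_pos_lower_bound[of "\<A> - {H}" m] m finite_reflecting_hyperplanes by auto
  have "homotopic_loops X (circ (Y 0) ((\<lambda>s. of_real e *s A s) 0)) (circ (Y 1) ((\<lambda>s. of_real e *s A s) 1))"
  proof (rule homotopic_circ)
    show "continuous_on {0..1} Y" using Y(1) by (simp add: path_def)
    have "continuous_on {0..1} A" using A(1) by (simp add: path_def)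
    then show "continuous_on {0..1} (\<lambda>s. of_real e *s A s)"
      unfolding vector_scalar_mult_def by (intro continuous_intros)
    fix s :: real and H' u assume s: "s \<in> {0..1}" and H': "H' \<in> \<A>" and u: "cmod u = 1"
    show "form H' (Y s) + u * form H' (of_real e *s A s) \<noteq> 0"
    proof (rule circle_avoids[OF H' _ u])
      have nz: "form H' (A s) \<noteq> 0" using YH(2)[OF s] H' by (simp add: complement_eq_forms)
      have n: "cmod (form H' (of_real e *s A s)) = e * cmod (form H' (A s))"
        using e H' by (simp add: form_linear norm_mult)
      show "cmod (form H' (of_real e *s A s)) \<noteq> cmod (form H' (Y s))"
      proof (cases "H' = H")
        case True
        then have "form H' (Y s) = 0" using YH(1)[OF s] form_eq_0_iff[OF H] by simp
        then show ?thesis using e nz unfolding n by simp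
      next
        case False
        with H' have *: "H' \<in> \<A> - {H}" by simp
        have "e * cmod (form H' (A s)) < m H' * cmod (form H' (A s))"
          using bspec[OF e(3) *] nz by simp
        also have "\<dots> \<le> cmod (form H' (Y s))" using bspec[OF m *] s by blast
        finally show ?thesis unfolding n by simp
      qed
    qed
  qed
  then have "homotopic_loops X (circ y (of_real e *s a)) (circ y' (of_real e *s a'))"
    using Y(3,4) A(3,4) by (simp add: pathstart_def pathfinish_def)
  moreover have "homotopic_loops X (circ y a) (circ y (of_real e *s a))"
    using small_circle_shrink[OF sc] e by simp
  moreover have "homotopic_loops X (circ y' (of_real e *s a')) (circ y' a')"
    using homotopic_loops_sym[OF small_circle_shrink[OF sc']] e by simp
  ultimately show ?thesis using homotopic_loops_trans by blast
qed

text \<open>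
  The forms of \<open>H\<close> and of its image were chosen independently; they correspond up to a scalar.
\<close>
lemma form_image:
  assumes H: "H \<in> \<A>" and g: "g \<in> W"
  shows "\<exists>k. k \<noteq> 0 \<and> (\<forall>z. form ((*v) g ` H) (g *v z) = k * form H z)"
proof -
  let ?K = "(*v) g ` H"
  have K: "?K \<in> \<A>" by (rule reflecting_hyperplane_image[OF H g])
  obtain s where "reflection_along s H" using H by (auto simp: reflecting_hyperplanes_def)
  then have "H \<noteq> UNIV" using reflecting_hyperplane_fixed_space by (metis UNIV_I mem_Collect_eq matrix_eq matrix_vector_mul_lid reflection_along_def)
  then obtain e where e: "form H e \<noteq> 0" using form_eq_0_iff[OF H] by blast
  have memK: "g *v z \<in> ?K \<longleftrightarrow> z \<in> H" for z
  proof
    assume "g *v z \<in> ?K"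
    then obtain h where h: "h \<in> H" "g *v z = g *v h" by blast
    obtain g' where g': "g' \<in> W" "g' ** g = mat 1" using W_inverse[OF g] by metis
    have "z = g' *v (g *v z)" by (simp add: matrix_vector_mul_assoc g')
    also have "\<dots> = h" unfolding h(2) by (simp add: matrix_vector_mul_assoc g')
    finally show "z \<in> H" using h(1) by simp
  qed simp
  let ?k = "form ?K (g *v e) / form H e"
  have "form ?K (g *v e) \<noteq> 0" using memK[of e] e form_eq_0_iff[OF K] form_eq_0_iff[OF H] by simp
  then have k: "?k \<noteq> 0" using e by simp
  have eq: "form ?K (g *v z) = ?k * form H z" for z
  proof -
    let ?z = "z - (form H z / form H e) *s e"
    have "form H ?z = 0" using e by (simp add: form_linear[OF H])
    then have "form ?K (g *v ?z) = 0" using memK form_eq_0_iff[OF K] form_eq_0_iff[OF H] by simp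
    then have "form ?K (g *v z) - (form H z / form H e) * form ?K (g *v e) = 0"
      by (simp add: vec.diff vec.scale form_linear[OF K])
    then show ?thesis by simp
  qed
  show ?thesis
  proof (intro exI conjI allI)
    show "?k \<noteq> 0" by (rule k)
    show "form ?K (g *v z) = ?k * form H z" for z by (rule eq)
  qed
qed

lemma small_circle_act:
  assumes sc: "small_circle H y a" and g: "g \<in> W"
  shows "small_circle ((*v) g ` H) (g *v y) (g *v a)"
  unfolding small_circle_def
proof (intro conjI ballI)
  have H: "H \<in> \<A>" using sc by (simp add: small_circle_def)
  show "(*v) g ` H \<in> \<A>" by (rule reflecting_hyperplane_image[OF H g])
  show "g *v y \<in> (*v) g ` H" using sc by (simp add: small_circle_def)
  show "g *v a \<in> X" using sc g complement_stable by (simp add: small_circle_def)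
  fix K assume K: "K \<in> \<A> - {(*v) g ` H}"
  obtain g' where g': "g' \<in> W" "g' ** g = mat 1" "g ** g' = mat 1" using W_inverse[OF g] by metis
  define H' where "H' = (*v) g' ` K"
  have KH': "K = (*v) g ` H'" by (simp add: H'_def image_image matrix_vector_mul_assoc g'(3))
  have "H' \<in> \<A>" using reflecting_hyperplane_image[of K g'] K g'(1) by (simp add: H'_def)
  moreover have "H' \<noteq> H" using KH' K by blast
  ultimately have H': "H' \<in> \<A> - {H}" by simp
  obtain k where k: "k \<noteq> 0" "\<forall>z. form K (g *v z) = k * form H' z"
    using form_image[OF \<open>H' \<in> \<A>\<close> g] unfolding KH'[symmetric] by blast
  have "cmod (form H' a) < cmod (form H' y)" using sc H' by (simp add: small_circle_def)
  then show "cmod (form K (g *v a)) < cmod (form K (g *v y))" using k by (simp add: norm_mult)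
qed

end

section \<open>The full twist as a product of meridians\<close>

context reflection_group
begin

text \<open>
  The parameter of the point in which the line \<open>v + c a\<close> meets \<open>H\<close>.
\<close>
definition line_root :: "complex^'n \<Rightarrow> complex^'n \<Rightarrow> (complex^'n) set \<Rightarrow> complex"
  where "line_root v a H = - form H v / form H a"

lemma form_on_line:
  assumes "H \<in> \<A>" "a \<in> X"
  shows "form H (v + c *s a) = form H a * (c - line_root v a H)"
  using assms by (simp add: form_linear line_root_def complement_eq_forms field_simps)

lemma on_line_in_complement_iff:
  assumes "a \<in> X" shows "v + c *s a \<in> X \<longleftrightarrow> (\<forall>H\<in>\<A>. c \<noteq> line_root v a H)"
  using assms form_on_line[OF _ assms, of _ v c] by (simp add: complement_eq_forms)

text \<open>
  For generic \<open>v\<close> the line meets the hyperplanes in distinct points; moving \<open>v\<close> along the line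
  translates their parameters, which makes the moduli distinct as well.
\<close>
lemma ex_generic_line:
  assumes a: "a \<in> X"
  obtains v where "inj_on (\<lambda>H. cmod (line_root v a H)) \<A>" "\<forall>H\<in>\<A>. line_root v a H \<noteq> 0"
proof -
  define J where "J = {(H, K) \<in> \<A> \<times> \<A>. H \<noteq> K}"
  define p where "p = (\<lambda>(H, K) v. form K a * form H v - form H a * form K v)"
  have finJ: "finite J" unfolding J_def
    by (rule finite_subset[of _ "\<A> \<times> \<A>"]) (auto simp: finite_reflecting_hyperplanes)
  have "\<exists>v. \<forall>j\<in>J. p j v \<noteq> 0"
  proof (rule hpoly_common_nonzero[OF finJ, where k = "\<lambda>_. 1"])
    fix j assume "j \<in> J"
    then obtain H K where j: "j = (H, K)" "H \<in> \<A>" "K \<in> \<A>" "H \<noteq> K" by (auto simp: J_def)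
    have nz: "form H a \<noteq> 0" "form K a \<noteq> 0" using a j by (auto simp: complement_eq_forms)
    have "hpoly 1 (p j)"
      unfolding j(1) p_def using hpoly_form[OF j(2)] hpoly_form[OF j(3)]
      by (simp only: case_prod_conv) (intro hpoly_diff hpoly_scale)
    moreover have "\<exists>v. p j v \<noteq> 0"
    proof (rule ccontr)
      assume "\<not> (\<exists>v. p j v \<noteq> 0)"
      then have "form K a * form H v = form H a * form K v" for v unfolding j(1) p_def by auto
      then have "form H v = 0 \<longleftrightarrow> form K v = 0" for v using nz by (metis mult_eq_0_iff)
      then have "H = K" using form_eq_0_iff[OF j(2)] form_eq_0_iff[OF j(3)] by blast
      with j(4) show False by contradiction
    qed
    ultimately show "hpoly 1 (p j) \<and> (\<exists>v. p j v \<noteq> 0)" by blast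
  qed
  then obtain w where w: "\<forall>j\<in>J. p j w \<noteq> 0" by blast
  have "inj_on (line_root w a) \<A>"
  proof (rule inj_onI, rule ccontr)
    fix H K assume HK: "H \<in> \<A>" "K \<in> \<A>" "line_root w a H = line_root w a K" "H \<noteq> K"
    then have "form H a \<noteq> 0" "form K a \<noteq> 0" using a by (auto simp: complement_eq_forms)
    with HK(3) have "p (H, K) w = 0" by (simp add: line_root_def p_def field_simps)
    moreover have "(H, K) \<in> J" using HK by (simp add: J_def)
    ultimately show False using w by blast
  qed
  from ex_translate_distinct_moduli[OF finite_reflecting_hyperplanes this]
  obtain c where c: "inj_on (\<lambda>H. cmod (line_root w a H + c)) \<A>" "\<forall>H\<in>\<A>. line_root w a H + c \<noteq> 0"
    by blast
  have eq: "line_root (w - c *s a) a H = line_root w a H + c" if "H \<in> \<A>" for H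
    using that a by (simp add: line_root_def form_linear complement_eq_forms field_simps)
  show ?thesis
  proof (rule that[of "w - c *s a"])
    show "inj_on (\<lambda>H. cmod (line_root (w - c *s a) a H)) \<A>"
      using c(1) by (simp add: eq cong: inj_on_cong)
  qed (use c(2) eq in simp)
qed

lemma small_circle_on_line:
  assumes a: "a \<in> X" and H: "H \<in> \<A>" and c: "c \<noteq> 0"
    and small: "\<forall>K\<in>\<A> - {H}. cmod c < cmod (line_root v a H - line_root v a K)"
  shows "small_circle H (v + line_root v a H *s a) (c *s a)"
  unfolding small_circle_def
proof (intro conjI ballI)
  show "H \<in> \<A>" by fact
  show "v + line_root v a H *s a \<in> H"
    unfolding form_eq_0_iff[OF H, symmetric] form_on_line[OF H a] by simp
  show "c *s a \<in> X" using a c by (simp add: complement_eq_forms form_linear)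
  fix K assume K: "K \<in> \<A> - {H}"
  then have "form K a \<noteq> 0" using a by (simp add: complement_eq_forms)
  then show "cmod (form K (c *s a)) < cmod (form K (v + line_root v a H *s a))"
    using K bspec[OF small K] by (simp add: form_on_line a form_scale norm_mult mult.commute)
qed

lemma small_circle_exists:
  assumes H: "H \<in> \<A>" and a: "a \<in> X"
  shows "\<exists>y b. small_circle H y b"
proof -
  obtain v where v: "inj_on (\<lambda>H. cmod (line_root v a H)) \<A>" "\<forall>H\<in>\<A>. line_root v a H \<noteq> 0"
    by (rule ex_generic_line[OF a])
  have "0 < cmod (line_root v a H - line_root v a K)" if "K \<in> \<A> - {H}" for K
    using that v(1) H by (auto simp: inj_on_def)
  then obtain e where "0 < e" "\<forall>K\<in>\<A> - {H}. e < cmod (line_root v a H - line_root v a K)"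
    using finite_pos_lower_bound[of "\<A> - {H}" "\<lambda>K. cmod (line_root v a H - line_root v a K)"]
      finite_reflecting_hyperplanes by auto
  then have "small_circle H (v + line_root v a H *s a) (of_real e *s a)"
    using a H by (intro small_circle_on_line) auto
  then show ?thesis by blast
qed

text \<open>
  The radii are interpolated through logarithms, so that the modulus stays between the given ones
  while the argument turns.
\<close>
lemma homotopic_circles_on_line:
  assumes a: "a \<in> X" and c: "c \<noteq> 0" "c' \<noteq> 0"
    and avoid: "\<forall>H\<in>\<A>. cmod (line_root v a H) < min (cmod c) (cmod c') \<or> max (cmod c) (cmod c') < cmod (line_root v a H)"
  shows "homotopic_loops X (circ v (c *s a)) (circ v (c' *s a))"
proof -
  define q where "q = (\<lambda>s::real. exp (of_real (1 - s) * Ln c + of_real s * Ln c'))"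
  have "homotopic_loops X (circ ((\<lambda>s::real. v) 0) ((\<lambda>s. q s *s a) 0)) (circ ((\<lambda>s. v) (1::real)) ((\<lambda>s. q s *s a) 1))"
  proof (rule homotopic_circ)
    show "continuous_on {0..1} (\<lambda>s. q s *s a)"
      unfolding vector_scalar_mult_def q_def by (intro continuous_intros)
    fix s :: real and H u assume s: "s \<in> {0..1}" and H: "H \<in> \<A>" and u: "cmod u = 1"
    have lnq: "ln (cmod (q s)) = (1 - s) * ln (cmod c) + s * ln (cmod c')"
      using c by (simp add: q_def)
    have "(1 - s) * ln (cmod c) + s * ln (cmod c') \<in>
        {min (ln (cmod c)) (ln (cmod c'))..max (ln (cmod c)) (ln (cmod c'))}"
      using convexD[of "{min (ln (cmod c)) (ln (cmod c'))..max (ln (cmod c)) (ln (cmod c'))}"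
          "ln (cmod c)" "ln (cmod c')" "1 - s" s] s by auto
    then have "min (ln (cmod c)) (ln (cmod c')) \<le> ln (cmod (q s))"
      "ln (cmod (q s)) \<le> max (ln (cmod c)) (ln (cmod c'))" unfolding lnq by auto
    moreover have "cmod (q s) > 0" by (simp add: q_def)
    ultimately have "min (cmod c) (cmod c') \<le> cmod (q s)" "cmod (q s) \<le> max (cmod c) (cmod c')"
      using c by (auto simp: min_def max_def split: if_splits)
    then have ne: "cmod (q s) \<noteq> cmod (line_root v a H)" using bspec[OF avoid H] by auto
    have fa: "form H a \<noteq> 0" using a H by (simp add: complement_eq_forms)
    show "form H v + u * form H (q s *s a) \<noteq> 0"
    proof (rule circle_avoids[OF H _ u])
      show "cmod (form H (q s *s a)) \<noteq> cmod (form H v)"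
      proof
        assume "cmod (form H (q s *s a)) = cmod (form H v)"
        then have "cmod (q s) = cmod (line_root v a H)"
          using fa H by (simp add: form_scale line_root_def norm_mult norm_divide field_simps)
        with ne show False by contradiction
      qed
    qed
  qed simp
  then show ?thesis using c by (simp add: q_def)
qed

end

context based_reflection_group
begin

text \<open>
  The image of the pure braid group in the quotient, that is, its abelianization.
\<close>
definition pure_classes :: "(real \<Rightarrow> (complex^'n) set) set set set"
  where "pure_classes = qbraid ` {p. pure_loop p}"

abbreviation "G \<equiv> Q\<lparr>carrier := pure_classes\<rparr>"

lemma one_qbraid: "\<one>\<^bsub>Q\<^esub> = qbraid (\<lambda>t. x)" and const_pure: "pure_loop (\<lambda>t. x)"
proof -
  show l: "pure_loop (\<lambda>t. x)"
    using x W_one by (auto simp: lifts_def path_def path_image_def pathstart_def pathfinish_def)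
  then have "homotopic_loops X (\<lambda>t. x) (\<lambda>t. x)"
    by (auto simp: homotopic_loops_refl lifts_def)
  from free_class_eqI[OF l this] free_class_const[OF x] show "\<one>\<^bsub>Q\<^esub> = qbraid (\<lambda>t. x)" by simp
qed

lemma pure_classes_subgroup: "subgroup pure_classes Q"
proof -
  interpret Q: group Q by (rule group_Q)
  show ?thesis
  proof (rule Q.subgroupI)
    show "pure_classes \<subseteq> carrier Q" by (auto simp: pure_classes_def qbraid_in_carrier)
    show "pure_classes \<noteq> {}" using const_pure by (auto simp: pure_classes_def)
    show "c \<otimes>\<^bsub>Q\<^esub> c' \<in> pure_classes" if cc: "c \<in> pure_classes" "c' \<in> pure_classes" for c c'
    proof -
      obtain p p' where p: "pure_loop p" "pure_loop p'" "c = qbraid p" "c' = qbraid p'"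
        using cc by (auto simp: pure_classes_def)
      have "pure_loop (p +++ p')" using lifts_join[OF p(1,2)] by simp
      then show ?thesis unfolding p(3,4) qbraid_pure_mult[OF p(1,2)] pure_classes_def by blast
    qed
    show "inv\<^bsub>Q\<^esub> c \<in> pure_classes" if cc: "c \<in> pure_classes" for c
    proof -
      obtain p where p: "pure_loop p" "c = qbraid p" using cc by (auto simp: pure_classes_def)
      have r: "pure_loop (reversepath p)" using p(1) by (auto simp: lifts_def)
      have "homotopic_paths X (reversepath p +++ p) (linepath (pathfinish p) (pathfinish p))"
        using p(1) by (intro homotopic_paths_linv) (auto simp: lifts_def)
      moreover have "linepath (pathfinish p) (pathfinish p) = (\<lambda>t. x)"
        using p(1) by (auto simp: lifts_def linepath_def scaleR_left_distrib[symmetric])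
      ultimately have "qbraid (reversepath p +++ p) = qbraid (\<lambda>t. x)"
        using lifts_join[OF r p(1)] by (intro qbraid_cong) auto
      then have "qbraid (reversepath p) \<otimes>\<^bsub>Q\<^esub> c = \<one>\<^bsub>Q\<^esub>"
        unfolding p(2) qbraid_pure_mult[OF r p(1)] one_qbraid .
      then have "inv\<^bsub>Q\<^esub> c = qbraid (reversepath p)"
        using p r by (intro Q.inv_equality) (auto simp: qbraid_in_carrier)
      then show ?thesis using r by (auto simp: pure_classes_def)
    qed
  qed
qed

lemma comm_group_G: "comm_group G"
proof -
  interpret Q: group Q by (rule group_Q)
  have "group G" by (rule subgroup.subgroup_is_group[OF pure_classes_subgroup group_Q])
  then show ?thesis
    by (rule group.group_comm_groupI) (auto simp: pure_classes_def qbraid_pure_commute)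
qed

lemma free_class_pure: "closed_path \<gamma> \<Longrightarrow> free_class \<gamma> \<in> pure_classes"
  by (elim pure_representative) (auto simp: pure_classes_def)

text \<open>
  The class of any small circle around \<open>H\<close>; by the lemma \<open>small_circles_homotopic\<close> they all agree.
\<close>
definition meridian :: "(complex^'n) set \<Rightarrow> (real \<Rightarrow> (complex^'n) set) set set"
  where "meridian H = free_class (case (SOME q. small_circle H (fst q) (snd q)) of (y, a) \<Rightarrow> circ y a)"

lemma meridian_eq:
  assumes "small_circle H y a" shows "meridian H = free_class (circ y a)"
proof -
  define q where "q = (SOME q. small_circle H (fst q) (snd q))"
  have "small_circle H (fst q) (snd q)"
    unfolding q_def by (rule someI[of "\<lambda>q. small_circle H (fst q) (snd q)" "(y, a)"]) (simp add: assms)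
  from free_class_cong[OF small_circles_homotopic[OF this assms]]
  show ?thesis by (simp add: meridian_def q_def[symmetric] case_prod_beta)
qed

lemma closed_path_small_circle: "small_circle H y a \<Longrightarrow> closed_path (circ y a)"
  using closed_path_homotopic(1)[OF small_circles_homotopic] by blast

lemma meridian_in_pure_classes:
  assumes "H \<in> \<A>" shows "meridian H \<in> pure_classes"
proof -
  obtain y b where "small_circle H y b" using small_circle_exists[OF assms x] by blast
  then show ?thesis using meridian_eq closed_path_small_circle free_class_pure by simp
qed

definition meridian_product :: "(complex^'n) set set \<Rightarrow> (real \<Rightarrow> (complex^'n) set) set set"
  where "meridian_product S = finprod G meridian S"

lemma meridian_product_empty: "meridian_product {} = \<one>\<^bsub>Q\<^esub>"
  using comm_monoid.finprod_empty[OF comm_group.axioms(1)[OF comm_group_G]]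
  by (simp add: meridian_product_def)

lemma meridian_product_insert:
  assumes "H \<in> \<A>" "S \<subseteq> \<A>" "H \<notin> S"
  shows "meridian_product (insert H S) = meridian H \<otimes>\<^bsub>Q\<^esub> meridian_product S"
proof -
  interpret G: comm_group G by (rule comm_group_G)
  have "finite S" using assms(2) finite_reflecting_hyperplanes finite_subset by blast
  then have "finprod G meridian (insert H S) = meridian H \<otimes>\<^bsub>G\<^esub> finprod G meridian S"
    using assms meridian_in_pure_classes by (intro G.finprod_insert) auto
  then show ?thesis by (simp add: meridian_product_def)
qed

lemma meridian_product_in_pure_classes:
  assumes "S \<subseteq> \<A>" shows "meridian_product S \<in> pure_classes"
proof -
  interpret G: comm_group G by (rule comm_group_G)
  have "finprod G meridian S \<in> carrier G"
    using assms meridian_in_pure_classes by (intro G.finprod_closed) auto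
  then show ?thesis by (simp add: meridian_product_def)
qed

lemma meridian_product_Un:
  assumes "S \<subseteq> \<A>" "T \<subseteq> \<A>" "S \<inter> T = {}"
  shows "meridian_product (S \<union> T) = meridian_product S \<otimes>\<^bsub>Q\<^esub> meridian_product T"
proof -
  interpret G: comm_group G by (rule comm_group_G)
  have "finite S" "finite T" using assms finite_reflecting_hyperplanes finite_subset by blast+
  then have "finprod G meridian (S \<union> T) = finprod G meridian S \<otimes>\<^bsub>G\<^esub> finprod G meridian T"
    using assms meridian_in_pure_classes by (intro G.finprod_Un_disjoint) auto
  then show ?thesis by (simp add: meridian_product_def)
qed

text \<open>
  The two circles become the outer and the inner detour in the slit annulus around the intersection
  with \<open>H\<close>, and these differ by a loop that is homotopic to a small circle around \<open>H\<close>.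
\<close>
lemma circle_crossing:
  assumes a: "a \<in> X" and H: "H \<in> \<A>" and \<eta>: "0 < \<eta>" "\<eta> < 1"
    and \<sigma>: "line_root v a H \<noteq> 0"
    and gap: "\<forall>K\<in>\<A> - {H}. cmod (line_root v a K) < cmod (line_root v a H) * (1 - \<eta>) \<or>
      cmod (line_root v a H) * (1 + \<eta>) < cmod (line_root v a K)"
  shows "free_class (circ v ((- line_root v a H * of_real (1 + \<eta>)) *s a)) =
    meridian H \<otimes>\<^bsub>Q\<^esub> free_class (circ v ((- line_root v a H * of_real (1 - \<eta>)) *s a))"
proof -
  let ?\<sigma> = "line_root v a H"
  define \<Phi> where "\<Phi> = (\<lambda>w. v + (?\<sigma> * w) *s a)"
  define D where "D = (\<lambda>e t. rcis (1 + e * sin (pi * t)) (- pi * cos (pi * t)))"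
  have cont: "continuous_on S \<Phi>" for S
    unfolding \<Phi>_def vector_scalar_mult_def by (intro continuous_intros)
  have maps: "\<Phi> \<in> slit_annulus \<eta> \<rightarrow> X"
  proof
    fix w assume w: "w \<in> slit_annulus \<eta>"
    have "?\<sigma> * w \<noteq> line_root v a K" if K: "K \<in> \<A>" for K
    proof (cases "K = H")
      case True then show ?thesis using w \<sigma> by (simp add: slit_annulus_def)
    next
      case False
      have "cmod ?\<sigma> * (1 - \<eta>) \<le> cmod ?\<sigma> * cmod w" "cmod ?\<sigma> * cmod w \<le> cmod ?\<sigma> * (1 + \<eta>)"
        using w by (auto simp: slit_annulus_def intro!: mult_left_mono)
      moreover have "K \<in> \<A> - {H}" using K False by simp
      ultimately have "cmod (?\<sigma> * w) \<noteq> cmod (line_root v a K)"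
        using bspec[OF gap, of K] unfolding norm_mult by linarith
      then show ?thesis by metis
    qed
    then show "\<Phi> w \<in> X" unfolding \<Phi>_def on_line_in_complement_iff[OF a] by blast
  qed
  have image: "homotopic_loops X (\<Phi> \<circ> p) (\<Phi> \<circ> q)" if "homotopic_loops (slit_annulus \<eta>) p q" for p q
    by (rule homotopic_loops_continuous_image[OF that cont maps])
  have detour: "homotopic_loops X (circ v ((- ?\<sigma> * of_real (1 + e)) *s a)) (\<Phi> \<circ> D e)"
    if e: "\<bar>e\<bar> \<le> \<eta>" "e \<noteq> 0" for e
  proof -
    have "\<Phi> \<circ> (\<lambda>t. rcis (1 + e) (pi * (2 * t - 1))) = circ v ((- ?\<sigma> * of_real (1 + e)) *s a)"
    proof
      fix t
      have "cis (pi * (2 * t - 1)) = - cis (2 * pi * t)"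
        by (simp add: complex_eq_iff right_diff_distrib cos_diff sin_diff mult.assoc mult.left_commute)
      then show "(\<Phi> \<circ> (\<lambda>t. rcis (1 + e) (pi * (2 * t - 1)))) t = circ v ((- ?\<sigma> * of_real (1 + e)) *s a) t"
        by (simp add: \<Phi>_def circ_def rcis_def vector_smult_assoc mult_ac)
    qed
    with image[OF homotopic_circle_detour[OF e \<eta>(2)]] show ?thesis by (simp add: D_def)
  qed
  have out: "homotopic_loops X (circ v ((- ?\<sigma> * of_real (1 + \<eta>)) *s a)) (\<Phi> \<circ> D \<eta>)"
    using \<eta> by (intro detour) auto
  have "in": "homotopic_loops X (circ v ((- ?\<sigma> * of_real (1 - \<eta>)) *s a)) (\<Phi> \<circ> D (- \<eta>))"
    using detour[of "- \<eta>"] \<eta> by simp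
  have split: "free_class (\<Phi> \<circ> D \<eta>) =
      free_class ((\<Phi> \<circ> D \<eta>) +++ reversepath (\<Phi> \<circ> D (- \<eta>))) \<otimes>\<^bsub>Q\<^esub> free_class (\<Phi> \<circ> D (- \<eta>))"
    by (rule free_class_split[OF closed_path_homotopic(2)[OF out] closed_path_homotopic(2)[OF "in"]])
      (simp add: pathstart_def D_def)
  define c where "c = ?\<sigma> * (of_real (\<eta> / 2) * - \<i>)"
  have "(\<Phi> \<circ> D \<eta>) +++ reversepath (\<Phi> \<circ> D (- \<eta>)) = \<Phi> \<circ> (D \<eta> +++ reversepath (D (- \<eta>)))"
    by (simp add: path_compose_join path_compose_reversepath)
  also have "D \<eta> +++ reversepath (D (- \<eta>)) = (\<lambda>t. rcis (1 + \<eta> * sin (2 * pi * t)) (- pi * cos (2 * pi * t)))"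
    unfolding D_def by (rule detour_difference)
  finally have M: "(\<Phi> \<circ> D \<eta>) +++ reversepath (\<Phi> \<circ> D (- \<eta>)) =
      \<Phi> \<circ> (\<lambda>t. rcis (1 + \<eta> * sin (2 * pi * t)) (- pi * cos (2 * pi * t)))" .
  have "homotopic_loops X ((\<Phi> \<circ> D \<eta>) +++ reversepath (\<Phi> \<circ> D (- \<eta>)))
      (\<Phi> \<circ> (\<lambda>t. 1 + of_real (\<eta> / 2) * (- \<i> * cis (2 * pi * t))))"
    unfolding M by (rule image[OF homotopic_detour_difference_circle[OF \<eta>]])
  moreover have "\<Phi> \<circ> (\<lambda>t. 1 + of_real (\<eta> / 2) * (- \<i> * cis (2 * pi * t))) = circ (v + ?\<sigma> *s a) (c *s a)"
  proof
    fix t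
    have "?\<sigma> * (1 + of_real (\<eta> / 2) * (- \<i> * cis (2 * pi * t))) = ?\<sigma> + cis (2 * pi * t) * c"
      by (simp add: c_def algebra_simps)
    then show "(\<Phi> \<circ> (\<lambda>t. 1 + of_real (\<eta> / 2) * (- \<i> * cis (2 * pi * t)))) t = circ (v + ?\<sigma> *s a) (c *s a) t"
      unfolding \<Phi>_def circ_def o_def by (simp only: vector_sadd_rdistrib vector_smult_assoc add.assoc)
  qed
  moreover have "small_circle H (v + ?\<sigma> *s a) (c *s a)"
  proof (rule small_circle_on_line[OF a H])
    show "c \<noteq> 0" using \<sigma> \<eta> by (simp add: c_def)
    have "cmod c = cmod ?\<sigma> * (\<eta> / 2)" using \<eta> by (simp add: c_def norm_mult)
    moreover have "0 < cmod ?\<sigma> * \<eta>" using \<sigma> \<eta>(1) by (intro mult_pos_pos) auto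
    ultimately have cn: "cmod c < cmod ?\<sigma> * \<eta>" by simp
    show "\<forall>K\<in>\<A> - {H}. cmod c < cmod (?\<sigma> - line_root v a K)"
    proof
      fix K assume "K \<in> \<A> - {H}"
      with gap have "cmod ?\<sigma> * \<eta> < cmod ?\<sigma> - cmod (line_root v a K) \<or> cmod ?\<sigma> * \<eta> < cmod (line_root v a K) - cmod ?\<sigma>"
        by (auto simp: algebra_simps)
      then show "cmod c < cmod (?\<sigma> - line_root v a K)"
        using cn norm_triangle_ineq2[of ?\<sigma> "line_root v a K"] norm_triangle_ineq2[of "line_root v a K" ?\<sigma>]
        by (auto simp: norm_minus_commute)
    qed
  qed
  ultimately have "free_class ((\<Phi> \<circ> D \<eta>) +++ reversepath (\<Phi> \<circ> D (- \<eta>))) = meridian H"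
    using free_class_cong meridian_eq by simp
  then show ?thesis
    using split free_class_cong[OF out] free_class_cong[OF "in"] by simp
qed

text \<open>
  Let the radius shrink to 0. Each hyperplane contributes its meridian when the circle crosses the
  intersection with it, one hyperplane at a time since the moduli are distinct.
\<close>
lemma circle_class:
  assumes a: "a \<in> X" and inj: "inj_on (\<lambda>H. cmod (line_root v a H)) \<A>"
    and nz: "\<forall>H\<in>\<A>. line_root v a H \<noteq> 0"
    and r: "0 < r" "\<forall>H\<in>\<A>. cmod (line_root v a H) \<noteq> r"
  shows "free_class (circ v (of_real r *s a)) = meridian_product {H\<in>\<A>. cmod (line_root v a H) < r}"
  using r
proof (induction "card {H\<in>\<A>. cmod (line_root v a H) < r}" arbitrary: r rule: less_induct)
  case less
  let ?\<rho> = "\<lambda>H. cmod (line_root v a H)"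
  let ?S = "\<lambda>r. {H\<in>\<A>. ?\<rho> H < r}"
  have finS: "finite (?S r)" for r using finite_reflecting_hyperplanes by simp
  show ?case
  proof (cases "?S r = {}")
    case True
    have "homotopic_loops X (circ ((\<lambda>s::real. v) 0) ((\<lambda>s. of_real ((1 - s) * r) *s a) 0))
        (circ ((\<lambda>s. v) (1::real)) ((\<lambda>s. of_real ((1 - s) * r) *s a) 1))"
    proof (rule homotopic_circ)
      show "continuous_on {0..1} (\<lambda>s. of_real ((1 - s) * r) *s a)"
        unfolding vector_scalar_mult_def by (intro continuous_intros)
      fix s :: real and H u assume s: "s \<in> {0..1}" and H: "H \<in> \<A>" and u: "cmod u = 1"
      have fa: "form H a \<noteq> 0" using a H by (simp add: complement_eq_forms)
      have "r < ?\<rho> H" using True H less.prems(2) by fastforce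
      moreover have "(1 - s) * r \<le> r" using s less.prems(1) by (simp add: mult_left_le_one_le)
      ultimately have lt: "(1 - s) * r < ?\<rho> H" by linarith
      show "form H v + u * form H (of_real ((1 - s) * r) *s a) \<noteq> 0"
      proof (rule circle_avoids[OF H _ u])
        have "cmod (form H (of_real ((1 - s) * r) *s a)) = ((1 - s) * r) * cmod (form H a)"
          unfolding form_scale[OF H] norm_mult norm_of_real using s less.prems(1) by simp
        also have "\<dots> < ?\<rho> H * cmod (form H a)" using lt fa by simp
        also have "\<dots> = cmod (form H v)" using fa by (simp add: line_root_def norm_divide)
        finally show "cmod (form H (of_real ((1 - s) * r) *s a)) \<noteq> cmod (form H v)" by simp
      qed
    qed simp
    then have "homotopic_loops X (circ v (of_real r *s a)) (circ v 0)" by simp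
    moreover have "circ v 0 = (\<lambda>t. v)" by (rule ext) (simp add: circ_def)
    moreover have "v \<in> X"
      using on_line_in_complement_iff[OF a, of v 0] nz by auto
    ultimately have "free_class (circ v (of_real r *s a)) = \<one>\<^bsub>Q\<^esub>"
      using free_class_cong free_class_const by simp
    then show ?thesis unfolding True meridian_product_empty .
  next
    case False
    have "Max (?\<rho> ` ?S r) \<in> ?\<rho> ` ?S r" using finS False by (intro Max_in) auto
    then obtain H where H1: "H \<in> ?S r" "Max (?\<rho> ` ?S r) = ?\<rho> H" by (rule imageE)
    have "\<forall>K\<in>?S r. ?\<rho> K \<le> ?\<rho> H"
      unfolding H1(2)[symmetric] using finS by (intro ballI Max_ge) auto
    note H = H1(1) this
    have HA: "H \<in> \<A>" "?\<rho> H < r" using H(1) by auto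
    have pos: "0 < ?\<rho> H" using nz HA(1) by simp
    \<comment> \<open>the gap keeps the annulus inside the circle of radius \<open>r\<close> and clear of the other hyperplanes\<close>
    define gapf where "gapf = (\<lambda>K. if K = H then r / ?\<rho> H - 1 else \<bar>?\<rho> K / ?\<rho> H - 1\<bar>)"
    have "0 < gapf K" if "K \<in> \<A>" for K
    proof (cases "K = H")
      case True then show ?thesis using HA pos by (simp add: gapf_def)
    next
      case False
      then have "?\<rho> K \<noteq> ?\<rho> H" using inj that HA(1) by (auto simp: inj_on_def)
      then show ?thesis using pos False by (simp add: gapf_def)
    qed
    then obtain \<eta> where \<eta>: "0 < \<eta>" "\<eta> < 1" "\<forall>K\<in>\<A>. \<eta> < gapf K"
      using finite_pos_lower_bound[OF finite_reflecting_hyperplanes, of gapf] by auto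
    have r2: "?\<rho> H * (1 + \<eta>) < r"
      using bspec[OF \<eta>(3) HA(1)] pos by (simp add: gapf_def field_simps)
    have gap: "\<forall>K\<in>\<A> - {H}. ?\<rho> K < ?\<rho> H * (1 - \<eta>) \<or> ?\<rho> H * (1 + \<eta>) < ?\<rho> K"
    proof
      fix K assume K: "K \<in> \<A> - {H}"
      then have "\<eta> < \<bar>?\<rho> K / ?\<rho> H - 1\<bar>" using bspec[OF \<eta>(3), of K] by (simp add: gapf_def)
      then have "?\<rho> K / ?\<rho> H < 1 - \<eta> \<or> 1 + \<eta> < ?\<rho> K / ?\<rho> H" by linarith
      then show "?\<rho> K < ?\<rho> H * (1 - \<eta>) \<or> ?\<rho> H * (1 + \<eta>) < ?\<rho> K"
        using pos by (simp add: pos_divide_less_eq pos_less_divide_eq mult.commute)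
    qed
    let ?r1 = "?\<rho> H * (1 - \<eta>)"
    have r1: "0 < ?r1" using pos \<eta> by simp
    have le: "?r1 < ?\<rho> H" "?\<rho> H < ?\<rho> H * (1 + \<eta>)" using pos \<eta> by (simp_all add: algebra_simps)
    have outer: "homotopic_loops X (circ v (of_real r *s a)) (circ v ((- line_root v a H * of_real (1 + \<eta>)) *s a))"
    proof (rule homotopic_circles_on_line[OF a])
      show "of_real r \<noteq> (0::complex)" using less.prems(1) by simp
      show "- line_root v a H * of_real (1 + \<eta>) \<noteq> 0" using pos \<eta> by (simp del: of_real_add)
      have n: "cmod (- line_root v a H * of_real (1 + \<eta>)) = ?\<rho> H * (1 + \<eta>)"
        using \<eta> unfolding norm_mult norm_minus_cancel norm_of_real by simp
      have n': "cmod (of_real r) = r" using less.prems(1) by simp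
      show "\<forall>K\<in>\<A>. ?\<rho> K < min (cmod (of_real r)) (cmod (- line_root v a H * of_real (1 + \<eta>))) \<or>
          max (cmod (of_real r)) (cmod (- line_root v a H * of_real (1 + \<eta>))) < ?\<rho> K"
        unfolding n n'
      proof
        fix K assume K: "K \<in> \<A>"
        show "?\<rho> K < min r (?\<rho> H * (1 + \<eta>)) \<or> max r (?\<rho> H * (1 + \<eta>)) < ?\<rho> K"
        proof (cases "?\<rho> K < r")
          case True
          then have "?\<rho> K \<le> ?\<rho> H" using H(2) K by blast
          then show ?thesis using le r2 by auto
        next
          case False
          then show ?thesis using less.prems(2) K r2 by fastforce
        qed
      qed
    qed
    have r1K: "\<forall>K\<in>\<A>. ?\<rho> K \<noteq> ?r1"
    proof
      fix K assume "K \<in> \<A>"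
      then show "?\<rho> K \<noteq> ?r1" using gap le by (cases "K = H") force+
    qed
    have inner: "homotopic_loops X (circ v ((- line_root v a H * of_real (1 - \<eta>)) *s a)) (circ v (of_real ?r1 *s a))"
    proof (rule homotopic_circles_on_line[OF a])
      show "of_real ?r1 \<noteq> (0::complex)" unfolding of_real_eq_0_iff using r1 by linarith
      show "- line_root v a H * of_real (1 - \<eta>) \<noteq> 0" using pos \<eta> by (simp del: of_real_diff)
      have n: "cmod (- line_root v a H * of_real (1 - \<eta>)) = ?r1"
        using \<eta> unfolding norm_mult norm_minus_cancel norm_of_real by simp
      have n': "cmod (of_real ?r1) = ?r1" using r1 by (simp only: norm_of_real abs_of_pos)
      show "\<forall>K\<in>\<A>. ?\<rho> K < min (cmod (- line_root v a H * of_real (1 - \<eta>))) (cmod (of_real ?r1)) \<or>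
          max (cmod (- line_root v a H * of_real (1 - \<eta>))) (cmod (of_real ?r1)) < ?\<rho> K"
        unfolding n n' min.idem max.idem using r1K by (simp add: neq_iff)
    qed
    have S: "?S r = insert H (?S ?r1)" "H \<notin> ?S ?r1"
    proof -
      have "K \<in> ?S ?r1" if K: "K \<in> ?S r" "K \<noteq> H" for K
      proof -
        have "K \<in> \<A> - {H}" "?\<rho> K \<le> ?\<rho> H" using H(2) K by auto
        with gap le(2) show ?thesis by force
      qed
      moreover have "K \<in> ?S r" if "K \<in> ?S ?r1" for K using that le HA(2) by auto
      ultimately show "?S r = insert H (?S ?r1)" using H(1) by blast
      show "H \<notin> ?S ?r1" using le by simp
    qed
    have "card (?S ?r1) < card (?S r)" unfolding S(1) using S(2) finS by simp
    from less.hyps[OF this r1 r1K]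
    have IH: "free_class (circ v (of_real ?r1 *s a)) = meridian_product (?S ?r1)" .
    have "free_class (circ v (of_real r *s a)) = meridian H \<otimes>\<^bsub>Q\<^esub> meridian_product (?S ?r1)"
      unfolding free_class_cong[OF outer] circle_crossing[OF a HA(1) \<eta>(1,2) nz[rule_format, OF HA(1)] gap]
        free_class_cong[OF inner] IH ..
    also have "\<dots> = meridian_product (?S r)"
      unfolding S(1) using meridian_product_insert[of H "?S ?r1"] HA(1) S(2) by auto
    finally show ?thesis .
  qed
qed

text \<open>
  The loop \<open>circ 0 a\<close> is the full twist. Up to homotopy it is a circle of large radius on a generic line
  in the direction \<open>a\<close>, for at large radius the displacement \<open>v\<close> of the line is negligible.
\<close>
theorem full_twist_eq_meridian_product:
  assumes a: "a \<in> X" shows "free_class (circ 0 a) = meridian_product \<A>"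
proof -
  obtain v where v: "inj_on (\<lambda>H. cmod (line_root v a H)) \<A>" "\<forall>H\<in>\<A>. line_root v a H \<noteq> 0"
    by (rule ex_generic_line[OF a])
  \<comment> \<open>larger than all the moduli, and at least 1 so that the radius can be reduced to 1 afterwards\<close>
  define R where "R = 1 + (\<Sum>H\<in>\<A>. cmod (line_root v a H))"
  have R1: "1 \<le> R" by (simp add: R_def sum_nonneg)
  have R: "cmod (line_root v a H) < R" if "H \<in> \<A>" for H
    using member_le_sum[OF that, of "\<lambda>H. cmod (line_root v a H)"] finite_reflecting_hyperplanes
    by (simp add: R_def)
  have "homotopic_loops X (circ ((\<lambda>s. of_real (1 - s) *s v) 0) ((\<lambda>s. of_real R *s a) 0))
      (circ ((\<lambda>s. of_real (1 - s) *s v) 1) ((\<lambda>s. of_real R *s a) (1::real)))"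
  proof (rule homotopic_circ)
    show "continuous_on {0..1} (\<lambda>s. of_real (1 - s) *s v)"
      unfolding vector_scalar_mult_def by (intro continuous_intros)
    fix s :: real and H u assume s: "s \<in> {0..1}" and H: "H \<in> \<A>" and u: "cmod u = 1"
    have fa: "form H a \<noteq> 0" using a H by (simp add: complement_eq_forms)
    show "form H (of_real (1 - s) *s v) + u * form H (of_real R *s a) \<noteq> 0"
    proof (rule circle_avoids[OF H _ u])
      have "cmod (form H (of_real (1 - s) *s v)) = (1 - s) * cmod (form H v)"
        unfolding form_scale[OF H] norm_mult norm_of_real using s by simp
      also have "\<dots> \<le> cmod (form H v)" using s by (simp add: mult_left_le_one_le)
      also have "\<dots> = cmod (line_root v a H) * cmod (form H a)"
        using fa by (simp add: line_root_def norm_divide)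
      also have "\<dots> < R * cmod (form H a)" using R[OF H] fa by simp
      also have "\<dots> = cmod (form H (of_real R *s a))" using R1 by (simp add: form_scale[OF H] norm_mult)
      finally show "cmod (form H (of_real R *s a)) \<noteq> cmod (form H (of_real (1 - s) *s v))" by simp
    qed
  qed simp
  then have "homotopic_loops X (circ v (of_real R *s a)) (circ 0 (of_real R *s a))" by simp
  moreover have "homotopic_loops X (circ 0 (of_real R *s a)) (circ 0 (1 *s a))"
  proof (rule homotopic_circles_on_line[OF a])
    show "of_real R \<noteq> (0::complex)" using R1 by simp
    have "line_root 0 a H = 0" if "H \<in> \<A>" for H
      using form_scale[OF that, of 0 0] by (simp add: line_root_def)
    then show "\<forall>H\<in>\<A>. cmod (line_root 0 a H) < min (cmod (of_real R)) (cmod 1) \<or>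
        max (cmod (of_real R)) (cmod 1) < cmod (line_root 0 a H)" using R1 by simp
  qed simp
  ultimately have "free_class (circ 0 a) = free_class (circ v (of_real R *s a))"
    using free_class_cong by simp
  also have "\<dots> = meridian_product {H\<in>\<A>. cmod (line_root v a H) < R}"
    using R R1 by (intro circle_class[OF a v]) force+
  also have "{H\<in>\<A>. cmod (line_root v a H) < R} = \<A>" using R by auto
  finally show ?thesis .
qed

lemma qbraid_meridian:
  assumes q: "lifts g q" and H: "H \<in> \<A>"
  shows "qbraid q \<otimes>\<^bsub>Q\<^esub> meridian H = meridian ((*v) g ` H) \<otimes>\<^bsub>Q\<^esub> qbraid q"
proof -
  obtain y b where sc: "small_circle H y b" using small_circle_exists[OF H x] by blast
  have g: "g \<in> W" using q by (simp add: lifts_def)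
  have "act g (circ y b) = circ (g *v y) (g *v b)"
    by (auto simp: circ_def matrix_vector_right_distrib vec.scale)
  then show ?thesis
    using qbraid_free_class[OF q closed_path_small_circle[OF sc]] meridian_eq[OF sc]
      meridian_eq[OF small_circle_act[OF sc g]] by simp
qed

end

section \<open>An element of finite order\<close>

lemma GL_pow_Suc: "g [^]\<^bsub>GL\<^esub> Suc j = g [^]\<^bsub>GL\<^esub> j ** g" for g :: "complex^'n^'n"
  by (simp add: nat_pow_def)

lemma GL_pow_0: "g [^]\<^bsub>GL\<^esub> (0::nat) = mat 1" for g :: "complex^'n^'n"
  by (simp add: nat_pow_def)

lemma GL_pow_eigenvector:
  fixes g :: "complex^'n^'n"
  assumes "g *v y = c *s y" shows "(g [^]\<^bsub>GL\<^esub> (j::nat)) *v y = c ^ j *s y"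
proof (induction j)
  case (Suc j)
  have "(g [^]\<^bsub>GL\<^esub> Suc j) *v y = (g [^]\<^bsub>GL\<^esub> j) *v (g *v y)"
    by (simp only: GL_pow_Suc matrix_vector_mul_assoc)
  also have "\<dots> = c *s ((g [^]\<^bsub>GL\<^esub> j) *v y)" by (simp add: assms vec.scale)
  finally show ?case by (simp add: Suc)
qed (simp add: GL_pow_0)

lemma GL_pow_add:
  fixes g :: "complex^'n^'n"
  shows "g [^]\<^bsub>GL\<^esub> (i + j :: nat) = g [^]\<^bsub>GL\<^esub> i ** g [^]\<^bsub>GL\<^esub> j"
  by (induction j) (simp_all only: GL_pow_Suc GL_pow_0 add_Suc_right add_0_right matrix_mul_rid matrix_mul_assoc)

text \<open>
  The powers of \<open>\<zeta>\<close> are \<open>d\<close> distinct roots of unity, hence all of them.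
\<close>
lemma root_of_unity_power_generates:
  assumes "root_of_unity_order \<zeta> d"
  shows "\<exists>m. \<zeta> ^ m = cis (2 * pi / d)"
proof -
  have d: "0 < d" "\<zeta> ^ d = 1" "\<And>k. 0 < k \<Longrightarrow> k < d \<Longrightarrow> \<zeta> ^ k \<noteq> 1"
    using assms by (auto simp: root_of_unity_order_def)
  have "\<zeta> \<noteq> 0" using d(1,2) by (auto simp: power_0_left)
  have less: False if "i < j" "j < d" "\<zeta> ^ i = \<zeta> ^ j" for i j
  proof -
    have "\<zeta> ^ j = \<zeta> ^ i * \<zeta> ^ (j - i)" using that(1) by (simp flip: power_add)
    then have "\<zeta> ^ (j - i) = 1" using that(3) \<open>\<zeta> \<noteq> 0\<close> by simp
    then show False using d(3)[of "j - i"] that by simp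
  qed
  have "inj_on (\<lambda>j. \<zeta> ^ j) {..<d}"
    by (rule inj_onI) (metis less lessThan_iff linorder_neqE_nat)
  then have "card ((\<lambda>j. \<zeta> ^ j) ` {..<d}) = d" by (simp add: card_image)
  moreover have "(\<lambda>j. \<zeta> ^ j) ` {..<d} \<subseteq> {z. z ^ d = 1}"
  proof (rule image_subsetI)
    fix j
    have "(\<zeta> ^ j) ^ d = (\<zeta> ^ d) ^ j" by (simp only: power_mult[symmetric] mult.commute)
    then show "\<zeta> ^ j \<in> {z. z ^ d = 1}" by (simp add: d(2))
  qed
  moreover have "finite {z::complex. z ^ d = 1}" "card {z::complex. z ^ d = 1} = d"
    using d(1) card_roots_unity_eq finite_roots_unity[of d] by auto
  ultimately have "(\<lambda>j. \<zeta> ^ j) ` {..<d} = {z. z ^ d = 1}" by (intro card_subset_eq) auto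
  moreover have "cis (2 * pi / d) ^ d = 1" using d(1) by (simp add: Complex.DeMoivre)
  ultimately show ?thesis by (metis (mono_tags, lifting) imageE mem_Collect_eq)
qed

text \<open>
  The path \<open>q\<close> is traversed backwards and forwards in the middle.
\<close>
lemma homotopic_paths_cancel_middle:
  fixes p :: "real \<Rightarrow> 'a::real_normed_vector"
  assumes "path p" "path_image p \<subseteq> S" "path q" "path_image q \<subseteq> S"
    and "path B" "path_image B \<subseteq> S" "path r" "path_image r \<subseteq> S"
    and AB: "homotopic_paths S (A +++ B) C"
    and "path A" "path_image A \<subseteq> S" "pathfinish p = pathstart A" "pathfinish A = pathfinish q"
    and "pathfinish q = pathstart B" "pathfinish B = pathstart r"
  shows "homotopic_paths S (((p +++ A) +++ reversepath q) +++ ((q +++ B) +++ r)) ((p +++ C) +++ r)"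
proof -
  note [simp] = assms path_image_join
  have 1: "homotopic_paths S (((p +++ A) +++ reversepath q) +++ ((q +++ B) +++ r))
      ((((p +++ A) +++ reversepath q) +++ (q +++ B)) +++ r)"
    by (intro homotopic_paths_assoc) simp_all
  have "homotopic_paths S (((p +++ A) +++ reversepath q) +++ (q +++ B))
      ((((p +++ A) +++ reversepath q) +++ q) +++ B)"
    by (intro homotopic_paths_assoc) simp_all
  also have "homotopic_paths S \<dots> ((p +++ A) +++ B)"
    by (intro homotopic_paths_join homotopic_paths_append_back) simp_all
  also have "homotopic_paths S ((p +++ A) +++ B) (p +++ (A +++ B))"
    by (rule homotopic_paths_sym, intro homotopic_paths_assoc) simp_all
  also have "homotopic_paths S (p +++ (A +++ B)) (p +++ C)"
    by (rule homotopic_paths_join[OF _ AB]) simp_all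
  finally have 2: "homotopic_paths S (((p +++ A) +++ reversepath q) +++ (q +++ B)) (p +++ C)" .
  have "homotopic_paths S ((((p +++ A) +++ reversepath q) +++ (q +++ B)) +++ r) ((p +++ C) +++ r)"
    by (rule homotopic_paths_join[OF 2]) simp_all
  with 1 show ?thesis by (rule homotopic_paths_trans)
qed

context reflection_group
begin

lemma W_pow: "g \<in> W \<Longrightarrow> g [^]\<^bsub>GL\<^esub> (j::nat) \<in> W"
  by (induction j) (simp_all only: GL_pow_0 GL_pow_Suc W_one W_mult)

end

text \<open>
  The situation of the theorem after replacing the regular element by a power \<open>g\<close> whose eigenvalue is
  the standard primitive root of unity of order \<open>d\<close>; \<open>e\<close> is the eigenvector. The last assumption
  expresses the free action on the hyperplanes in terms of powers of \<open>g\<close>.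
\<close>
locale free_rotation = based_reflection_group W x for W :: "(complex^'n^'n) set" and x +
  fixes g :: "complex^'n^'n" and d :: nat and e :: "complex^'n"
  assumes g: "g \<in> W" and d: "0 < d" and e: "e \<in> hyperplane_complement W"
    and ge: "g *v e = cis (2 * pi / d) *s e" and e_nonzero: "e \<noteq> 0"
    and free: "\<And>j H. H \<in> reflecting_hyperplanes W \<Longrightarrow> (*v) (g [^]\<^bsub>GL\<^esub> (j::nat)) ` H = H \<Longrightarrow> g [^]\<^bsub>GL\<^esub> j = mat 1"
begin

abbreviation gpow :: "nat \<Rightarrow> complex^'n^'n" where "gpow j \<equiv> g [^]\<^bsub>GL\<^esub> j"

lemma gpow_e: "gpow j *v e = cis (2 * pi * j / d) *s e"
  using GL_pow_eigenvector[OF ge, of j] by (simp add: Complex.DeMoivre mult.commute)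

lemma gpow_d: "gpow d = mat 1"
proof (rule steinberg[OF W_pow[OF g] _ e])
  show "gpow d *v e = e" using gpow_e[of d] d by simp
qed

lemma gpow_neq_one: assumes "0 < j" "j < d" shows "gpow j \<noteq> mat 1"
proof
  assume "gpow j = mat 1"
  then have "cis (2 * pi * j / d) *s e = 1 *s e" using gpow_e[of j] by simp
  then have "cis (2 * pi * j / d) = 1" using e_nonzero vec.scale_right_imp_eq by blast
  then have "cos (2 * pi * j / d) = 1" by (simp add: complex_eq_iff)
  then obtain n :: int where n: "2 * pi * j / d = real_of_int n * 2 * pi" unfolding cos_one_2pi_int by blast
  then have "real j = real_of_int n * real d" using d by (simp add: field_simps)
  then have "int j = n * int d" by (metis of_int_eq_iff of_int_mult of_int_of_nat_eq)
  then have "int d dvd int j" by simp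
  then show False using assms by (simp add: dvd_imp_le nat_dvd_not_less)
qed

definition rot :: "nat \<Rightarrow> (complex^'n) set \<Rightarrow> (complex^'n) set"
  where "rot j H = (*v) (gpow j) ` H"

lemma rot_rot: "rot i (rot j H) = rot (i + j) H"
  by (simp add: rot_def image_image GL_pow_add matrix_vector_mul_assoc)

lemma rot_mult_d: "rot (d * n) H = H"
proof (induction n)
  case 0 show ?case by (simp add: rot_def GL_pow_0)
next
  case (Suc n)
  have "rot (d * Suc n) H = rot d (rot (d * n) H)" by (simp add: rot_rot)
  then show ?case by (simp add: Suc) (simp add: rot_def gpow_d)
qed

lemma rot_hyperplane: "H \<in> \<A> \<Longrightarrow> rot j H \<in> \<A>"
  unfolding rot_def by (rule reflecting_hyperplane_image[OF _ W_pow[OF g]])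

lemma rot_free: "H \<in> \<A> \<Longrightarrow> rot j H = H \<Longrightarrow> j < d \<Longrightarrow> j = 0"
  using free gpow_neq_one unfolding rot_def by blast

definition rot_orbit :: "(complex^'n) set \<Rightarrow> (complex^'n) set set"
  where "rot_orbit H = range (\<lambda>n. rot n H)"

lemma rot_orbit_eq: assumes "K \<in> rot_orbit H" shows "rot_orbit K = rot_orbit H"
proof -
  obtain m where m: "K = rot m H" using assms by (auto simp: rot_orbit_def)
  have "H = rot (d * m - m) K"
  proof -
    have "d * m - m + m = d * m" using d by simp
    then have "rot (d * m - m) K = rot (d * m) H" unfolding m rot_rot by simp
    then show ?thesis by (simp add: rot_mult_d)
  qed
  then have "rot n H \<in> rot_orbit K" for n using rot_rot[of n "d * m - m" K] by (auto simp: rot_orbit_def)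
  moreover have "rot n K \<in> rot_orbit H" for n unfolding m rot_rot by (simp add: rot_orbit_def)
  ultimately show ?thesis by (auto simp: rot_orbit_def)
qed

text \<open>
  A set of representatives of the orbits of hyperplanes under the powers of \<open>g\<close>. As the action is
  free, each hyperplane is \<open>rot j H\<close> for exactly one \<open>j < d\<close> and one representative \<open>H\<close>.
\<close>
definition reps :: "(complex^'n) set set"
  where "reps = (\<lambda>O'. SOME H. H \<in> O') ` (rot_orbit ` \<A>)"

lemma self_in_rot_orbit: "H \<in> rot_orbit H"
  unfolding rot_orbit_def using rot_mult_d[of 0 H] by (metis mult_0_right rangeI)

lemma rep_in_rot_orbit: "(SOME K. K \<in> rot_orbit H) \<in> rot_orbit H"
  by (rule someI[of "\<lambda>K. K \<in> rot_orbit H" H]) (rule self_in_rot_orbit)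

lemma reps_subset: "reps \<subseteq> \<A>"
proof
  fix K assume "K \<in> reps"
  then obtain H where "H \<in> \<A>" "K \<in> rot_orbit H" using rep_in_rot_orbit by (auto simp: reps_def)
  then show "K \<in> \<A>" using rot_hyperplane by (auto simp: rot_orbit_def)
qed

lemma reps_unique: assumes "H \<in> reps" "K \<in> reps" "K \<in> rot_orbit H" shows "K = H"
proof -
  have rep: "L = (SOME M. M \<in> rot_orbit L)" if L: "L \<in> reps" for L
  proof -
    obtain L0 where "L = (SOME M. M \<in> rot_orbit L0)" using L by (auto simp: reps_def)
    moreover from this have "rot_orbit L = rot_orbit L0" using rot_orbit_eq rep_in_rot_orbit by metis
    ultimately show ?thesis by simp
  qed
  show ?thesis using rep[OF assms(1)] rep[OF assms(2)] rot_orbit_eq[OF assms(3)] by metis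
qed

definition rotated_reps :: "nat \<Rightarrow> (complex^'n) set set"
  where "rotated_reps j = (\<Union>i<j. rot i ` reps)"

lemma rotated_reps_subset: "rotated_reps j \<subseteq> \<A>"
  using reps_subset rot_hyperplane by (auto simp: rotated_reps_def)

lemma rotated_reps_disjoint:
  assumes "j < d" shows "rot j ` reps \<inter> rotated_reps j = {}"
proof (rule ccontr)
  assume "rot j ` reps \<inter> rotated_reps j \<noteq> {}"
  then obtain i H K where HK: "i < j" "H \<in> reps" "K \<in> reps" "rot j H = rot i K"
    by (auto simp: rotated_reps_def)
  have "K = rot (d - i) (rot i K)" using rot_rot[of "d - i" i K] rot_mult_d[of 1 K] HK(1) assms by simp
  also have "\<dots> = rot (d - i + j) H" by (simp only: HK(4)[symmetric] rot_rot)
  also have "d - i + j = (j - i) + d * 1" using HK(1) assms by simp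
  also have "rot \<dots> H = rot (j - i) H" by (simp only: rot_rot[symmetric] rot_mult_d)
  finally have K: "K = rot (j - i) H" .
  then have "K = H" using reps_unique[OF HK(2,3)] by (simp add: rot_orbit_def)
  then have "j - i = 0" using rot_free[of H "j - i"] K HK(2) reps_subset assms by auto
  then show False using HK(1) by simp
qed

lemma rotated_reps_all: "rotated_reps d = \<A>"
proof (intro equalityI subsetI)
  fix H assume H: "H \<in> \<A>"
  define K where "K = (SOME K. K \<in> rot_orbit H)"
  have K: "K \<in> reps" "K \<in> rot_orbit H" using H rep_in_rot_orbit by (auto simp: K_def reps_def)
  have "H \<in> rot_orbit K" using rot_orbit_eq[OF K(2)] self_in_rot_orbit by simp
  then obtain n where "H = rot n K" by (auto simp: rot_orbit_def)
  also have "n = n mod d + d * (n div d)" by simp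
  also have "rot \<dots> K = rot (n mod d) K" by (simp only: rot_rot[symmetric] rot_mult_d)
  finally show "H \<in> rotated_reps d" using K(1) d by (auto simp: rotated_reps_def)
qed (use rotated_reps_subset in auto)

text \<open>
  The arc from \<open>e\<close> to \<open>g\<^sup>j e\<close> obtained by turning \<open>e\<close> through \<open>j\<close> times the angle of the
  eigenvalue; for \<open>j = d\<close> it closes to the full twist.
\<close>
definition rotation_arc :: "nat \<Rightarrow> real \<Rightarrow> complex^'n"
  where "rotation_arc j = (\<lambda>\<theta>. cis \<theta> *s e) \<circ> linepath 0 (2 * pi * j / d)"

lemma cis_e: "cis \<theta> *s e \<in> X"
  using e by (simp add: complement_eq_forms form_scale)

lemma continuous_on_cis_e: "continuous_on S (\<lambda>\<theta>. cis \<theta> *s e)"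
  unfolding vector_scalar_mult_def by (intro continuous_intros)

lemma rotation_arc_path: "path (rotation_arc j)" "path_image (rotation_arc j) \<subseteq> X" "pathstart (rotation_arc j) = e" "pathfinish (rotation_arc j) = gpow j *v e"
  unfolding rotation_arc_def using cis_e
  by (auto simp: path_image_compose pathstart_compose pathfinish_compose gpow_e
      intro!: path_continuous_image continuous_on_cis_e)

lemma rotation_arc_append: "homotopic_paths X (rotation_arc j +++ act (gpow j) (rotation_arc 1)) (rotation_arc (Suc j))"
proof -
  let ?\<theta> = "\<lambda>j::nat. 2 * pi * j / d"
  have "homotopic_paths UNIV (linepath 0 (?\<theta> j) +++ linepath (?\<theta> j) (?\<theta> (Suc j))) (linepath 0 (?\<theta> (Suc j)))"
  proof -
    have "simply_connected (UNIV :: real set)" by (rule convex_imp_simply_connected) simp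
    then show ?thesis unfolding simply_connected_eq_homotopic_paths by simp
  qed
  then have "homotopic_paths X ((\<lambda>\<theta>. cis \<theta> *s e) \<circ> (linepath 0 (?\<theta> j) +++ linepath (?\<theta> j) (?\<theta> (Suc j)))) (rotation_arc (Suc j))"
    unfolding rotation_arc_def by (rule homotopic_paths_continuous_image[OF _ continuous_on_cis_e]) (use cis_e in auto)
  moreover have "(\<lambda>\<theta>. cis \<theta> *s e) \<circ> linepath (?\<theta> j) (?\<theta> (Suc j)) = act (gpow j) (rotation_arc 1)"
  proof
    fix t
    have "linepath (?\<theta> j) (?\<theta> (Suc j)) t = linepath 0 (?\<theta> 1) t + ?\<theta> j"
      using d by (simp add: linepath_def field_simps)
    then show "((\<lambda>\<theta>. cis \<theta> *s e) \<circ> linepath (?\<theta> j) (?\<theta> (Suc j))) t = gpow j *v rotation_arc 1 t"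
      by (simp add: rotation_arc_def vec.scale gpow_e vector_smult_assoc flip: cis_mult)
  qed
  ultimately show ?thesis by (simp add: path_compose_join rotation_arc_def)
qed

lemma rotation_arc_full: "rotation_arc d = circ 0 e"
  using d by (auto simp: rotation_arc_def circ_def linepath_def mult_ac)

definition approach :: "real \<Rightarrow> complex^'n"
  where "approach = (SOME p. path p \<and> path_image p \<subseteq> X \<and> pathstart p = x \<and> pathfinish p = e)"

lemma approach: "path approach" "path_image approach \<subseteq> X" "pathstart approach = x" "pathfinish approach = e"
proof -
  have "\<exists>p. path p \<and> path_image p \<subseteq> X \<and> pathstart p = x \<and> pathfinish p = e"
    using path_connected_complement x e unfolding path_connected_def by blast
  from someI_ex[OF this, folded approach_def]
  show "path approach" "path_image approach \<subseteq> X" "pathstart approach = x" "pathfinish approach = e" by auto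
qed

text \<open>
  The arc, moved to the base point \<open>x\<close> by means of a path from \<open>x\<close> to \<open>e\<close>. At its end the path has
  to be moved by \<open>g\<^sup>j\<close> in order to lead to \<open>g\<^sup>j x\<close>.
\<close>
definition rotation_path :: "nat \<Rightarrow> real \<Rightarrow> complex^'n"
  where "rotation_path j = (approach +++ rotation_arc j) +++ reversepath (act (gpow j) approach)"

lemma act_approach: "path (act (gpow j) approach)" "path_image (act (gpow j) approach) \<subseteq> X"
  using approach path_image_act[OF W_pow[OF g]] by auto

lemma lifts_rotation_path: "lifts (gpow j) (rotation_path j)"
  using approach rotation_arc_path[of j] act_approach[of j] W_pow[OF g]
  by (auto simp: lifts_def rotation_path_def path_image_join)

lemma rotation_path_append:
  "homotopic_paths X (rotation_path j +++ act (gpow j) (rotation_path 1)) (rotation_path (Suc j))"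
proof -
  have "act (gpow j) (rotation_path 1) =
      (act (gpow j) approach +++ act (gpow j) (rotation_arc 1)) +++ reversepath (act (gpow (Suc j)) approach)"
    by (simp add: rotation_path_def act_join act_reversepath matrix_vector_mul_assoc GL_pow_Suc GL_pow_0)
  moreover have "homotopic_paths X
    (((approach +++ rotation_arc j) +++ reversepath (act (gpow j) approach)) +++
      ((act (gpow j) approach +++ act (gpow j) (rotation_arc 1)) +++ reversepath (act (gpow (Suc j)) approach)))
    ((approach +++ rotation_arc (Suc j)) +++ reversepath (act (gpow (Suc j)) approach))"
  proof (rule homotopic_paths_cancel_middle[OF _ _ _ _ _ _ _ _ rotation_arc_append])
    show "path (act (gpow j) (rotation_arc 1))" by (rule path_act[OF rotation_arc_path(1)])
    show "path_image (act (gpow j) (rotation_arc 1)) \<subseteq> X"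
      by (rule path_image_act[OF W_pow[OF g] rotation_arc_path(2)])
    show "path (reversepath (act (gpow (Suc j)) approach))"
      "path_image (reversepath (act (gpow (Suc j)) approach)) \<subseteq> X"
      unfolding path_image_reversepath path_reversepath by (rule act_approach)+
    show "pathfinish (act (gpow j) (rotation_arc 1)) = pathstart (reversepath (act (gpow (Suc j)) approach))"
      by (simp only: pathstart_reversepath pathfinish_act approach(4) rotation_arc_path
          matrix_vector_mul_assoc One_nat_def GL_pow_Suc GL_pow_0 matrix_mul_lid)
  qed (use approach rotation_arc_path act_approach in simp_all)
  ultimately show ?thesis by (simp only: rotation_path_def)
qed

definition rotation_braid :: "(real \<Rightarrow> (complex^'n) set) set set"
  where "rotation_braid = qbraid (rotation_path 1)"

lemma rotation_braid_in_carrier: "rotation_braid \<in> carrier Q"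
  unfolding rotation_braid_def by (rule qbraid_in_carrier[OF lifts_rotation_path])

lemma closed_rotation_path:
  assumes "gpow j = mat 1"
  shows "pure_loop (rotation_path j)" "qbraid (rotation_path j) = free_class (rotation_arc j)"
proof -
  show l: "pure_loop (rotation_path j)" using lifts_rotation_path[of j] assms by simp
  have closed: "pathfinish (rotation_arc j) = e" using rotation_arc_path(4)[of j] assms by simp
  have "homotopic_paths X (approach +++ rotation_arc j +++ reversepath approach) ((approach +++ rotation_arc j) +++ reversepath approach)"
    using approach rotation_arc_path[of j] closed by (intro homotopic_paths_assoc) auto
  then have "homotopic_paths X (approach +++ rotation_arc j +++ reversepath approach) (rotation_path j)"
    by (simp add: rotation_path_def assms)
  then have "homotopic_loops X (approach +++ rotation_arc j +++ reversepath approach) (rotation_path j)"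
    using approach l by (intro homotopic_paths_imp_homotopic_loops) (auto simp: lifts_def)
  moreover have "homotopic_loops X (approach +++ rotation_arc j +++ reversepath approach) (rotation_arc j)"
    using approach rotation_arc_path[of j] closed by (intro homotopic_loops_conjugate) auto
  ultimately have "homotopic_loops X (rotation_arc j) (rotation_path j)"
    using homotopic_loops_sym homotopic_loops_trans by blast
  from free_class_eqI[OF l this] show "qbraid (rotation_path j) = free_class (rotation_arc j)" by simp
qed

lemma rotation_braid_pow: "rotation_braid [^]\<^bsub>Q\<^esub> (j::nat) = qbraid (rotation_path j)"
proof (induction j)
  case 0
  have "rotation_arc 0 = (\<lambda>t. e)" by (auto simp: rotation_arc_def linepath_def)
  then have "qbraid (rotation_path 0) = \<one>\<^bsub>Q\<^esub>"
    using closed_rotation_path(2)[OF GL_pow_0] free_class_const[OF e] by simp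
  then show ?case by (simp add: nat_pow_def)
next
  case (Suc j)
  interpret Q: group Q by (rule group_Q)
  have l: "lifts (gpow j ** gpow 1) (rotation_path j +++ act (gpow j) (rotation_path 1))"
    by (rule lifts_join[OF lifts_rotation_path lifts_rotation_path])
  have "rotation_braid [^]\<^bsub>Q\<^esub> Suc j = qbraid (rotation_path j) \<otimes>\<^bsub>Q\<^esub> rotation_braid"
    unfolding Q.nat_pow_Suc Suc ..
  also have "\<dots> = qbraid (rotation_path (Suc j))"
    unfolding rotation_braid_def
    using qbraid_mult[OF lifts_rotation_path lifts_rotation_path] qbraid_cong[OF rotation_path_append l] by simp
  finally show ?case .
qed

lemma rotation_braid_pow_d: "rotation_braid [^]\<^bsub>Q\<^esub> d = meridian_product \<A>"
  unfolding rotation_braid_pow closed_rotation_path(2)[OF gpow_d] rotation_arc_full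
  by (rule full_twist_eq_meridian_product[OF e])

text \<open>
  A braid over \<open>h\<close> permutes the meridians under conjugation as \<open>h\<close> permutes the hyperplanes.
\<close>
lemma qbraid_meridian_product:
  assumes q: "lifts h q" and S: "S \<subseteq> \<A>"
  shows "qbraid q \<otimes>\<^bsub>Q\<^esub> meridian_product S = meridian_product ((`) ((*v) h) ` S) \<otimes>\<^bsub>Q\<^esub> qbraid q"
proof -
  interpret Q: group Q by (rule group_Q)
  have h: "h \<in> W" using q by (simp add: lifts_def)
  have pc: "c \<in> carrier Q" if "c \<in> pure_classes" for c
    using that subgroup.subset[OF pure_classes_subgroup] by blast
  have qc: "qbraid q \<in> carrier Q" by (rule qbraid_in_carrier[OF q])
  have inj: "inj ((`) ((*v) h))"
  proof -
    obtain h' where "h' ** h = mat 1" using W_inverse[OF h] by metis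
    then have "(*v) h' ` (*v) h ` S = S" for S by (simp add: image_image matrix_vector_mul_assoc)
    then show ?thesis by (metis injI)
  qed
  have "finite S" using S finite_reflecting_hyperplanes finite_subset by blast
  then show ?thesis using S
  proof (induction S)
    case empty
    then show ?case using qc by (simp add: meridian_product_empty)
  next
    case (insert H S)
    let ?h = "(`) ((*v) h)"
    have H: "H \<in> \<A>" "S \<subseteq> \<A>" "?h H \<in> \<A>" "?h ` S \<subseteq> \<A>"
      using insert.prems reflecting_hyperplane_image[OF _ h] by auto
    have m: "meridian H \<in> carrier Q" "meridian (?h H) \<in> carrier Q"
      "meridian_product S \<in> carrier Q" "meridian_product (?h ` S) \<in> carrier Q"
      using H meridian_in_pure_classes meridian_product_in_pure_classes pc by auto
    have nin: "?h H \<notin> ?h ` S" using inj insert.hyps(2) by (simp add: inj_image_mem_iff)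
    have "qbraid q \<otimes>\<^bsub>Q\<^esub> meridian_product (insert H S) =
        (qbraid q \<otimes>\<^bsub>Q\<^esub> meridian H) \<otimes>\<^bsub>Q\<^esub> meridian_product S"
      using meridian_product_insert[OF H(1,2) insert.hyps(2)] qc m by (simp add: Q.m_assoc)
    also have "\<dots> = meridian (?h H) \<otimes>\<^bsub>Q\<^esub> (qbraid q \<otimes>\<^bsub>Q\<^esub> meridian_product S)"
      using qbraid_meridian[OF q H(1)] qc m by (simp add: Q.m_assoc)
    also have "\<dots> = meridian (?h H) \<otimes>\<^bsub>Q\<^esub> meridian_product (?h ` S) \<otimes>\<^bsub>Q\<^esub> qbraid q"
      using insert.IH[OF H(2)] qc m by (simp add: Q.m_assoc)
    also have "\<dots> = meridian_product (?h ` insert H S) \<otimes>\<^bsub>Q\<^esub> qbraid q"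
      using meridian_product_insert[OF H(3,4) nin] by simp
    finally show ?case .
  qed
qed

text \<open>
  The product of the conjugates of the correction factor by the powers of the rotation braid runs once
  over each hyperplane and so cancels the full twist.
\<close>
definition torsion_braid :: "(real \<Rightarrow> (complex^'n) set) set set"
  where "torsion_braid = inv\<^bsub>Q\<^esub> meridian_product reps \<otimes>\<^bsub>Q\<^esub> rotation_braid"

lemma torsion_braid_pow:
  assumes "j \<le> d"
  shows "torsion_braid [^]\<^bsub>Q\<^esub> j = inv\<^bsub>Q\<^esub> meridian_product (rotated_reps j) \<otimes>\<^bsub>Q\<^esub> rotation_braid [^]\<^bsub>Q\<^esub> j"
  using assms
proof (induction j)
  interpret Q: group Q by (rule group_Q)
  case 0 show ?case by (simp add: rotated_reps_def meridian_product_empty)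
next
  interpret Q: group Q by (rule group_Q)
  case (Suc j)
  let ?b = rotation_braid and ?F = meridian_product
  have pc: "?F S \<in> carrier Q" if "S \<subseteq> \<A>" for S
    using meridian_product_in_pure_classes[OF that] subgroup.subset[OF pure_classes_subgroup] by blast
  have rj: "rot j ` reps \<subseteq> \<A>" using reps_subset rot_hyperplane by auto
  note car = pc[OF reps_subset] pc[OF rotated_reps_subset[of j]] pc[OF rj] rotation_braid_in_carrier
  have bj: "?b [^]\<^bsub>Q\<^esub> j \<in> carrier Q" using car by simp
  have "(`) ((*v) (gpow j)) ` reps = rot j ` reps" by (simp add: rot_def)
  then have conj: "?b [^]\<^bsub>Q\<^esub> j \<otimes>\<^bsub>Q\<^esub> ?F reps = ?F (rot j ` reps) \<otimes>\<^bsub>Q\<^esub> ?b [^]\<^bsub>Q\<^esub> j"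
    unfolding rotation_braid_pow using qbraid_meridian_product[OF lifts_rotation_path reps_subset, of j] by simp
  have conj': "?b [^]\<^bsub>Q\<^esub> j \<otimes>\<^bsub>Q\<^esub> inv\<^bsub>Q\<^esub> ?F reps = inv\<^bsub>Q\<^esub> ?F (rot j ` reps) \<otimes>\<^bsub>Q\<^esub> ?b [^]\<^bsub>Q\<^esub> j"
  proof -
    have "?F (rot j ` reps) \<otimes>\<^bsub>Q\<^esub> (?b [^]\<^bsub>Q\<^esub> j \<otimes>\<^bsub>Q\<^esub> inv\<^bsub>Q\<^esub> ?F reps) =
        (?F (rot j ` reps) \<otimes>\<^bsub>Q\<^esub> ?b [^]\<^bsub>Q\<^esub> j) \<otimes>\<^bsub>Q\<^esub> inv\<^bsub>Q\<^esub> ?F reps"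
      using car bj by (simp add: Q.m_assoc)
    also have "\<dots> = ?b [^]\<^bsub>Q\<^esub> j"
      unfolding conj[symmetric] using car bj by (simp add: Q.m_assoc)
    finally have "?b [^]\<^bsub>Q\<^esub> j = ?F (rot j ` reps) \<otimes>\<^bsub>Q\<^esub> (?b [^]\<^bsub>Q\<^esub> j \<otimes>\<^bsub>Q\<^esub> inv\<^bsub>Q\<^esub> ?F reps)" ..
    then show ?thesis
      using car bj Q.inv_solve_left[of "?b [^]\<^bsub>Q\<^esub> j \<otimes>\<^bsub>Q\<^esub> inv\<^bsub>Q\<^esub> ?F reps" "?F (rot j ` reps)" "?b [^]\<^bsub>Q\<^esub> j"]
      by simp
  qed
  have U: "rotated_reps (Suc j) = rot j ` reps \<union> rotated_reps j"
    by (simp add: rotated_reps_def lessThan_Suc)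
  have "?F (rotated_reps (Suc j)) = ?F (rot j ` reps) \<otimes>\<^bsub>Q\<^esub> ?F (rotated_reps j)"
    unfolding U using Suc.prems by (intro meridian_product_Un rj rotated_reps_subset rotated_reps_disjoint) simp
  then have inv: "inv\<^bsub>Q\<^esub> ?F (rotated_reps (Suc j)) = inv\<^bsub>Q\<^esub> ?F (rotated_reps j) \<otimes>\<^bsub>Q\<^esub> inv\<^bsub>Q\<^esub> ?F (rot j ` reps)"
    using car by (simp add: Q.inv_mult_group)
  have "torsion_braid [^]\<^bsub>Q\<^esub> Suc j =
      inv\<^bsub>Q\<^esub> ?F (rotated_reps j) \<otimes>\<^bsub>Q\<^esub> (?b [^]\<^bsub>Q\<^esub> j \<otimes>\<^bsub>Q\<^esub> inv\<^bsub>Q\<^esub> ?F reps) \<otimes>\<^bsub>Q\<^esub> ?b"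
    using Suc car bj by (simp add: torsion_braid_def Q.m_assoc)
  also have "\<dots> = inv\<^bsub>Q\<^esub> ?F (rotated_reps (Suc j)) \<otimes>\<^bsub>Q\<^esub> ?b [^]\<^bsub>Q\<^esub> Suc j"
    unfolding conj' inv using car bj by (simp add: Q.m_assoc)
  finally show ?case .
qed

text \<open>
  The power with exponent \<open>d\<close> is trivial by \<open>torsion_braid_pow\<close> and \<open>rotation_braid_pow_d\<close>. A smaller
  positive power is not, because its image in \<open>W\<close> is a nontrivial power of \<open>g\<close>.
\<close>
theorem ord_torsion_braid: "torsion_braid \<in> carrier Q" "group.ord Q torsion_braid = d"
proof -
  interpret Q: group Q by (rule group_Q)
  have pc: "meridian_product S \<in> carrier Q" if "S \<subseteq> \<A>" for S
    using meridian_product_in_pure_classes[OF that] subgroup.subset[OF pure_classes_subgroup] by blast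
  show t: "torsion_braid \<in> carrier Q"
    unfolding torsion_braid_def using pc[OF reps_subset] rotation_braid_in_carrier by simp
  have "torsion_braid [^]\<^bsub>Q\<^esub> d = \<one>\<^bsub>Q\<^esub>"
    using torsion_braid_pow[of d] pc[of \<A>] by (simp add: rotation_braid_pow_d rotated_reps_all)
  then have dvd: "Q.ord torsion_braid dvd d" using Q.pow_eq_id[OF t] by simp
  have "torsion_braid [^]\<^bsub>Q\<^esub> j \<noteq> \<one>\<^bsub>Q\<^esub>" if j: "0 < j" "j < d" for j
  proof
    assume "torsion_braid [^]\<^bsub>Q\<^esub> j = \<one>\<^bsub>Q\<^esub>"
    then have "inv\<^bsub>Q\<^esub> meridian_product (rotated_reps j) \<otimes>\<^bsub>Q\<^esub> qbraid (rotation_path j) = \<one>\<^bsub>Q\<^esub>"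
      using torsion_braid_pow[of j] j by (simp add: rotation_braid_pow)
    then have "qbraid (rotation_path j) = meridian_product (rotated_reps j)"
      using pc[OF rotated_reps_subset] qbraid_in_carrier[OF lifts_rotation_path]
      by (metis Q.inv_closed Q.inv_equality Q.inv_inv Q.l_inv Q.r_inv Q.inv_comm)
    moreover have "meridian_product (rotated_reps j) \<in> pure_classes"
      by (rule meridian_product_in_pure_classes[OF rotated_reps_subset])
    ultimately obtain p where "qbraid (rotation_path j) = qbraid p" "pure_loop p"
      by (auto simp: pure_classes_def)
    then have "gpow j = mat 1" using qbraid_eq_pureD lifts_rotation_path by blast
    then show False using gpow_neq_one j by blast
  qed
  then have "\<not> Q.ord torsion_braid < d"
    using Q.pow_ord_eq_1[OF t] dvd d by (metis dvd_0_left_iff gr0I less_irrefl)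
  then show "Q.ord torsion_braid = d" using dvd_imp_le[OF dvd d] by simp
qed

end

theorem proposition3p1:
  fixes W :: "(complex^'n^'n) set" and x :: "complex^'n" and d :: nat
  assumes "complex_reflection_group W"
    and "x \<in> hyperplane_complement W"
    and "freely_regular_number W d"
  shows "\<exists>b \<in> carrier (quasi_abelianized_braid_group W x).
    group.ord (quasi_abelianized_braid_group W x) b = d"
proof -
  obtain w where w: "regular_element W w d" and free: "acts_freely_on_hyperplanes W (generate GL {w})"
    using assms(3) by (auto simp: freely_regular_number_def)
  obtain e \<zeta> where e: "w \<in> W" "e \<in> hyperplane_complement W" "e \<noteq> 0" "w *v e = \<zeta> *s e" "root_of_unity_order \<zeta> d"
    using w by (auto simp: regular_element_def)
  \<comment> \<open>a power of the regular element with the standard eigenvalue; it lies in the same cyclic group\<close>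
  obtain m where m: "\<zeta> ^ m = cis (2 * pi / d)" using root_of_unity_power_generates[OF e(5)] by blast
  interpret reflection_group W by unfold_locales (rule assms(1))
  let ?g = "w [^]\<^bsub>GL\<^esub> m"
  have gen: "w [^]\<^bsub>GL\<^esub> (j::nat) \<in> generate GL {w}" for j
    by (induction j) (auto simp: GL_pow_0 GL_pow_Suc intro: generate.incl
        generate.one[of GL "{w}", simplified] generate.eng[of _ GL "{w}", simplified])
  have pow: "?g [^]\<^bsub>GL\<^esub> j = w [^]\<^bsub>GL\<^esub> (m * j)" for j :: nat
    by (induction j)
      (simp_all only: GL_pow_0 GL_pow_Suc mult_0_right mult_Suc_right add.commute[of m] GL_pow_add)
  have eig: "?g *v e = cis (2 * pi / d) *s e" using GL_pow_eigenvector[OF e(4), of m] m by simp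
  interpret free_rotation W x ?g d e
  proof unfold_locales
    show "x \<in> hyperplane_complement W" by fact
    show "?g \<in> W" by (rule W_pow[OF e(1)])
    show "0 < d" using e(5) by (simp add: root_of_unity_order_def)
    show "?g [^]\<^bsub>GL\<^esub> j = mat 1"
      if "H \<in> reflecting_hyperplanes W" "(*v) (?g [^]\<^bsub>GL\<^esub> j) ` H = H" for j :: nat and H
      using free gen[of "m * j"] that unfolding pow acts_freely_on_hyperplanes_def by blast
  qed (fact e(2) eig e(3))+
  show ?thesis using ord_torsion_braid by blast
qed

end
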